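(* Let $\phi$ be a non-negative Borel measure on $(0,\infty)$ with $\int_{(0,\infty)}(z^2\wedge z)\,\phi(dz)<\infty$ and $\int_{(0,1)}z\,\phi(dz)=\infty$. Let $\mathrm{LR}\in\{\mathrm{DD},\mathrm{DN},\mathrm{ND},\mathrm{NN},\mathrm{N^*D},\mathrm{N^*N}\}$ and let $(G^-,\mathrm{LR})$ on $C_0(\Omega)$ and $(G^+,\mathrm{LR})$ on $L^1[-1,1]$ be the operators defined in the context, both of which generate positive strongly continuous contraction semigroups. Then the restriction to $L^1[-1,1]$ of the dual of the semigroup generated by $(G^-,\mathrm{LR})$ equals the semigroup generated by $(G^+,\mathrm{LR})$. Conversely, the restriction to $C_0(\Omega)$ of the dual of the semigroup generated by $(G^+,\mathrm{LR})$ equals the semigroup generated by $(G^-,\mathrm{LR})$.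
   Context: Let $\Phi(x)=\Phi^+(x)=\int_x^\infty\phi((y,\infty))\,dy$ for $x>0$, $\Phi(x)=0$ for $x\le 0$, and $\Phi^-(x)=\Phi(-x)$. Functions on $[-1,1]$ are extended by zero to $\mathbb R$ before convolving ($\star$), so on $[-1,1]$: $\Phi^+\star u(x)=\int_{-1}^x\Phi(x-y)u(y)\,dy$ and $\Phi^-\star u(x)=\int_x^1\Phi(y-x)u(y)\,dy$. Derivatives are (weak) derivatives on $(-1,1)$. Define on $[-1,1]$ - $\partial^{\psi}_{\pm}f=\frac{d}{dx}[\Phi^\pm\star f']$ and $\partial^{\psi-1}_{\pm}f=\Phi^\pm\star f'$, for $f\in W^{1,1}[-1,1]$; - $D^{\psi}_+f=\frac{d^2}{dx^2}[\Phi\star f]$ and $D^{\psi-1}_+f=\frac{d}{dx}[\Phi\star f]$, for $f\in L^1[-1,1]$. For each $\mathrm{LR}$, $\Omega$ is the interval with endpoints $-1,1$ which excludes $-1$ iff $\mathrm L=\mathrm D$ and excludes $1$ iff $\mathrm R=\mathrm D$. $C_0(\Omega)$ is the closure in the supremum norm of the continuous functions with compact support in $\Omega$. Backward operators: $G^-=\partial^{\psi}_-$ for all six $\mathrm{LR}$, on $X=C_0(\Omega)$. Forward operators, on $X=L^1[-1,1]$: $G^+=\partial^{\psi}_+$ for $\mathrm{DD},\mathrm{DN},\mathrm{ND},\mathrm{NN}$ and $G^+=D^{\psi}_+$ for $\mathrm{N^*D},\mathrm{N^*N}$. The domain $\mathcal D(G^\pm,\mathrm{LR})$ is the set of $f\in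 X$ (with $f\in W^{1,1}[-1,1]$ when the operator is $\partial^\psi_\pm$) such that $G^\pm f\in X$, $f$ satisfies boundary condition $\mathrm L$ at $-1$ and boundary condition $\mathrm R$ at $1$; $(G^\pm,\mathrm{LR})$ denotes $G^\pm:\mathcal D(G^\pm,\mathrm{LR})\to X$. Boundary conditions at an endpoint $e\in\{-1,1\}$ (one-sided limits from inside $(-1,1)$): - $\mathrm D$: $\lim_{x\to e}f(x)=0$. - $\mathrm N$: $\lim_{x\to e}\partial^{\psi-1}_\pm f(x)=0$ (sign $-$ for $G^-$, sign $+$ for $G^+$), except that for $(D^\psi_+,\mathrm{N^*N})$ the condition at $1$ is $\lim_{x\uparrow1}D^{\psi-1}_+f(x)=0$. - $\mathrm{N^*}$ (at $-1$): $\lim_{x\downarrow-1}f'(x)=0$ for $G^-$; $\lim_{x\downarrow-1}D^{\psi-1}_+f(x)=0$ for $G^+=D^\psi_+$. The dual of $C_0(\Omega)$ is the space of finite signed Borel measures on $\Omega$, containing $L^1[-1,1]$ via $g\mapsto g\,dx$; the dual of $L^1[-1,1]$ is $L^\infty[-1,1]\supset C_0(\Omega)$. The dual of a semigroup $(P_t)$ on $X$ is $(P_t^* )$ on $X^*$. *)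

theory Defs
  imports "HOL-Analysis.Analysis"
begin
text \<open>
  Functions on subsets of \<open>[-1,1]\<close> are total functions on the reals. Elements of \<open>L\<^sup>1[-1,1]\<close> are
  represented by integrable functions (arbitrary outside \<open>[-1,1]\<close>), and two representatives denote
  the same element iff their difference has seminorm \<open>0\<close>. Elements of \<open>C\<^sub>0(\<Omega>)\<close> vanish outside
  \<open>\<Omega>\<close>, so that for them equality is equality of functions.
\<close>

definition L1 :: "(real \<Rightarrow> real) set" where
  "L1 = {f. set_integrable lborel {-1..1} f}"

definition L1_norm :: "(real \<Rightarrow> real) \<Rightarrow> real" where
  "L1_norm f = (LBINT x:{-1..1}. \<bar>f x\<bar>)"

definition Cc :: "real set \<Rightarrow> (real \<Rightarrow> real) set" where
  "Cc \<Omega> = {f. continuous_on \<Omega> f \<and> (\<exists>K. compact K \<and> K \<subseteq> \<Omega> \<and> (\<forall>x. x \<notin> K \<longrightarrow> f x = 0))}"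

definition C0 :: "real set \<Rightarrow> (real \<Rightarrow> real) set" where
  "C0 \<Omega> = {f. \<forall>\<epsilon>>0. \<exists>g\<in>Cc \<Omega>. \<forall>x. \<bar>f x - g x\<bar> < \<epsilon>}"

definition sup_norm :: "(real \<Rightarrow> real) \<Rightarrow> real" where
  "sup_norm f = (SUP x\<in>{-1..1}. \<bar>f x\<bar>)"

definition test_function :: "(real \<Rightarrow> real) \<Rightarrow> bool" where
  "test_function \<eta> \<longleftrightarrow>
     (\<forall>n x. (deriv ^^ n) \<eta> differentiable (at x)) \<and>
     (\<exists>K. compact K \<and> K \<subseteq> {-1<..<1} \<and> (\<forall>x. x \<notin> K \<longrightarrow> \<eta> x = 0))"

definition loc_integrable :: "(real \<Rightarrow> real) \<Rightarrow> bool" where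
  "loc_integrable f \<longleftrightarrow> (\<forall>K. compact K \<and> K \<subseteq> {-1<..<1} \<longrightarrow> set_integrable lborel K f)"

definition weak_deriv :: "(real \<Rightarrow> real) \<Rightarrow> (real \<Rightarrow> real) \<Rightarrow> bool" where
  "weak_deriv f g \<longleftrightarrow> loc_integrable f \<and> loc_integrable g \<and>
     (\<forall>\<eta>. test_function \<eta> \<longrightarrow>
        (LBINT x:{-1<..<1}. f x * deriv \<eta> x) = - (LBINT x:{-1<..<1}. g x * \<eta> x))"

text \<open>
  Boundary values are taken of functions that are determined only almost everywhere, so some
  representative is required to have the limit. For functions with a continuous representative on
  \<open>(-1,1)\<close> this is the ordinary limit of that representative.
\<close>

definition vanishes_at :: "(real \<Rightarrow> real) \<Rightarrow> real filter \<Rightarrow> bool" where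
  "vanishes_at f F \<longleftrightarrow>
     (\<exists>g. (AE x in lborel. x \<in> {-1<..<1} \<longrightarrow> g x = f x) \<and> (g \<longlongrightarrow> 0) F)"

definition Phi :: "real measure \<Rightarrow> real \<Rightarrow> real" where
  "Phi \<phi> x = (if x > 0 then (LBINT y:{x<..}. measure \<phi> {y<..}) else 0)"

abbreviation Phi_minus :: "real measure \<Rightarrow> real \<Rightarrow> real" where
  "Phi_minus \<phi> \<equiv> (\<lambda>x. Phi \<phi> (- x))"

definition conv :: "(real \<Rightarrow> real) \<Rightarrow> (real \<Rightarrow> real) \<Rightarrow> real \<Rightarrow> real" where
  "conv k u x = (LBINT y:{-1..1}. k (x - y) * u y)"

text \<open>
  The operators are given as relations between a function and (any representative of) its image.
  With \<open>k\<close> one of the kernels \<open>Phi \<phi>\<close>, \<open>Phi_minus \<phi>\<close>, the relation \<open>caputo k\<close> is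
  \<open>\<partial>\<^sup>\<psi>\<^sub>\<plusminus>\<close> and \<open>caputo' k\<close> is \<open>\<partial>\<^sup>\<psi>\<^sup>-\<^sup>1\<^sub>\<plusminus>\<close>; both contain the requirement that the first argument
  is in \<open>W\<^sup>1\<^sup>,\<^sup>1[-1,1]\<close>. The relations \<open>riemann_liouville\<close> and \<open>riemann_liouville'\<close> are
  \<open>D\<^sup>\<psi>\<^sub>+\<close> and \<open>D\<^sup>\<psi>\<^sup>-\<^sup>1\<^sub>+\<close>.
\<close>

definition W11_deriv :: "(real \<Rightarrow> real) \<Rightarrow> (real \<Rightarrow> real) \<Rightarrow> bool" where
  "W11_deriv f f' \<longleftrightarrow> f \<in> L1 \<and> f' \<in> L1 \<and> weak_deriv f f'"

definition caputo' :: "(real \<Rightarrow> real) \<Rightarrow> (real \<Rightarrow> real) \<Rightarrow> (real \<Rightarrow> real) \<Rightarrow> bool" where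
  "caputo' k f F \<longleftrightarrow> (\<exists>f'. W11_deriv f f' \<and> F = conv k f')"

definition caputo :: "(real \<Rightarrow> real) \<Rightarrow> (real \<Rightarrow> real) \<Rightarrow> (real \<Rightarrow> real) \<Rightarrow> bool" where
  "caputo k f h \<longleftrightarrow> (\<exists>F. caputo' k f F \<and> weak_deriv F h)"

definition riemann_liouville' :: "real measure \<Rightarrow> (real \<Rightarrow> real) \<Rightarrow> (real \<Rightarrow> real) \<Rightarrow> bool" where
  "riemann_liouville' \<phi> f g \<longleftrightarrow> f \<in> L1 \<and> weak_deriv (conv (Phi \<phi>) f) g"

definition riemann_liouville :: "real measure \<Rightarrow> (real \<Rightarrow> real) \<Rightarrow> (real \<Rightarrow> real) \<Rightarrow> bool" where
  "riemann_liouville \<phi> f h \<longleftrightarrow> (\<exists>g. riemann_liouville' \<phi> f g \<and> weak_deriv g h)"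

datatype left_bc = LD | LN | LNstar
datatype right_bc = RD | RN

definition Omega :: "left_bc \<Rightarrow> right_bc \<Rightarrow> real set" where
  "Omega l r = {-1..1} - (if l = LD then {-1} else {}) - (if r = RD then {1} else {})"

fun left_cond_bwd :: "real measure \<Rightarrow> left_bc \<Rightarrow> (real \<Rightarrow> real) \<Rightarrow> bool" where
  "left_cond_bwd \<phi> LD f \<longleftrightarrow> vanishes_at f (at_right (-1))"
| "left_cond_bwd \<phi> LN f \<longleftrightarrow> (\<exists>F. caputo' (Phi_minus \<phi>) f F \<and> vanishes_at F (at_right (-1)))"
| "left_cond_bwd \<phi> LNstar f \<longleftrightarrow> (\<exists>f'. W11_deriv f f' \<and> vanishes_at f' (at_right (-1)))"

fun right_cond_bwd :: "real measure \<Rightarrow> right_bc \<Rightarrow> (real \<Rightarrow> real) \<Rightarrow> bool" where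
  "right_cond_bwd \<phi> RD f \<longleftrightarrow> vanishes_at f (at_left 1)"
| "right_cond_bwd \<phi> RN f \<longleftrightarrow> (\<exists>F. caputo' (Phi_minus \<phi>) f F \<and> vanishes_at F (at_left 1))"

fun left_cond_fwd :: "real measure \<Rightarrow> left_bc \<Rightarrow> (real \<Rightarrow> real) \<Rightarrow> bool" where
  "left_cond_fwd \<phi> LD f \<longleftrightarrow> vanishes_at f (at_right (-1))"
| "left_cond_fwd \<phi> LN f \<longleftrightarrow> (\<exists>F. caputo' (Phi \<phi>) f F \<and> vanishes_at F (at_right (-1)))"
| "left_cond_fwd \<phi> LNstar f \<longleftrightarrow> (\<exists>g. riemann_liouville' \<phi> f g \<and> vanishes_at g (at_right (-1)))"

fun right_cond_fwd :: "real measure \<Rightarrow> left_bc \<Rightarrow> right_bc \<Rightarrow> (real \<Rightarrow> real) \<Rightarrow> bool" where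
  "right_cond_fwd \<phi> l RD f \<longleftrightarrow> vanishes_at f (at_left 1)"
| "right_cond_fwd \<phi> l RN f \<longleftrightarrow>
     (if l = LNstar
      then (\<exists>g. riemann_liouville' \<phi> f g \<and> vanishes_at g (at_left 1))
      else (\<exists>F. caputo' (Phi \<phi>) f F \<and> vanishes_at F (at_left 1)))"

definition G_minus ::
  "real measure \<Rightarrow> left_bc \<Rightarrow> right_bc \<Rightarrow> ((real \<Rightarrow> real) \<times> (real \<Rightarrow> real)) set" where
  "G_minus \<phi> l r = {(f, h). f \<in> C0 (Omega l r) \<and> h \<in> C0 (Omega l r) \<and>
     caputo (Phi_minus \<phi>) f h \<and> left_cond_bwd \<phi> l f \<and> right_cond_bwd \<phi> r f}"

definition G_plus ::
  "real measure \<Rightarrow> left_bc \<Rightarrow> right_bc \<Rightarrow> ((real \<Rightarrow> real) \<times> (real \<Rightarrow> real)) set" where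
  "G_plus \<phi> l r = {(f, h). f \<in> L1 \<and> h \<in> L1 \<and>
     (if l = LNstar then riemann_liouville \<phi> f h else caputo (Phi \<phi>) f h) \<and>
     left_cond_fwd \<phi> l f \<and> right_cond_fwd \<phi> l r f}"

text \<open>
  Throughout, \<open>X\<close> is a space of functions with seminorm \<open>N\<close>, standing for the normed space obtained
  by identifying functions at seminorm distance \<open>0\<close>; all identities are therefore stated modulo
  \<open>N\<close>. In particular \<open>N (\<lambda>x. \<bar>f x\<bar> - f x) = 0\<close> says that \<open>f \<ge> 0\<close> in the order of that space
  (almost everywhere for \<open>L\<^sup>1\<close>, everywhere for \<open>C\<^sub>0\<close>).
\<close>

definition pos_contraction_semigroup ::
  "(real \<Rightarrow> real) set \<Rightarrow> ((real \<Rightarrow> real) \<Rightarrow> real) \<Rightarrow> (real \<Rightarrow> (real \<Rightarrow> real) \<Rightarrow> (real \<Rightarrow> real)) \<Rightarrow> bool" where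
  "pos_contraction_semigroup X N T \<longleftrightarrow>
     (\<forall>t\<ge>0. \<forall>f\<in>X. T t f \<in> X) \<and>
     (\<forall>t\<ge>0. \<forall>f\<in>X. \<forall>g\<in>X. \<forall>a b.
        N (\<lambda>x. T t (\<lambda>y. a * f y + b * g y) x - (a * T t f x + b * T t g x)) = 0) \<and>
     (\<forall>t\<ge>0. \<forall>f\<in>X. N (T t f) \<le> N f) \<and>
     (\<forall>t\<ge>0. \<forall>f\<in>X. N (\<lambda>x. \<bar>f x\<bar> - f x) = 0 \<longrightarrow> N (\<lambda>x. \<bar>T t f x\<bar> - T t f x) = 0) \<and>
     (\<forall>f\<in>X. N (\<lambda>x. T 0 f x - f x) = 0) \<and>
     (\<forall>s\<ge>0. \<forall>t\<ge>0. \<forall>f\<in>X. N (\<lambda>x. T (s + t) f x - T s (T t f) x) = 0) \<and>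
     (\<forall>f\<in>X. ((\<lambda>t. N (\<lambda>x. T t f x - f x)) \<longlongrightarrow> 0) (at_right 0))"

definition generator ::
  "(real \<Rightarrow> real) set \<Rightarrow> ((real \<Rightarrow> real) \<Rightarrow> real) \<Rightarrow> (real \<Rightarrow> (real \<Rightarrow> real) \<Rightarrow> (real \<Rightarrow> real))
   \<Rightarrow> ((real \<Rightarrow> real) \<times> (real \<Rightarrow> real)) set" where
  "generator X N T = {(f, h). f \<in> X \<and> h \<in> X \<and>
     ((\<lambda>t. N (\<lambda>x. (T t f x - f x) / t - h x)) \<longlongrightarrow> 0) (at_right 0)}"

definition dual_space ::
  "(real \<Rightarrow> real) set \<Rightarrow> ((real \<Rightarrow> real) \<Rightarrow> real) \<Rightarrow> ((real \<Rightarrow> real) \<Rightarrow> real) set" where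
  "dual_space X N = {\<mu> \<in> extensional X.
     (\<forall>f\<in>X. \<forall>g\<in>X. \<forall>a b. \<mu> (\<lambda>x. a * f x + b * g x) = a * \<mu> f + b * \<mu> g) \<and>
     (\<exists>C. \<forall>f\<in>X. \<bar>\<mu> f\<bar> \<le> C * N f)}"

definition dual_op ::
  "(real \<Rightarrow> real) set \<Rightarrow> ((real \<Rightarrow> real) \<Rightarrow> real) \<Rightarrow> ((real \<Rightarrow> real) \<Rightarrow> (real \<Rightarrow> real))
   \<Rightarrow> ((real \<Rightarrow> real) \<Rightarrow> real) \<Rightarrow> ((real \<Rightarrow> real) \<Rightarrow> real)" where
  "dual_op X N S = (\<lambda>\<mu>\<in>dual_space X N. \<lambda>f\<in>X. \<mu> (S f))"

text \<open>
  The functional induced by the measure \<open>g dx\<close> (for \<open>X = C\<^sub>0(\<Omega>)\<close>), respectively by the bounded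
  function \<open>g\<close> (for \<open>X = L\<^sup>1[-1,1]\<close>).
\<close>

definition dual_embed ::
  "(real \<Rightarrow> real) set \<Rightarrow> (real \<Rightarrow> real) \<Rightarrow> ((real \<Rightarrow> real) \<Rightarrow> real)" where
  "dual_embed X g = (\<lambda>f\<in>X. LBINT x:{-1..1}. f x * g x)"

end

(*
For f in D(G^-) and g in D(G^+) one has <G^- f, g> = <f, G^+ g>. The semigroup duality follows:
with h = t/n the difference <P_t f, g> - <f, Q_t g> telescopes into n terms
<P_h a, b> - <a, Q_h b> with a = P_{kh} f and b = Q_{(n-k-1)h} g in the domains, each o(h)
uniformly in k, and domains of generators are dense.

For the generators, write F = Phi^- * f'. Integration by parts reduces the claim to
<F, g'> = <f', Phi^+ * g'> (Caputo case) or <F', g> = - <f', (Phi^+ * g)'> (Riemann-Liouville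
case), but these convolution integrals need not converge absolutely. Shifting one factor by s
makes the identity absolutely convergent for almost every s, and one then lets s tend to 0
(respectively differentiates in s at 0), using that both convolutions have absolutely continuous
representatives. The boundary terms vanish by the boundary conditions; in the N* case
Phi^+ * g may jump at -1, which is compensated by f'(-1+) = 0.
*)
theory Submission
  imports Defs
begin

section \<open>Density of the generator domain and duality of contraction semigroups\<close>

text \<open>The data are merely integrable: \<open>Phi \<phi>\<close> blows up at 0 but is
  integrable on (0,2], and f' and g' (or g itself) lie in L^1. The double integral behind each
  pairing is thus a convolution of three L^1 functions evaluated at one point, and such a
  convolution is defined only almost everywhere; hence the shift s. A shift pushes one function
  across an endpoint, so that a slab of width s is lost there. The slab is harmless in the limit s
  to 0, but in a difference quotient it is divided by s, and then the boundary conditions have to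
  make the integrand small on it. Weak derivatives are tested against smooth functions, so the
  absolutely continuous representatives come from a du Bois-Reymond argument with explicit bump
  functions. An L^1 function has no endpoint values; each boundary condition is therefore moved to a
  continuous representative where there is one and otherwise kept as an almost everywhere smallness
  near the endpoint.\<close>

locale function_space =
  fixes X :: "(real \<Rightarrow> real) set" and N :: "(real \<Rightarrow> real) \<Rightarrow> real"
  assumes lincomb_closed: "f \<in> X \<Longrightarrow> g \<in> X \<Longrightarrow> (\<lambda>x. a * f x + b * g x) \<in> X"
    and N_nonneg: "f \<in> X \<Longrightarrow> 0 \<le> N f"
    and N_lincomb: "f \<in> X \<Longrightarrow> g \<in> X \<Longrightarrow> N (\<lambda>x. a * f x + b * g x) \<le> \<bar>a\<bar> * N f + \<bar>b\<bar> * N g"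
    and X_complete: "(\<And>n. s n \<in> X) \<Longrightarrow>
      (\<And>e. e > 0 \<Longrightarrow> \<exists>M. \<forall>m\<ge>M. \<forall>n\<ge>M. N (\<lambda>x. s m x - s n x) < e) \<Longrightarrow>
      \<exists>g\<in>X. (\<lambda>n. N (\<lambda>x. s n x - g x)) \<longlonglongrightarrow> 0"
    and zero_closed: "(\<lambda>x. 0) \<in> X"
begin

lemma scale_closed: "f \<in> X \<Longrightarrow> (\<lambda>x. a * f x) \<in> X"
  using lincomb_closed[of f f a 0] by simp

lemma add_closed: "f \<in> X \<Longrightarrow> g \<in> X \<Longrightarrow> (\<lambda>x. f x + g x) \<in> X"
  using lincomb_closed[of f g 1 1] by simp

lemma diff_closed: "f \<in> X \<Longrightarrow> g \<in> X \<Longrightarrow> (\<lambda>x. f x - g x) \<in> X"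
  using lincomb_closed[of f g 1 "-1"] by simp

lemma divide_closed: "f \<in> X \<Longrightarrow> (\<lambda>x. f x / c) \<in> X"
  using scale_closed[of f "1 / c"] by simp

lemma sum_closed: "(\<And>i. i \<in> I \<Longrightarrow> F i \<in> X) \<Longrightarrow> (\<lambda>x. \<Sum>i\<in>I. F i x) \<in> X"
  by (induction I rule: infinite_finite_induct) (simp_all add: zero_closed add_closed)

lemmas closed = scale_closed add_closed diff_closed divide_closed

lemma N_zero: "N (\<lambda>x. 0) = 0"
  using N_lincomb[OF zero_closed zero_closed, of 0 0] N_nonneg[OF zero_closed] by simp

lemma N_scale_le: "f \<in> X \<Longrightarrow> N (\<lambda>x. a * f x) \<le> \<bar>a\<bar> * N f"
  using N_lincomb[of f f a 0] by simp

lemma N_divide_le: "f \<in> X \<Longrightarrow> c > 0 \<Longrightarrow> N (\<lambda>x. f x / c) \<le> N f / c"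
  using N_scale_le[of f "1 / c"] by simp

lemma N_add: "f \<in> X \<Longrightarrow> g \<in> X \<Longrightarrow> N (\<lambda>x. f x + g x) \<le> N f + N g"
  using N_lincomb[of f g 1 1] by simp

lemma N_diff: "f \<in> X \<Longrightarrow> g \<in> X \<Longrightarrow> N (\<lambda>x. f x - g x) \<le> N f + N g"
  using N_lincomb[of f g 1 "-1"] by simp

lemma N_commute: "f \<in> X \<Longrightarrow> g \<in> X \<Longrightarrow> N (\<lambda>x. f x - g x) = N (\<lambda>x. g x - f x)"
  using N_scale_le[OF diff_closed, of f g "-1"] N_scale_le[OF diff_closed, of g f "-1"] by simp

lemma N_triangle:
  "f \<in> X \<Longrightarrow> g \<in> X \<Longrightarrow> h \<in> X \<Longrightarrow> N (\<lambda>x. f x - h x) \<le> N (\<lambda>x. f x - g x) + N (\<lambda>x. g x - h x)"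
  using N_add[OF diff_closed diff_closed, of f g g h] by simp

lemma N_sum: "(\<And>i. i \<in> I \<Longrightarrow> F i \<in> X) \<Longrightarrow> N (\<lambda>x. \<Sum>i\<in>I. F i x) \<le> (\<Sum>i\<in>I. N (F i))"
proof (induction I rule: infinite_finite_induct)
  case (insert i I)
  then have "N (\<lambda>x. F i x + (\<Sum>i\<in>I. F i x)) \<le> N (F i) + N (\<lambda>x. \<Sum>i\<in>I. F i x)"
    by (intro N_add sum_closed) auto
  with insert show ?case by force
qed (simp_all add: N_zero)

text \<open>\<open>n\<close> and \<open>c\<close> are independent because later a sum of m end terms
  is divided by the number 2^n of all nodes.\<close>

lemma N_average_le:
  fixes n :: nat and e c :: real
  assumes "\<And>i. i < n \<Longrightarrow> F i \<in> X" "\<And>i. i < n \<Longrightarrow> N (F i) \<le> e" "c > 0"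
  shows "N (\<lambda>x. (\<Sum>i<n. F i x) / c) \<le> n * e / c"
proof -
  have "N (\<lambda>x. (\<Sum>i<n. F i x) / c) \<le> N (\<lambda>x. \<Sum>i<n. F i x) / c"
    using assms by (intro N_divide_le sum_closed) auto
  also have "\<dots> \<le> (\<Sum>i<n. N (F i)) / c"
    using assms by (intro divide_right_mono N_sum) auto
  also have "\<dots> \<le> (\<Sum>i<n. e) / c"
    using assms by (intro divide_right_mono sum_mono) auto
  finally show ?thesis by simp
qed

end

section \<open>Contraction semigroups and time averages of their orbits\<close>

locale contraction_semigroup = function_space +
  fixes T :: "real \<Rightarrow> (real \<Rightarrow> real) \<Rightarrow> (real \<Rightarrow> real)"
  assumes pcs: "pos_contraction_semigroup X N T"
begin

lemma T_closed: "t \<ge> 0 \<Longrightarrow> f \<in> X \<Longrightarrow> T t f \<in> X"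
  using pcs by (simp add: pos_contraction_semigroup_def)

lemma T_lincomb: "t \<ge> 0 \<Longrightarrow> f \<in> X \<Longrightarrow> g \<in> X \<Longrightarrow>
    N (\<lambda>x. T t (\<lambda>y. a * f y + b * g y) x - (a * T t f x + b * T t g x)) = 0"
  using pcs by (simp add: pos_contraction_semigroup_def)

lemma T_contraction: "t \<ge> 0 \<Longrightarrow> f \<in> X \<Longrightarrow> N (T t f) \<le> N f"
  using pcs by (simp add: pos_contraction_semigroup_def)

lemma T_zero: "f \<in> X \<Longrightarrow> N (\<lambda>x. T 0 f x - f x) = 0"
  using pcs by (simp add: pos_contraction_semigroup_def)

lemma T_add: "s \<ge> 0 \<Longrightarrow> t \<ge> 0 \<Longrightarrow> f \<in> X \<Longrightarrow> N (\<lambda>x. T (s + t) f x - T s (T t f) x) = 0"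
  using pcs by (simp add: pos_contraction_semigroup_def)

lemma T_continuous: "f \<in> X \<Longrightarrow> ((\<lambda>t. N (\<lambda>x. T t f x - f x)) \<longlongrightarrow> 0) (at_right 0)"
  using pcs by (simp add: pos_contraction_semigroup_def)

lemma T_diff:
  assumes "t \<ge> 0" "f \<in> X" "g \<in> X"
  shows "N (\<lambda>x. T t (\<lambda>y. f y - g y) x - (T t f x - T t g x)) = 0"
  using T_lincomb[OF assms, of 1 "-1"] by simp

lemma T_dist_le:
  assumes "t \<ge> 0" "f \<in> X" "g \<in> X"
  shows "N (\<lambda>x. T t f x - T t g x) \<le> N (\<lambda>x. f x - g x)"
proof -
  have "N (\<lambda>x. T t f x - T t g x) \<le>
      N (\<lambda>x. T t (\<lambda>y. f y - g y) x) + N (\<lambda>x. T t (\<lambda>y. f y - g y) x - (T t f x - T t g x))"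
    using N_diff[of "T t (\<lambda>y. f y - g y)" "\<lambda>x. T t (\<lambda>y. f y - g y) x - (T t f x - T t g x)"] assms
    by (simp add: closed T_closed)
  also have "\<dots> \<le> N (\<lambda>x. f x - g x)"
    using T_diff[OF assms] T_contraction[OF assms(1) diff_closed[OF assms(2,3)]] by simp
  finally show ?thesis .
qed

lemma T_scale:
  assumes "t \<ge> 0" "f \<in> X"
  shows "N (\<lambda>x. T t (\<lambda>y. a * f y) x - a * T t f x) = 0"
  using T_lincomb[OF assms assms(2), of a 0] by simp

text \<open>Additivity holds only up to \<open>N\<close>, so the null errors of the single additions
  are collected by induction. For the empty sum, contractivity makes \<open>T t\<close> of the zero
  function null.\<close>

lemma T_sum_zero:
  assumes "t \<ge> 0"
  shows "(\<And>i. i < n \<Longrightarrow> F i \<in> X) \<Longrightarrow>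
    N (\<lambda>x. T t (\<lambda>y. \<Sum>i<n. F i y) x - (\<Sum>i<(n::nat). T t (F i) x)) = 0"
proof (induction n)
  case 0
  have "N (\<lambda>x. T t (\<lambda>y. 0) x) \<le> 0"
    using T_contraction[OF assms zero_closed] N_zero by simp
  then show ?case using N_nonneg[OF T_closed[OF assms zero_closed]] by simp
next
  case (Suc n)
  let ?S = "\<lambda>y. \<Sum>i<n. F i y"
  have S: "?S \<in> X" "F n \<in> X" "(\<lambda>x. \<Sum>i<n. T t (F i) x) \<in> X"
    using Suc assms by (auto intro!: sum_closed T_closed)
  let ?a = "\<lambda>x. T t (\<lambda>y. ?S y + F n y) x - (T t ?S x + T t (F n) x)"
  let ?b = "\<lambda>x. T t ?S x - (\<Sum>i<n. T t (F i) x)"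
  have ab: "?a \<in> X" "?b \<in> X" using S assms by (simp_all add: closed T_closed)
  have "N ?a = 0" using T_lincomb[OF assms S(1,2), of 1 1] by simp
  moreover have "N ?b = 0" using Suc by simp
  ultimately have "N (\<lambda>x. ?a x + ?b x) \<le> 0" using N_add[OF ab] by simp
  moreover have "0 \<le> N (\<lambda>x. ?a x + ?b x)" using ab by (intro N_nonneg add_closed)
  moreover have "(\<lambda>x. ?a x + ?b x) = (\<lambda>x. T t (\<lambda>y. \<Sum>i<Suc n. F i y) x - (\<Sum>i<Suc n. T t (F i) x))"
    by (simp add: fun_eq_iff)
  ultimately show ?case by simp
qed

text \<open>Up to a null function the increment is T s applied to T (t - s) f - f, and T s
  contracts. Strong continuity at 0 thus becomes uniform continuity of the whole orbit.\<close>

lemma T_increment_le: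
  assumes "0 \<le> s" "s \<le> t" "f \<in> X"
  shows "N (\<lambda>x. T t f x - T s f x) \<le> N (\<lambda>x. T (t - s) f x - f x)"
proof -
  have "N (\<lambda>x. T t f x - T s f x) \<le>
      N (\<lambda>x. T t f x - T s (T (t - s) f) x) + N (\<lambda>x. T s (T (t - s) f) x - T s f x)"
    using assms by (intro N_triangle T_closed) auto
  also have "\<dots> \<le> 0 + N (\<lambda>x. T (t - s) f x - f x)"
    using T_add[of s "t - s" f] T_dist_le[of s "T (t - s) f" f] assms by (simp add: T_closed)
  finally show ?thesis by simp
qed

lemma T_modulus:
  assumes "f \<in> X" "e > 0"
  obtains d where "d > 0" "\<And>s. 0 \<le> s \<Longrightarrow> s \<le> d \<Longrightarrow> N (\<lambda>x. T s f x - f x) \<le> e"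
proof -
  have "\<forall>\<^sub>F s in at_right 0. N (\<lambda>x. T s f x - f x) < e"
    using T_continuous[OF assms(1)] assms(2) by (rule order_tendstoD)
  then obtain d where d: "d > 0" "\<And>s. 0 < s \<Longrightarrow> s < d \<Longrightarrow> N (\<lambda>x. T s f x - f x) < e"
    by (auto simp: eventually_at_right_field)
  show ?thesis
  \<comment> \<open>Halving passes to a closed interval; s = 0 lies outside the filter
    \<open>at_right 0\<close> and is covered by \<open>T_zero\<close>.\<close>
  proof (rule that[of "d / 2"])
    fix s assume "0 \<le> s" "s \<le> d / 2"
    then show "N (\<lambda>x. T s f x - f x) \<le> e"
      using d T_zero[OF assms(1)] assms(2) by (cases "s = 0") (force intro: less_imp_le)+
  qed (use d in simp)
qed

text \<open>Dyadic Riemann sums for the mean of \<open>s \<mapsto> T s f\<close> over \<open>[0, d]\<close>. They replace the Bochner integral,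
  which is not available on the seminormed space \<open>X\<close>.\<close>

definition riemann_mean :: "(real \<Rightarrow> real) \<Rightarrow> real \<Rightarrow> nat \<Rightarrow> (real \<Rightarrow> real)" where
  "riemann_mean f d n = (\<lambda>x. (\<Sum>k<(2::nat) ^ n. T (k * (d / 2 ^ n)) f x) / 2 ^ n)"

lemma riemann_mean_closed: "f \<in> X \<Longrightarrow> d \<ge> 0 \<Longrightarrow> riemann_mean f d n \<in> X"
  unfolding riemann_mean_def by (intro closed sum_closed T_closed) auto

lemma riemann_mean_dist_le:
  assumes f: "f \<in> X" and d: "d \<ge> 0"
    and e: "\<And>s. 0 \<le> s \<Longrightarrow> s \<le> d \<Longrightarrow> N (\<lambda>x. T s f x - f x) \<le> e"
  shows "N (\<lambda>x. riemann_mean f d n x - f x) \<le> e"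
proof -
  have "N (\<lambda>x. riemann_mean f d n x - f x) =
      N (\<lambda>x. (\<Sum>k<(2::nat) ^ n. T (k * (d / 2 ^ n)) f x - f x) / 2 ^ n)"
    by (simp add: riemann_mean_def sum_subtractf diff_divide_distrib)
  also have "\<dots> \<le> ((2::nat) ^ n) * e / 2 ^ n"
  proof (rule N_average_le)
    fix k :: nat assume "k < 2 ^ n"
    then have "real k \<le> 2 ^ n" by (metis less_imp_le of_nat_le_iff of_nat_numeral of_nat_power)
    then have "real k * (d / 2 ^ n) \<le> d" using d mult_right_mono[of "real k" "2 ^ n" "d / 2 ^ n"] by simp
    then show "N (\<lambda>x. T (k * (d / 2 ^ n)) f x - f x) \<le> e" using d by (intro e) auto
  qed (use f d in \<open>auto intro!: closed T_closed\<close>)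
  finally show ?thesis by simp
qed

text \<open>Each fine node is compared with the nearest coarse node to its left, which is less than
  one coarse mesh width d / 2^n away; the orbit varies by at most e over that time.\<close>

lemma riemann_mean_refine:
  assumes f: "f \<in> X" and d: "d \<ge> 0" and "n \<le> m"
    and e: "\<And>s. 0 \<le> s \<Longrightarrow> s \<le> d / 2 ^ n \<Longrightarrow> N (\<lambda>x. T s f x - f x) \<le> e"
  shows "N (\<lambda>x. riemann_mean f d m x - riemann_mean f d n x) \<le> e"
proof -
  define q :: nat where "q = 2 ^ (m - n)"
  have q: "q > 0" "(2::nat) ^ m = q * 2 ^ n" "(2::real) ^ m = real q * 2 ^ n"
    using \<open>n \<le> m\<close> by (simp_all add: q_def flip: power_add)
  \<comment> \<open>The coarse sum is rewritten over the fine index set: every coarse node is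
    repeated q times, as \<open>k div q\<close>.\<close>
  have regroup: "(\<Sum>k<(2::nat) ^ m. G (k div q)) = q * (\<Sum>k<(2::nat) ^ n. G k)" for G :: "nat \<Rightarrow> real"
  proof -
    have "(\<Sum>k<q * 2 ^ n. G (k div q)) = (\<Sum>i<2 ^ n. \<Sum>k = i * q..<i * q + q. G (k div q))"
      using sum.nat_group[of "\<lambda>k. G (k div q)" q "2 ^ n"] by (simp add: mult.commute)
    also have "\<dots> = (\<Sum>i<2 ^ n. \<Sum>k = i * q..<i * q + q. G i)"
    proof (intro sum.cong refl)
      fix i k assume "k \<in> {i * q..<i * q + q}"
      then have "k div q = i"
        by (intro div_nat_eqI) (auto simp: mult.commute)
      then show "G (k div q) = G i" by simp
    qed
    finally show ?thesis using q by (simp add: sum_distrib_left)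
  qed
  have "(\<lambda>x. riemann_mean f d m x - riemann_mean f d n x) =
     (\<lambda>x. (\<Sum>k<(2::nat) ^ m. T (k * (d / 2 ^ m)) f x - T (real (k div q) * (d / 2 ^ n)) f x) / 2 ^ m)"
  proof
    fix x
    have "riemann_mean f d n x = (\<Sum>k<(2::nat) ^ m. T (real (k div q) * (d / 2 ^ n)) f x) / 2 ^ m"
      using regroup[of "\<lambda>k. T (real k * (d / 2 ^ n)) f x"] q(1,3) by (simp add: riemann_mean_def)
    then show "riemann_mean f d m x - riemann_mean f d n x =
       (\<Sum>k<(2::nat) ^ m. T (k * (d / 2 ^ m)) f x - T (real (k div q) * (d / 2 ^ n)) f x) / 2 ^ m"
      by (simp add: riemann_mean_def sum_subtractf diff_divide_distrib)
  qed
  then have "N (\<lambda>x. riemann_mean f d m x - riemann_mean f d n x) =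
     N (\<lambda>x. (\<Sum>k<(2::nat) ^ m. T (k * (d / 2 ^ m)) f x - T (real (k div q) * (d / 2 ^ n)) f x) / 2 ^ m)"
    by (rule arg_cong)
  also have "\<dots> \<le> ((2::nat) ^ m) * e / 2 ^ m"
  proof (rule N_average_le)
    fix k :: nat
    let ?s = "real (k div q) * (d / 2 ^ n)" and ?t = "k * (d / 2 ^ m)"
    have kq: "real k = real q * real (k div q) + real (k mod q)"
      by (metis mult_div_mod_eq of_nat_add of_nat_mult)
    have "?t = real q * real (k div q) * (d / 2 ^ m) + real (k mod q) * (d / 2 ^ m)"
      unfolding kq by (rule distrib_right)
    then have t: "?t = ?s + real (k mod q) * (d / 2 ^ m)"
      using q by simp
    have "real (k mod q) * (d / 2 ^ m) \<le> real q * (d / 2 ^ m)"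
      using q(1) d by (intro mult_right_mono) (simp_all add: less_imp_le)
    then have "?s \<le> ?t" "?t - ?s \<le> d / 2 ^ n"
      using t d q by (auto simp: field_simps)
    then show "N (\<lambda>x. T ?t f x - T ?s f x) \<le> e"
      using T_increment_le[of ?s ?t f] e[of "?t - ?s"] f d by simp
  qed (use f d in \<open>auto intro!: closed T_closed\<close>)
  finally show ?thesis by simp
qed


lemma T_average:
  assumes "t \<ge> 0" "c > 0" "\<And>i. i < n \<Longrightarrow> F i \<in> X"
  shows "N (\<lambda>x. T t (\<lambda>y. (\<Sum>i<(n::nat). F i y) / c) x - (\<Sum>i<n. T t (F i) x) / c) = 0"
proof -
  let ?S = "\<lambda>y. \<Sum>i<n. F i y" and ?U = "\<lambda>x. \<Sum>i<n. T t (F i) x"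
  have S: "?S \<in> X" "?U \<in> X" using assms by (auto intro!: sum_closed T_closed)
  have S': "(\<lambda>y. ?S y / c) \<in> X" "(\<lambda>y. ?U y / c) \<in> X" "(\<lambda>y. T t ?S y / c) \<in> X"
    using S assms by (auto intro!: divide_closed T_closed)
  have "N (\<lambda>x. T t (\<lambda>y. ?S y / c) x - ?U x / c) \<le>
      N (\<lambda>x. T t (\<lambda>y. ?S y / c) x - T t ?S x / c) + N (\<lambda>x. T t ?S x / c - ?U x / c)"
    using assms S' by (intro N_triangle T_closed) auto
  moreover have "N (\<lambda>x. T t (\<lambda>y. ?S y / c) x - T t ?S x / c) = 0"
    using T_scale[OF assms(1) S(1), of "1 / c"] by simp
  moreover have "N (\<lambda>x. T t ?S x / c - ?U x / c) \<le> 0"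
    using N_divide_le[OF diff_closed[OF T_closed[OF assms(1) S(1)] S(2)] assms(2)]
      T_sum_zero[OF assms(1,3)] by (simp add: diff_divide_distrib)
  moreover have "0 \<le> N (\<lambda>x. T t (\<lambda>y. ?S y / c) x - ?U x / c)"
    using S' assms by (intro N_nonneg diff_closed T_closed) auto
  ultimately show ?thesis by simp
qed

text \<open>A shift by \<open>m\<close> mesh widths changes the mean only in its first and last \<open>m\<close> terms.\<close>

lemma riemann_mean_shift:
  assumes f: "f \<in> X" and d: "d > 0"
  defines "w \<equiv> (\<lambda>x. T d f x - f x)"
  assumes e: "\<And>s. 0 \<le> s \<Longrightarrow> s \<le> m * (d / 2 ^ n) \<Longrightarrow> N (\<lambda>x. T s w x - w x) \<le> e"
  shows "N (\<lambda>x. T (real m * (d / 2 ^ n)) (riemann_mean f d n) x - riemann_mean f d n x - real m / 2 ^ n * w x)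
    \<le> real m / 2 ^ n * e"
proof -
  define h where "h = d / 2 ^ n"
  have h: "h > 0" "2 ^ n * h = d" using d by (simp_all add: h_def)
  define t where "t = real m * h"
  have t: "t \<ge> 0" using h by (simp add: t_def)
  have w: "w \<in> X" unfolding w_def using f d by (intro diff_closed T_closed) auto
  have Tc: "T (real k * h) f \<in> X" for k using f h by (intro T_closed) auto
  define R where "R = riemann_mean f d n"
  have R: "R \<in> X" unfolding R_def using f d by (intro riemann_mean_closed) auto
  \<comment> \<open>The error has three parts: \<open>A\<close> is the failure of T t to commute
    literally with averages, \<open>B\<close> the failure of the semigroup law to hold literally,
    both null. \<open>C\<close> holds the m nodes gained beyond d minus the m nodes lost at the
    start; each such difference is T (k h) w up to a null function, hence within e of w.\<close>
  define A where "A = (\<lambda>x. T t R x - (\<Sum>k<(2::nat) ^ n. T t (T (k * h) f) x) / 2 ^ n)"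
  define B where "B = (\<lambda>x. (\<Sum>k<(2::nat) ^ n. T t (T (k * h) f) x - T (real (m + k) * h) f x) / 2 ^ n)"
  define C where "C = (\<lambda>x. (\<Sum>k<m. T (real (2 ^ n + k) * h) f x - T (k * h) f x - w x) / 2 ^ n)"
  have ABC: "A \<in> X" "B \<in> X" "C \<in> X"
    unfolding A_def B_def C_def
    using f h R w t Tc by (auto intro!: diff_closed divide_closed sum_closed T_closed)
  \<comment> \<open>Moving a window of length M by j exchanges j terms at its ends, whether or not j
    exceeds M.\<close>
  have telescope: "(\<Sum>k<M. G (j + k)) - (\<Sum>k<M. G k) = (\<Sum>k<j. G (M + k) - G k)"
    for G :: "nat \<Rightarrow> real" and M j :: nat
  proof (induction j)
    case (Suc j)
    have "(\<Sum>k<M. G (Suc j + k)) = (\<Sum>k<M. G (j + k)) - G j + G (j + M)"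
      using sum.lessThan_Suc_shift[of "\<lambda>k. G (j + k)" M] by simp
    with Suc show ?case by (simp add: add.commute)
  qed simp
  have "(\<lambda>x. T t R x - R x - real m / 2 ^ n * w x) = (\<lambda>x. A x + B x + C x)"
  proof
    fix x
    have *: "C x = ((\<Sum>k<(2::nat) ^ n. T (real (m + k) * h) f x) - (\<Sum>k<(2::nat) ^ n. T (real k * h) f x)) / 2 ^ n
        - real m / 2 ^ n * w x"
    proof -
      have "(\<Sum>k<m. T (real (2 ^ n + k) * h) f x - T (k * h) f x - w x) =
          (\<Sum>k<m. T (real (2 ^ n + k) * h) f x - T (k * h) f x) - real m * w x"
        by (simp only: sum_subtractf sum_constant card_lessThan)
      then show ?thesis
        unfolding C_def telescope[where G = "\<lambda>k. T (real k * h) f x" and M = "2 ^ n" and j = m] by (simp only: diff_divide_distrib) simp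
    qed
    have "R x = (\<Sum>k<(2::nat) ^ n. T (k * h) f x) / 2 ^ n"
      by (simp add: R_def riemann_mean_def h_def)
    with * show "T t R x - R x - real m / 2 ^ n * w x = A x + B x + C x"
      unfolding A_def B_def by (simp add: sum_subtractf diff_divide_distrib)
  qed
  then have "N (\<lambda>x. T t R x - R x - real m / 2 ^ n * w x) = N (\<lambda>x. A x + B x + C x)"
    by (rule arg_cong)
  also have "\<dots> \<le> N A + N B + N C"
    using N_add[OF add_closed[OF ABC(1,2)] ABC(3)] N_add[OF ABC(1,2)] by simp
  also have "N A = 0"
    unfolding A_def using T_average[OF t, of "2 ^ n" "2 ^ n" "\<lambda>k. T (k * h) f"] Tc
    by (simp add: R_def riemann_mean_def h_def)
  also have "N B \<le> ((2::nat) ^ n) * (0::real) / 2 ^ n"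
    unfolding B_def
  proof (rule N_average_le)
    fix k :: nat
    have "N (\<lambda>x. T t (T (k * h) f) x - T (t + k * h) f x) = 0"
      using T_add[of t "k * h" f] t h f N_commute[of "T t (T (k * h) f)" "T (t + k * h) f"]
      by (simp add: T_closed)
    then show "N (\<lambda>x. T t (T (k * h) f) x - T (real (m + k) * h) f x) \<le> 0"
      by (simp add: t_def distrib_right)
  qed (use f h t in \<open>auto intro!: diff_closed T_closed\<close>)
  also have "N C \<le> m * e / 2 ^ n"
    unfolding C_def
  proof (rule N_average_le)
    fix k assume k: "k < m"
    have kh: "real k * h \<ge> 0" using h by simp
    let ?a = "T (real k * h + d) f" and ?b = "T (real k * h) (T d f)" and ?c = "T (real k * h) f"
    have abc: "?a \<in> X" "?b \<in> X" "?c \<in> X" "T (real k * h) w \<in> X"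
      using f d h w by (auto intro!: T_closed)
    have "N (\<lambda>x. (?a x - ?b x) + ((?b x - ?c x) - T (real k * h) w x)) \<le>
      N (\<lambda>x. ?a x - ?b x) + N (\<lambda>x. (?b x - ?c x) - T (real k * h) w x)"
      using abc by (intro N_add diff_closed)
    moreover have "N (\<lambda>x. ?a x - ?b x) = 0"
      using f d h by (intro T_add) auto
    moreover have "N (\<lambda>x. (?b x - ?c x) - T (real k * h) w x) = 0"
      using T_diff[OF kh T_closed[of d f] f] N_commute[OF abc(4) diff_closed[OF abc(2,3)]] f d
      by (simp add: w_def)
    moreover have "(\<lambda>x. (?a x - ?b x) + ((?b x - ?c x) - T (real k * h) w x)) =
        (\<lambda>x. (?a x - ?c x) - T (real k * h) w x)" by (rule ext) simp
    ultimately have 1: "N (\<lambda>x. (?a x - ?c x) - T (real k * h) w x) \<le> 0" by (simp only:)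
    have "real k * h \<le> real m * h" using k h by (intro mult_right_mono) auto
    then have "N (\<lambda>x. T (real k * h) w x - w x) \<le> e"
      using kh by (intro e) (auto simp: h_def)
    then have "N (\<lambda>x. (?a x - ?c x) - w x) \<le> e"
      using N_triangle[OF diff_closed[OF abc(1,3)] abc(4) w] 1 by simp
    moreover have "real (2 ^ n + k) * h = real k * h + d"
      using h by (simp add: distrib_right)
    ultimately show "N (\<lambda>x. T (real (2 ^ n + k) * h) f x - ?c x - w x) \<le> e" by simp
  qed (use f h w in \<open>auto intro!: diff_closed T_closed\<close>)
  finally show ?thesis by (simp add: t_def h_def R_def)
qed

text \<open>Once d / 2^M is below the continuity modulus of the orbit, all finer sums stay within e
  / 3 of the one at level M, so the dyadic sums are Cauchy and completeness applies.\<close>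

lemma riemann_mean_limit:
  assumes f: "f \<in> X" and d: "d > 0"
  obtains y where "y \<in> X" "(\<lambda>n. N (\<lambda>x. riemann_mean f d n x - y x)) \<longlonglongrightarrow> 0"
proof -
  have R: "riemann_mean f d n \<in> X" for n using f d by (intro riemann_mean_closed) auto
  have "\<exists>M. \<forall>m\<ge>M. \<forall>n\<ge>M. N (\<lambda>x. riemann_mean f d m x - riemann_mean f d n x) < e"
    if "e > 0" for e
  proof -
    obtain d' where d': "d' > 0" "\<And>s. 0 \<le> s \<Longrightarrow> s \<le> d' \<Longrightarrow> N (\<lambda>x. T s f x - f x) \<le> e / 3"
      using \<open>e > 0\<close> by (rule T_modulus[OF f, of "e / 3", OF divide_pos_pos[OF _ zero_less_numeral]]) blast
    obtain M where "d / d' < 2 ^ M" using real_arch_pow[of 2 "d / d'"] by auto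
    then have M: "d / 2 ^ M \<le> d'" using d' by (simp add: field_simps)
    have *: "N (\<lambda>x. riemann_mean f d m x - riemann_mean f d M x) \<le> e / 3" if "m \<ge> M" for m
      using M d d' that by (intro riemann_mean_refine f) auto
    show ?thesis
    proof (intro exI allI impI)
      fix m n assume "M \<le> m" "M \<le> n"
      then show "N (\<lambda>x. riemann_mean f d m x - riemann_mean f d n x) < e"
        using *[of m] *[of n] N_triangle[OF R[of m] R[of M] R[of n]] N_commute[OF R[of n] R[of M]] \<open>e > 0\<close> by simp
    qed
  qed
  then show ?thesis using X_complete[of "riemann_mean f d"] R that by blast
qed

text \<open>The witness \<open>y\<close> is the mean of the orbit over [0, d]. It is close to f
  because the orbit is close to f up to time d, and its image under the generator is (T d f - f) /
  d.\<close>

lemma generator_dense: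
  assumes f: "f \<in> X" and "e > 0"
  obtains y h where "(y, h) \<in> generator X N T" "N (\<lambda>x. y x - f x) \<le> e"
proof -
  obtain d where d: "d > 0" "\<And>s. 0 \<le> s \<Longrightarrow> s \<le> d \<Longrightarrow> N (\<lambda>x. T s f x - f x) \<le> e"
    using T_modulus[OF assms] by auto
  define R where "R = riemann_mean f d"
  define w where "w = (\<lambda>x. T d f x - f x)"
  have R: "R n \<in> X" for n unfolding R_def using f d by (intro riemann_mean_closed) auto
  have w: "w \<in> X" unfolding w_def using f d by (intro diff_closed T_closed) auto
  obtain y where y: "y \<in> X" and lim: "(\<lambda>n. N (\<lambda>x. R n x - y x)) \<longlonglongrightarrow> 0"
    using riemann_mean_limit[OF f d(1)] by (auto simp: R_def)
  have "N (\<lambda>x. y x - f x) \<le> N (\<lambda>x. R n x - y x) + e" for n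
    using N_triangle[OF y R f, of n] N_commute[OF y R, of n] riemann_mean_dist_le[of f d e n] d f
    by (simp add: R_def)
  then have close: "N (\<lambda>x. y x - f x) \<le> e"
    using LIMSEQ_le_const[OF tendsto_add[OF lim tendsto_const[of e]]] by auto
  \<comment> \<open>In terms of integrals, T h y - y is 1 / d times the integral of T s w over 0 < s
    < h, since the shifted mean loses [0, h] and gains [d, d + h]. The slack \<open>r\<close> below
    absorbs the passage from Riemann sums to their limit.\<close>
  have key: "N (\<lambda>x. T h y x - y x - h / d * w x) \<le> h / d * e'"
    if h: "h > 0" and e': "\<And>s. 0 \<le> s \<Longrightarrow> s \<le> h \<Longrightarrow> N (\<lambda>x. T s w x - w x) \<le> e'" for h e'
  proof (rule field_le_epsilon)
    fix r :: real assume "r > 0"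
    obtain q where q: "q > 0" "\<And>s. 0 \<le> s \<Longrightarrow> s \<le> q \<Longrightarrow> N (\<lambda>x. T s y x - y x) \<le> r / 4"
      using \<open>r > 0\<close> by (rule T_modulus[OF y, of "r / 4", OF divide_pos_pos[OF _ zero_less_numeral]]) blast
    have "\<forall>\<^sub>F n in sequentially. N (\<lambda>x. R n x - y x) < r / 4"
      using lim \<open>r > 0\<close> by (intro order_tendstoD) auto
    moreover have l2: "(\<lambda>n. c / 2 ^ n) \<longlonglongrightarrow> 0" for c :: real
      by (rule LIMSEQ_divide_realpow_zero) simp
    then have "\<forall>\<^sub>F n in sequentially. d / 2 ^ n < q" "\<forall>\<^sub>F n in sequentially. N w / 2 ^ n < r / 4"
      using q \<open>r > 0\<close> order_tendstoD(2)[OF l2, of q d] order_tendstoD(2)[OF l2, of "r / 4" "N w"] by auto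
    ultimately have "\<forall>\<^sub>F n in sequentially. N (\<lambda>x. R n x - y x) < r / 4 \<and> d / 2 ^ n < q \<and> N w / 2 ^ n < r / 4"
      by eventually_elim simp
    then obtain n where n: "N (\<lambda>x. R n x - y x) < r / 4" "d / 2 ^ n < q" "N w / 2 ^ n < r / 4"
      unfolding eventually_sequentially by blast
    define s where "s = d / 2 ^ n"
    have s: "s > 0" using d by (simp add: s_def)
    \<comment> \<open>The time h is rounded down to m mesh widths. The errors \<open>?A\<close>
      (rounding), \<open>?B\<close> and \<open>?D\<close> (mean replaced by its Riemann sum) and
      \<open>?E\<close> (m / 2^n instead of h / d) each cost at most r / 4; \<open>?C\<close> is the
      shift estimate.\<close>
    define m where "m = nat \<lfloor>h / s\<rfloor>"
    have "real m \<le> h / s" "h / s < real m + 1" using h s by (simp_all add: m_def)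
    then have m: "real m * s \<le> h" "h - real m * s \<le> s" using s by (simp_all add: field_simps)
    have ms: "real m * s \<ge> 0" using s by simp
    let ?A = "\<lambda>x. T h y x - T (real m * s) y x" and ?B = "\<lambda>x. T (real m * s) y x - T (real m * s) (R n) x"
    let ?C = "\<lambda>x. T (real m * s) (R n) x - R n x - real m / 2 ^ n * w x"
    let ?D = "\<lambda>x. R n x - y x" and ?E = "\<lambda>x. (real m / 2 ^ n - h / d) * w x"
    have cl: "?A \<in> X" "?B \<in> X" "?C \<in> X" "?D \<in> X" "?E \<in> X"
      using y R w h ms by (auto intro!: diff_closed T_closed scale_closed[OF w] simp del: times_divide_eq_left)
    have "N ?A \<le> r / 4"
      using T_increment_le[OF ms m(1) y] q(2)[of "h - real m * s"] m n s by (simp add: s_def)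
    moreover have "N ?B < r / 4"
      using T_dist_le[OF ms y R, of n] N_commute[OF y R, of n] n by simp
    moreover have "N ?C \<le> h / d * e'"
    proof -
      have "N ?C \<le> real m / 2 ^ n * e'"
        using riemann_mean_shift[OF f d(1), of m n e'] e' m by (simp add: R_def w_def s_def)
      also have "\<dots> \<le> h / d * e'"
        using m(1) d N_nonneg[OF diff_closed[OF T_closed[OF _ w] w], of 0] e'[of 0] h
        by (intro mult_right_mono) (auto simp: s_def field_simps)
      finally show ?thesis .
    qed
    moreover have "N ?E \<le> N w / 2 ^ n"
    proof -
      have "\<bar>real m / 2 ^ n - h / d\<bar> \<le> 1 / 2 ^ n"
        using m d by (auto simp: s_def field_simps abs_le_iff)
      then show ?thesis
        using N_scale_le[OF w, of "real m / 2 ^ n - h / d"] N_nonneg[OF w]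
          mult_right_mono[of "\<bar>real m / 2 ^ n - h / d\<bar>" "1 / 2 ^ n" "N w"] by simp
    qed
    moreover have "(\<lambda>x. T h y x - y x - h / d * w x) = (\<lambda>x. ?A x + (?B x + (?C x + (?D x + ?E x))))"
      by (simp add: fun_eq_iff algebra_simps)
    then have "N (\<lambda>x. T h y x - y x - h / d * w x) = N (\<lambda>x. ?A x + (?B x + (?C x + (?D x + ?E x))))"
      by (rule arg_cong)
    moreover have "N (\<lambda>x. ?A x + (?B x + (?C x + (?D x + ?E x)))) \<le> N ?A + (N ?B + (N ?C + (N ?D + N ?E)))"
      by (intro order_trans[OF N_add] add_mono order_refl cl add_closed)
    ultimately show "N (\<lambda>x. T h y x - y x - h / d * w x) \<le> h / d * e' + r" using n by linarith
  qed
  have "((\<lambda>t. N (\<lambda>x. (T t y x - y x) / t - w x / d)) \<longlongrightarrow> 0) (at_right 0)"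
  proof (rule tendstoI)
    fix r :: real assume "r > 0"
    \<comment> \<open>With this tolerance the bound of \<open>key\<close>, divided by h, is r /
      2.\<close>
    obtain q where q: "q > 0" "\<And>s. 0 \<le> s \<Longrightarrow> s \<le> q \<Longrightarrow> N (\<lambda>x. T s w x - w x) \<le> r * d / 2"
      using T_modulus[OF w, of "r * d / 2"] \<open>r > 0\<close> d by auto
    have "dist (N (\<lambda>x. (T h y x - y x) / h - w x / d)) 0 < r" if h: "0 < h" "h < q" for h
    proof -
      have "N (\<lambda>x. T h y x - y x - h / d * w x) \<le> h / d * (r * d / 2)"
        using h q by (intro key) auto
      also have "\<dots> = h * (r / 2)" using d by simp
      finally have "N (\<lambda>x. T h y x - y x - h / d * w x) / h \<le> r / 2"
        using h by (simp add: field_simps)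
      moreover have "(\<lambda>x. T h y x - y x - h / d * w x) \<in> X"
        using w y h by (intro diff_closed scale_closed T_closed) auto
      then have "N (\<lambda>x. (T h y x - y x - h / d * w x) / h) \<le> N (\<lambda>x. T h y x - y x - h / d * w x) / h"
        using h by (intro N_divide_le)
      moreover have "(\<lambda>x. (T h y x - y x - h / d * w x) / h) = (\<lambda>x. (T h y x - y x) / h - w x / d)"
        using h by (simp add: fun_eq_iff diff_divide_distrib)
      then have "N (\<lambda>x. (T h y x - y x - h / d * w x) / h) = N (\<lambda>x. (T h y x - y x) / h - w x / d)"
        by (rule arg_cong)
      moreover have "0 \<le> N (\<lambda>x. (T h y x - y x) / h - w x / d)"
        using w y h by (intro N_nonneg diff_closed divide_closed T_closed) auto
      ultimately show ?thesis using \<open>r > 0\<close> unfolding dist_real_def by linarith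
    qed
    then show "\<forall>\<^sub>F h in at_right 0. dist (N (\<lambda>x. (T h y x - y x) / h - w x / d)) 0 < r"
      unfolding eventually_at_right_field using q(1) by blast
  qed
  then have "(y, \<lambda>x. w x / d) \<in> generator X N T"
    using y w by (auto simp: generator_def intro: divide_closed)
  then show ?thesis using close that by blast
qed

text \<open>The left side is the norm of T t applied to the error of the difference quotient of f.
  The bound does not involve t, which makes the errors along an orbit uniform in the telescoping
  argument.\<close>

lemma generator_T:
  assumes "(f, h) \<in> generator X N T" "t \<ge> 0" "s > 0"
  shows "N (\<lambda>x. (T s (T t f) x - T t f x) / s - T t h x) \<le> N (\<lambda>x. (T s f x - f x) / s - h x)"
proof -
  have fh: "f \<in> X" "h \<in> X" using assms(1) by (auto simp: generator_def)
  have cl: "T s f \<in> X" "T t f \<in> X" "T t h \<in> X" "T t (T s f) \<in> X" "T s (T t f) \<in> X" "T (s + t) f \<in> X"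
    using fh assms by (auto intro!: T_closed)
  let ?u = "\<lambda>x. (T s f x - f x) / s"
  have u: "?u \<in> X" "T t ?u \<in> X" using cl fh assms by (auto intro!: divide_closed diff_closed T_closed)
  have "N (\<lambda>x. T s (T t f) x - T t (T s f) x) \<le>
      N (\<lambda>x. T s (T t f) x - T (s + t) f x) + N (\<lambda>x. T (s + t) f x - T t (T s f) x)"
    by (intro N_triangle cl)
  also have "\<dots> = 0"
    using T_add[of s t f] T_add[of t s f] fh assms N_commute[OF cl(5,6)] by (simp add: add.commute)
  finally have "N (\<lambda>x. (T s (T t f) x - T t (T s f) x) / s) \<le> 0"
    using N_divide_le[OF diff_closed[OF cl(5,4)] assms(3)] assms(3)
    by (meson divide_nonpos_pos order_trans)
  moreover have "N (\<lambda>x. (T t (T s f) x - T t f x) / s - T t ?u x) = 0"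
    using T_lincomb[OF assms(2) cl(1) fh(1), of "1 / s" "- 1 / s"] N_commute[OF u(2) divide_closed[OF diff_closed[OF cl(4,2)]], of s]
    by (simp add: diff_divide_distrib)
  moreover have "N (\<lambda>x. T t ?u x - T t h x) \<le> N (\<lambda>x. ?u x - h x)"
    using u fh assms by (intro T_dist_le) auto
  moreover have "N (\<lambda>x. (T s (T t f) x - T t (T s f) x) / s + (((T t (T s f) x - T t f x) / s - T t ?u x) + (T t ?u x - T t h x)))
     \<le> N (\<lambda>x. (T s (T t f) x - T t (T s f) x) / s) + (N (\<lambda>x. (T t (T s f) x - T t f x) / s - T t ?u x) + N (\<lambda>x. T t ?u x - T t h x))"
    by (intro order_trans[OF N_add] add_mono order_refl cl u add_closed diff_closed divide_closed)
  moreover have "(\<lambda>x. (T s (T t f) x - T t (T s f) x) / s + (((T t (T s f) x - T t f x) / s - T t ?u x) + (T t ?u x - T t h x)))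
     = (\<lambda>x. (T s (T t f) x - T t f x) / s - T t h x)"
    by (simp add: fun_eq_iff diff_divide_distrib)
  ultimately show ?thesis by simp
qed

lemma generator_invariant:
  assumes "(f, h) \<in> generator X N T" "t \<ge> 0"
  shows "(T t f, T t h) \<in> generator X N T"
proof -
  have fh: "f \<in> X" "h \<in> X" and lim: "((\<lambda>s. N (\<lambda>x. (T s f x - f x) / s - h x)) \<longlongrightarrow> 0) (at_right 0)"
    using assms(1) by (auto simp: generator_def)
  have "((\<lambda>s. N (\<lambda>x. (T s (T t f) x - T t f x) / s - T t h x)) \<longlongrightarrow> 0) (at_right 0)"
  proof (rule tendsto_sandwich[OF _ _ tendsto_const lim])
    have "0 \<le> N (\<lambda>x. (T s (T t f) x - T t f x) / s - T t h x)" if "s > 0" for s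
      using fh assms that by (intro N_nonneg diff_closed divide_closed T_closed) auto
    then show "\<forall>\<^sub>F s in at_right 0. 0 \<le> N (\<lambda>x. (T s (T t f) x - T t f x) / s - T t h x)"
      by (auto simp: eventually_at_right_field intro: exI[of _ 1])
    show "\<forall>\<^sub>F s in at_right 0. N (\<lambda>x. (T s (T t f) x - T t f x) / s - T t h x) \<le> N (\<lambda>x. (T s f x - f x) / s - h x)"
      using generator_T[OF assms] by (auto simp: eventually_at_right_field intro: exI[of _ 1])
  qed
  then show ?thesis using fh assms by (auto simp: generator_def T_closed)
qed

end

section \<open>Two semigroups whose generators are adjoint for a bounded bilinear form\<close>

locale semigroup_pairing =
  P: contraction_semigroup X N P + Q: contraction_semigroup Y M Q
  for X N P Y M Q +
  fixes B :: "(real \<Rightarrow> real) \<Rightarrow> (real \<Rightarrow> real) \<Rightarrow> real"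
  assumes B_left: "f \<in> X \<Longrightarrow> f' \<in> X \<Longrightarrow> g \<in> Y \<Longrightarrow> B (\<lambda>x. a * f x + b * f' x) g = a * B f g + b * B f' g"
    and B_right: "f \<in> X \<Longrightarrow> g \<in> Y \<Longrightarrow> g' \<in> Y \<Longrightarrow> B f (\<lambda>x. a * g x + b * g' x) = a * B f g + b * B f g'"
    and B_bound: "f \<in> X \<Longrightarrow> g \<in> Y \<Longrightarrow> \<bar>B f g\<bar> \<le> N f * M g"
    and B_generators: "(f, f') \<in> generator X N P \<Longrightarrow> (g, g') \<in> generator Y M Q \<Longrightarrow> B f' g = B f g'"
begin

lemma B_diff_left: "f \<in> X \<Longrightarrow> f' \<in> X \<Longrightarrow> g \<in> Y \<Longrightarrow> B (\<lambda>x. f x - f' x) g = B f g - B f' g"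
  using B_left[of f f' g 1 "-1"] by simp

lemma B_diff_right: "f \<in> X \<Longrightarrow> g \<in> Y \<Longrightarrow> g' \<in> Y \<Longrightarrow> B f (\<lambda>x. g x - g' x) = B f g - B f g'"
  using B_right[of f g g' 1 "-1"] by simp

lemma B_cong_left: "f \<in> X \<Longrightarrow> f' \<in> X \<Longrightarrow> g \<in> Y \<Longrightarrow> N (\<lambda>x. f x - f' x) = 0 \<Longrightarrow> B f g = B f' g"
  using B_bound[OF P.diff_closed[of f f'], of g] by (simp add: B_diff_left)

lemma B_cong_right: "f \<in> X \<Longrightarrow> g \<in> Y \<Longrightarrow> g' \<in> Y \<Longrightarrow> M (\<lambda>x. g x - g' x) = 0 \<Longrightarrow> B f g = B f g'"
  using B_bound[OF _ Q.diff_closed[of g g'], of f] by (simp add: B_diff_right)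

text \<open>With a = P p f and b = Q q g, the generator terms B (P p f') b and B a (Q q g') cancel,
  because the orbits stay in the domains. Only the two difference quotient errors remain, and by
  \<open>generator_T\<close> and contractivity their bounds are free of p and q.\<close>

lemma pairing_step:
  assumes f: "(f, f') \<in> generator X N P" and g: "(g, g') \<in> generator Y M Q"
    and pq: "p \<ge> 0" "q \<ge> 0" "s > 0"
  shows "\<bar>B (P (p + s) f) (Q q g) - B (P p f) (Q (q + s) g)\<bar> \<le>
    s * (N (\<lambda>x. (P s f x - f x) / s - f' x) * M g + N f * M (\<lambda>x. (Q s g x - g x) / s - g' x))"
proof -
  have fX: "f \<in> X" "f' \<in> X" and gY: "g \<in> Y" "g' \<in> Y" using f g by (auto simp: generator_def)
  define a where "a = P p f"
  define b where "b = Q q g"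
  have a: "a \<in> X" "P s a \<in> X" "P p f' \<in> X" and b: "b \<in> Y" "Q s b \<in> Y" "Q q g' \<in> Y"
    using fX gY pq by (auto simp: a_def b_def intro!: P.T_closed Q.T_closed)
  have "B (P (p + s) f) b = B (P s a) b"
    using P.T_add[of s p f] pq fX a b
    by (intro B_cong_left) (auto simp: a_def add.commute intro: P.T_closed)
  moreover have "B a (Q (q + s) g) = B a (Q s b)"
    using Q.T_add[of s q g] pq gY a b
    by (intro B_cong_right) (auto simp: b_def add.commute intro: Q.T_closed)
  moreover have gen: "B (P p f') b = B a (Q q g')"
    unfolding a_def b_def
    by (intro B_generators P.generator_invariant Q.generator_invariant f g pq)
  let ?u = "\<lambda>x. (P s a x - a x) / s - P p f' x" and ?v = "\<lambda>x. (Q s b x - b x) / s - Q q g' x"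
  have uv: "?u \<in> X" "?v \<in> Y"
    using a b by (auto intro!: P.diff_closed P.divide_closed Q.diff_closed Q.divide_closed)
  have "B ?u b = (B (P s a) b - B a b) / s - B (P p f') b"
  proof -
    have "B (\<lambda>x. 1 / s * (\<lambda>x. P s a x - a x) x + (-1) * P p f' x) b =
      1 / s * B (\<lambda>x. P s a x - a x) b + (-1) * B (P p f') b"
      using a b by (intro B_left P.diff_closed)
    then show ?thesis using a b by (simp add: B_diff_left)
  qed
  moreover have "B a ?v = (B a (Q s b) - B a b) / s - B a (Q q g')"
  proof -
    have "B a (\<lambda>x. 1 / s * (\<lambda>x. Q s b x - b x) x + (-1) * Q q g' x) =
      1 / s * B a (\<lambda>x. Q s b x - b x) + (-1) * B a (Q q g')"
      using a b by (intro B_right Q.diff_closed)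
    then show ?thesis using a b by (simp add: B_diff_right)
  qed
  ultimately have "B (P (p + s) f) b - B a (Q (q + s) g) = s * (B ?u b - B a ?v)"
    using pq gen by (simp add: field_simps)
  then have "\<bar>B (P (p + s) f) b - B a (Q (q + s) g)\<bar> = s * \<bar>B ?u b - B a ?v\<bar>"
    using pq by (simp add: abs_mult)
  also have "\<dots> \<le> s * (\<bar>B ?u b\<bar> + \<bar>B a ?v\<bar>)"
    using pq by (intro mult_left_mono abs_triangle_ineq4) simp
  also have "\<dots> \<le> s * (N (\<lambda>x. (P s f x - f x) / s - f' x) * M g + N f * M (\<lambda>x. (Q s g x - g x) / s - g' x))"
  proof (rule mult_left_mono[OF add_mono])
    have u: "N ?u \<le> N (\<lambda>x. (P s f x - f x) / s - f' x)" and v: "M ?v \<le> M (\<lambda>x. (Q s g x - g x) / s - g' x)"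
      unfolding a_def b_def using pq by (simp_all add: P.generator_T[OF f] Q.generator_T[OF g])
    have ab: "N a \<le> N f" "M b \<le> M g"
      unfolding a_def b_def using pq fX gY by (simp_all add: P.T_contraction Q.T_contraction)
    have nn: "0 \<le> N ?u" "0 \<le> M ?v" "0 \<le> N a" "0 \<le> M b"
      using uv a b by (simp_all add: P.N_nonneg Q.N_nonneg)
    show "\<bar>B ?u b\<bar> \<le> N (\<lambda>x. (P s f x - f x) / s - f' x) * M g"
      using B_bound[OF uv(1) b(1)] mult_mono[OF u ab(2)] nn u by linarith
    show "\<bar>B a ?v\<bar> \<le> N f * M (\<lambda>x. (Q s g x - g x) / s - g' x)"
      using B_bound[OF a(1) uv(2)] mult_mono[OF ab(1) v] nn ab by linarith
  qed (use pq in simp)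
  finally show ?thesis by (simp add: a_def b_def)
qed

lemma pairing_generator:
  assumes f: "(f, f') \<in> generator X N P" and g: "(g, g') \<in> generator Y M Q" and t: "t > 0"
  shows "B (P t f) g = B f (Q t g)"
proof -
  have fX: "f \<in> X" "f' \<in> X" and gY: "g \<in> Y" "g' \<in> Y" using f g by (auto simp: generator_def)
  define r where "r = (\<lambda>s. N (\<lambda>x. (P s f x - f x) / s - f' x) * M g + N f * M (\<lambda>x. (Q s g x - g x) / s - g' x))"
  have "(r \<longlongrightarrow> 0 * M g + N f * 0) (at_right 0)"
    unfolding r_def using f g by (intro tendsto_intros) (auto simp: generator_def)
  moreover have s: "(\<lambda>n. t / real (Suc n)) \<longlonglongrightarrow> 0"
    using LIMSEQ_Suc[OF lim_const_over_n[of t]] by simp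
  then have "filterlim (\<lambda>n. t / real (Suc n)) (at_right 0) sequentially"
    using t by (auto simp: filterlim_at eventually_sequentially)
  ultimately have "(\<lambda>n. r (t / real (Suc n))) \<longlonglongrightarrow> 0"
    by (auto intro: filterlim_compose)
  then have lim: "(\<lambda>n. t * r (t / real (Suc n))) \<longlonglongrightarrow> t * 0"
    by (intro tendsto_intros)
  have "\<bar>B (P t f) g - B f (Q t g)\<bar> \<le> t * r (t / real (Suc n))" for n
  proof -
    let ?n = "Suc n"
    define s where "s = t / real ?n"
    have s: "s > 0" "real ?n * s = t" using t by (simp_all add: s_def)
    define c where "c = (\<lambda>k. B (P (real k * s) f) (Q (real (?n - k) * s) g))"
    have "\<bar>c (Suc k) - c k\<bar> \<le> s * r s" if "k < ?n" for k
    proof -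
      have [simp]: "real (?n - k) * s = real (?n - Suc k) * s + s" "real (Suc k) * s = real k * s + s"
        using that by (simp_all add: of_nat_diff algebra_simps)
      then show ?thesis
        using pairing_step[OF f g, of "real k * s" "real (?n - Suc k) * s" s] s(1)
        by (simp del: of_nat_Suc add: c_def r_def)
    qed
    then have "\<bar>\<Sum>k<?n. c (Suc k) - c k\<bar> \<le> (\<Sum>k<?n. s * r s)"
      by (intro order_trans[OF sum_abs] sum_mono) auto
    also have "(\<Sum>k<?n. s * r s) = real ?n * s * r s" by (simp only: sum_constant card_lessThan mult.assoc)
    finally have "\<bar>c ?n - c 0\<bar> \<le> real ?n * s * r s"
      using sum_lessThan_telescope[of c ?n] by (simp del: of_nat_Suc sum.lessThan_Suc)
    \<comment> \<open>At both ends of the telescope a factor at time 0 is left, and time 0 acts as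
      the identity only modulo the seminorm; hence the congruence rules.\<close>
    moreover have "c ?n = B (P t f) g"
      unfolding c_def using s fX gY t Q.T_zero[OF gY(1)]
      by (simp del: of_nat_Suc) (intro B_cong_right P.T_closed Q.T_closed, auto)
    moreover have "c 0 = B f (Q t g)"
      unfolding c_def using s fX gY t P.T_zero[OF fX(1)]
      by (simp del: of_nat_Suc) (intro B_cong_left P.T_closed Q.T_closed, auto)
    ultimately show ?thesis using s by (simp add: s_def del: of_nat_Suc)
  qed
  then have "\<bar>B (P t f) g - B f (Q t g)\<bar> \<le> t * 0"
    using LIMSEQ_le_const[OF lim] by blast
  then show ?thesis by simp
qed

theorem pairing_duality:
  assumes f: "f \<in> X" and g: "g \<in> Y" and t: "t \<ge> 0"
  shows "B (P t f) g = B f (Q t g)"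
proof (cases "t = 0")
  case True
  have "B (P 0 f) g = B f g" "B f (Q 0 g) = B f g"
    using f g P.T_zero Q.T_zero by (auto intro!: B_cong_left B_cong_right P.T_closed Q.T_closed)
  then show ?thesis using True by simp
next
  case False
  then have t: "t > 0" "t \<ge> 0" using t by auto
  have "\<bar>B (P t f) g - B f (Q t g)\<bar> \<le> e" if "e > 0" for e
  proof -
    \<comment> \<open>Replacing f and g by domain elements at distance d changes each side by at
      most N f d + d (M g + d). The bound d <= 1 gives d^2 <= d, and the quotient then brings both
      changes together below e; the summand 1 keeps the denominator positive.\<close>
    define d where "d = min 1 (e / (2 * (N f + M g + 1)))"
    have nn: "N f \<ge> 0" "M g \<ge> 0" using f g P.N_nonneg Q.N_nonneg by auto
    have d: "d > 0" "d \<le> 1" "2 * d * (N f + M g + 1) \<le> e"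
    proof -
      have K: "N f + M g + 1 > 0" using nn by simp
      then show "d > 0" "d \<le> 1" using that by (simp_all add: d_def)
      have "d \<le> e / (2 * (N f + M g + 1))" by (simp add: d_def)
      with K show "2 * d * (N f + M g + 1) \<le> e" by (simp add: field_simps)
    qed
    obtain y y' where y: "(y, y') \<in> generator X N P" "N (\<lambda>x. y x - f x) \<le> d"
      using P.generator_dense[OF f d(1)] by blast
    obtain z z' where z: "(z, z') \<in> generator Y M Q" "M (\<lambda>x. z x - g x) \<le> d"
      using Q.generator_dense[OF g d(1)] by blast
    have yz: "y \<in> X" "z \<in> Y" using y z by (auto simp: generator_def)
    have eq: "B (P t y) z = B y (Q t z)" using pairing_generator[OF y(1) z(1) t(1)] .
    have cl: "P t f \<in> X" "P t y \<in> X" "Q t g \<in> Y" "Q t z \<in> Y"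
      using t f g yz by (auto intro: P.T_closed Q.T_closed)
    have Mz: "M z \<le> M g + d"
      using Q.N_add[OF Q.diff_closed[OF yz(2) g] g] z by simp
    have bound: "\<bar>B p u - B p' u'\<bar> \<le> N p * d + d * (M g + d)"
      if "p \<in> X" "p' \<in> X" "u \<in> Y" "u' \<in> Y" "N (\<lambda>x. p' x - p x) \<le> d" "M (\<lambda>x. u' x - u x) \<le> d"
        "M u' \<le> M g + d" for p p' u u'
    proof -
      have "B p u - B p' u' = B p (\<lambda>x. u x - u' x) + B (\<lambda>x. p x - p' x) u'"
        using that by (simp add: B_diff_left B_diff_right)
      also have "\<bar>\<dots>\<bar> \<le> \<bar>B p (\<lambda>x. u x - u' x)\<bar> + \<bar>B (\<lambda>x. p x - p' x) u'\<bar>" by (rule abs_triangle_ineq)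
      also have "\<dots> \<le> N p * M (\<lambda>x. u x - u' x) + N (\<lambda>x. p x - p' x) * M u'"
        using that by (intro add_mono B_bound P.diff_closed Q.diff_closed)
      also have "\<dots> \<le> N p * d + d * (M g + d)"
        using that P.N_commute[of p p'] Q.N_commute[of u u'] nn d
        by (intro add_mono mult_mono) (auto intro!: P.N_nonneg Q.N_nonneg P.diff_closed Q.diff_closed)
      finally show ?thesis .
    qed
    have "\<bar>B (P t f) g - B (P t y) z\<bar> \<le> N (P t f) * d + d * (M g + d)"
      using P.T_dist_le[OF t(2) yz(1) f] y z cl g yz Mz by (intro bound) auto
    moreover have "N (P t f) * d \<le> N f * d"
      using P.T_contraction[OF t(2) f] d by (intro mult_right_mono) auto
    moreover have "\<bar>B f (Q t g) - B y (Q t z)\<bar> \<le> N f * d + d * (M g + d)"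
      using Q.T_dist_le[OF t(2) yz(2) g] Q.T_contraction[OF t(2) yz(2)] y z cl f yz Mz
      by (intro bound) auto
    ultimately have "\<bar>B (P t f) g - B f (Q t g)\<bar> \<le> 2 * (N f * d + d * (M g + d))"
      unfolding eq abs_le_iff by (simp add: algebra_simps)
    also have "\<dots> \<le> 2 * d * (N f + M g + 1)"
      using d mult_left_mono[of d 1 d] by (simp add: algebra_simps)
    finally show ?thesis using d by simp
  qed
  then have "\<bar>B (P t f) g - B f (Q t g)\<bar> \<le> 0"
    by (rule field_le_epsilon) (simp del: abs_le_zero_iff)
  then show ?thesis by simp
qed

end

section \<open>Smooth cutoffs, test functions and primitives\<close>

text \<open>A form of smoothness suited to induction: each step peels off one derivative, so the
  product and chain rules follow by induction on the order. The count is off by one: index n asserts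
  n + 1 derivatives.\<close>

primrec times_differentiable :: "nat \<Rightarrow> (real \<Rightarrow> real) \<Rightarrow> bool" where
  "times_differentiable 0 f \<longleftrightarrow> (\<forall>x. f differentiable (at x))"
| "times_differentiable (Suc n) f \<longleftrightarrow> (\<forall>x. f differentiable (at x)) \<and> times_differentiable n (deriv f)"

lemma times_differentiable_iff:
  "times_differentiable n f \<longleftrightarrow> (\<forall>k\<le>n. \<forall>x. (deriv ^^ k) f differentiable (at x))"
proof (induction n arbitrary: f)
  case (Suc n)
  have "(\<forall>k\<le>Suc n. Q k) \<longleftrightarrow> Q 0 \<and> (\<forall>k\<le>n. Q (Suc k))" for Q
    by (metis Suc_le_mono nat.exhaust zero_le)
  then show ?case using Suc by (simp add: funpow_Suc_right del: funpow.simps(2))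
qed simp

lemma times_differentiable_Suc: "times_differentiable (Suc n) f \<Longrightarrow> times_differentiable n f"
  unfolding times_differentiable_iff by auto

lemma times_differentiable_differentiable: "times_differentiable n f \<Longrightarrow> f differentiable (at x)"
  by (cases n) auto

lemma times_differentiable_continuous_on:
  assumes "times_differentiable n f"
  shows "continuous_on A f"
  using differentiable_imp_continuous_within[OF times_differentiable_differentiable[OF assms]]
  by (rule continuous_at_imp_continuous_on[OF ballI])

lemma deriv_eqI: "(\<And>x. (f has_real_derivative f' x) (at x)) \<Longrightarrow> deriv f = f'"
  by (auto intro: DERIV_imp_deriv)

lemma differentiable_has_deriv: "(f :: real \<Rightarrow> real) differentiable (at x) \<Longrightarrow> (f has_real_derivative deriv f x) (at x)"
  by (metis DERIV_deriv_iff_real_differentiable)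

lemma times_differentiable_SucI:
  assumes "\<And>x. (f has_real_derivative f' x) (at x)" "times_differentiable n f'"
  shows "times_differentiable (Suc n) f"
  using assms deriv_eqI[OF assms(1)] by (auto simp: real_differentiable_def)

lemma times_differentiable_const: "times_differentiable n (\<lambda>x. c)"
proof (induction n arbitrary: c)
  case (Suc n)
  show ?case by (rule times_differentiable_SucI[where f' = "\<lambda>x. 0"]) (auto intro: Suc)
qed simp

lemma times_differentiable_add:
  "times_differentiable n f \<Longrightarrow> times_differentiable n g \<Longrightarrow> times_differentiable n (\<lambda>x. f x + g x)"
proof (induction n arbitrary: f g)
  case (Suc n)
  then show ?case
    by (intro times_differentiable_SucI[where f' = "\<lambda>x. deriv f x + deriv g x"])
       (auto intro!: DERIV_add differentiable_has_deriv)
qed simp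

lemma times_differentiable_mult:
  "times_differentiable n f \<Longrightarrow> times_differentiable n g \<Longrightarrow> times_differentiable n (\<lambda>x. f x * g x)"
proof (induction n arbitrary: f g)
  case (Suc n)
  then have fg: "f differentiable (at x)" "g differentiable (at x)" for x
    by auto
  show ?case
  proof (rule times_differentiable_SucI[where f' = "\<lambda>x. deriv f x * g x + deriv g x * f x"])
    show "((\<lambda>x. f x * g x) has_real_derivative deriv f x * g x + deriv g x * f x) (at x)" for x
      by (intro DERIV_mult differentiable_has_deriv fg)
    show "times_differentiable n (\<lambda>x. deriv f x * g x + deriv g x * f x)"
      using Suc.prems times_differentiable_Suc[OF Suc.prems(1)] times_differentiable_Suc[OF Suc.prems(2)]
      by (intro times_differentiable_add Suc.IH) auto
  qed
qed simp

lemma times_differentiable_affine: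
  "times_differentiable n f \<Longrightarrow> times_differentiable n (\<lambda>x. f (c * x + d))"
proof (induction n arbitrary: f)
  case (0 f)
  have "((\<lambda>x. f (c * x + d)) has_real_derivative deriv f (c * x + d) * c) (at x)" for x
    using 0 by (intro DERIV_chain2[where f = f] differentiable_has_deriv) (auto intro!: derivative_eq_intros)
  then show ?case by (auto simp: real_differentiable_def)
next
  case (Suc n f)
  show ?case
  proof (rule times_differentiable_SucI[where f' = "\<lambda>x. deriv f (c * x + d) * c"])
    show "((\<lambda>x. f (c * x + d)) has_real_derivative deriv f (c * x + d) * c) (at x)" for x
      using Suc by (intro DERIV_chain2[where f = f] differentiable_has_deriv) (auto intro!: derivative_eq_intros)
    show "times_differentiable n (\<lambda>x. deriv f (c * x + d) * c)"
      using Suc by (intro times_differentiable_mult times_differentiable_const Suc.IH) auto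
  qed
qed

text \<open>The classical exp (-1/x) with an added power of 1/x. The powers make the family closed
  under differentiation up to linear combinations, so one first derivative computation yields all
  orders.\<close>

definition flat :: "nat \<Rightarrow> real \<Rightarrow> real" where
  "flat k x = (if x > 0 then inverse x ^ k * exp (- inverse x) else 0)"

lemma flat_tendsto_0: "(flat k \<longlongrightarrow> 0) (at 0)"
proof -
  have "((\<lambda>x::real. inverse x ^ k / exp (inverse x)) \<longlongrightarrow> 0) (at_right 0)"
    by (rule filterlim_compose[OF tendsto_power_div_exp_0 filterlim_inverse_at_top_right])
  then have "(flat k \<longlongrightarrow> 0) (at_right 0)"
    by (rule Lim_transform_eventually)
       (auto simp: eventually_at_right_field flat_def exp_minus divide_inverse intro: exI[of _ 1])
  moreover have "(flat k \<longlongrightarrow> 0) (at_left 0)"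
    by (rule Lim_transform_eventually[OF tendsto_const])
       (auto simp: eventually_at_left_field flat_def intro: exI[of _ "-1"])
  ultimately show ?thesis by (simp add: filterlim_split_at)
qed

lemma flat_has_derivative: "(flat k has_real_derivative flat (k + 2) x - real k * flat (Suc k) x) (at x)"
proof -
  consider "x < 0" | "x = 0" | "x > 0" by linarith
  then show ?thesis
  proof cases
    case 1
    have "((\<lambda>x. 0) has_real_derivative 0) (at x)" by simp
    moreover have "\<forall>\<^sub>F y in nhds x. 0 = flat k y"
      using 1 eventually_nhds_in_open[of "{..<0}" x] by (auto simp: flat_def elim!: eventually_mono)
    ultimately have "(flat k has_real_derivative 0) (at x)"
      using DERIV_cong_ev[OF refl, of "\<lambda>x. 0" "flat k" x 0 0] by simp
    then show ?thesis using 1 by (simp add: flat_def)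
  next
    case 2
    \<comment> \<open>At 0 the difference quotient is itself a member of the family, whose limit is
      already known.\<close>
    have "(\<lambda>h. (flat k (0 + h) - flat k 0) / h) = flat (Suc k)"
      by (auto simp: flat_def fun_eq_iff divide_inverse)
    then have "(flat k has_real_derivative 0) (at 0)"
      using flat_tendsto_0[of "Suc k"] by (simp add: DERIV_def)
    then show ?thesis using 2 by (simp add: flat_def)
  next
    case 3
    let ?g = "\<lambda>x::real. inverse x ^ k * exp (- inverse x)"
    let ?D = "(real k * inverse x ^ (k - 1) * (- (inverse x ^ 2))) * exp (- inverse x)
        + inverse x ^ k * (exp (- inverse x) * inverse x ^ 2)"
    have "(?g has_real_derivative ?D) (at x)"
      using 3 by (auto intro!: derivative_eq_intros simp: power2_eq_square)
    moreover have "((?g has_real_derivative ?D) (at x)) = ((flat k has_real_derivative ?D) (at x))"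
      using 3 eventually_nhds_in_open[of "{0<..}" x]
      by (intro DERIV_cong_ev refl) (auto simp: flat_def elim!: eventually_mono)
    \<comment> \<open>For k = 0 the exponent k - 1 is truncated, but its term carries the factor
      \<open>real k\<close> = 0.\<close>
    moreover have "?D = flat (k + 2) x - real k * flat (Suc k) x"
      using 3 by (cases k) (simp_all add: flat_def power2_eq_square algebra_simps)
    ultimately show ?thesis by simp
  qed
qed

lemma times_differentiable_flat: "times_differentiable n (flat k)"
proof (induction n arbitrary: k)
  case 0
  show ?case using flat_has_derivative by (auto simp: real_differentiable_def)
next
  case (Suc n)
  have "times_differentiable n (\<lambda>x. flat (k + 2) x + (- real k) * flat (Suc k) x)"
    by (intro times_differentiable_add times_differentiable_mult times_differentiable_const Suc.IH)
  then show ?case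
    by (intro times_differentiable_SucI[OF flat_has_derivative]) (simp add: algebra_simps)
qed

text \<open>As n grows, flat 0 (n x) tends to 1 for every x > 0. These smooth functions are
  therefore bounded by 1, positive exactly on (a, b), and converge pointwise to its indicator, which
  is what dominated convergence asks for.\<close>

definition cutoff :: "real \<Rightarrow> real \<Rightarrow> nat \<Rightarrow> real \<Rightarrow> real" where
  "cutoff a b n x = flat 0 (real (Suc n) * (x - a)) * flat 0 (real (Suc n) * (b - x))"

lemma times_differentiable_cutoff: "times_differentiable m (cutoff a b n)"
proof -
  have "times_differentiable m (\<lambda>x. flat 0 (real (Suc n) * x + (- real (Suc n) * a)) * flat 0 ((- real (Suc n)) * x + real (Suc n) * b))"
    by (intro times_differentiable_mult times_differentiable_affine times_differentiable_flat)
  moreover have "cutoff a b n = (\<lambda>x. flat 0 (real (Suc n) * x + (- real (Suc n) * a)) * flat 0 ((- real (Suc n)) * x + real (Suc n) * b))"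
    by (simp add: cutoff_def fun_eq_iff algebra_simps)
  ultimately show ?thesis by simp
qed

lemma flat_0_bounds: "0 \<le> flat 0 x" "flat 0 x \<le> 1"
  by (auto simp: flat_def)

lemma cutoff_bounds: "0 \<le> cutoff a b n x" "cutoff a b n x \<le> 1"
  unfolding cutoff_def using flat_0_bounds by (auto intro: mult_le_one)

lemma cutoff_outside: "x \<notin> {a<..<b} \<Longrightarrow> cutoff a b n x = 0"
  by (auto simp: cutoff_def flat_def zero_less_mult_iff)

lemma cutoff_pos: "x \<in> {a<..<b} \<Longrightarrow> cutoff a b n x > 0"
  by (auto simp: cutoff_def flat_def zero_less_mult_iff)

lemma cutoff_tendsto: "(\<lambda>n. cutoff a b n x) \<longlonglongrightarrow> indicator {a<..<b} x"
proof (cases "x \<in> {a<..<b}")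
  case True
  have *: "(\<lambda>n. flat 0 (real (Suc n) * c)) \<longlonglongrightarrow> 1" if "c > 0" for c :: real
  proof -
    have "(\<lambda>n. exp (- (inverse (real (Suc n)) * inverse c))) \<longlonglongrightarrow> exp (- (0 * inverse c))"
      by (intro tendsto_intros LIMSEQ_inverse_real_of_nat)
    moreover have "flat 0 (real (Suc n) * c) = exp (- (inverse (real (Suc n)) * inverse c))" for n
      using that by (simp add: flat_def zero_less_mult_iff del: of_nat_Suc)
    ultimately show ?thesis by simp
  qed
  have "(\<lambda>n. cutoff a b n x) \<longlonglongrightarrow> 1 * 1"
    unfolding cutoff_def using True by (intro tendsto_mult *) auto
  then show ?thesis using True by simp
next
  case False
  then show ?thesis by (simp add: cutoff_outside)
qed

lemma continuous_cutoff: "continuous_on UNIV (cutoff a b n)"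
  using times_differentiable_cutoff[of 0] by (rule times_differentiable_continuous_on)

lemma borel_measurable_cutoff [measurable]: "cutoff a b n \<in> borel_measurable borel"
  using continuous_cutoff by (rule borel_measurable_continuous_onI)

lemma test_function_iff:
  "test_function \<eta> \<longleftrightarrow> (\<forall>n. times_differentiable n \<eta>) \<and> (\<exists>a b. -1 < a \<and> a < b \<and> b < 1 \<and> (\<forall>x. x \<notin> {a<..<b} \<longrightarrow> \<eta> x = 0))"
proof -
  have "(\<forall>n x. (deriv ^^ n) \<eta> differentiable (at x)) \<longleftrightarrow> (\<forall>n. times_differentiable n \<eta>)"
    unfolding times_differentiable_iff by auto
  moreover have "(\<exists>K. compact K \<and> K \<subseteq> {-1<..<1} \<and> (\<forall>x. x \<notin> K \<longrightarrow> \<eta> x = 0)) \<longleftrightarrow>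
      (\<exists>a b. -1 < a \<and> a < b \<and> b < 1 \<and> (\<forall>x. x \<notin> {a<..<b} \<longrightarrow> \<eta> x = 0))"
  proof safe
    fix K assume K: "compact K" "K \<subseteq> {-1<..<1::real}" "\<forall>x. x \<notin> K \<longrightarrow> \<eta> x = 0"
    \<comment> \<open>K may be empty; adding 0 ensures that extrema exist and lie on either side of
      0.\<close>
    let ?K = "insert 0 K"
    have c: "compact ?K" "?K \<subseteq> {-1<..<1}" "?K \<noteq> {}" using K by auto
    obtain s where s: "s \<in> ?K" "\<And>t. t \<in> ?K \<Longrightarrow> s \<le> t" using compact_attains_inf[OF c(1,3)] by blast
    obtain r where r: "r \<in> ?K" "\<And>t. t \<in> ?K \<Longrightarrow> t \<le> r" using compact_attains_sup[OF c(1,3)] by blast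
    have "s \<le> 0" "0 \<le> r" "-1 < s" "r < 1" using s r c by auto
    moreover have "\<eta> x = 0" if "x \<notin> {(s - 1) / 2<..<(r + 1) / 2}" for x
      using K(3) s(2)[of x] r(2)[of x] that \<open>-1 < s\<close> \<open>r < 1\<close> by (cases "x \<in> K") (auto simp: field_simps)
    ultimately show "\<exists>a b. -1 < a \<and> a < b \<and> b < 1 \<and> (\<forall>x. x \<notin> {a<..<b} \<longrightarrow> \<eta> x = 0)"
      by (intro exI[of _ "(s - 1) / 2"] exI[of _ "(r + 1) / 2"]) auto
  next
    fix a b assume "-1 < a" "a < b" "b < 1" "\<forall>x. x \<notin> {a<..<b} \<longrightarrow> \<eta> x = 0"
    then show "\<exists>K. compact K \<and> K \<subseteq> {-1<..<1} \<and> (\<forall>x. x \<notin> K \<longrightarrow> \<eta> x = 0)"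
      by (intro exI[of _ "{a..b}"]) auto
  qed
  ultimately show ?thesis unfolding test_function_def by simp
qed

lemma test_function_support:
  "test_function \<eta> \<Longrightarrow> \<exists>a b. -1 < a \<and> a < b \<and> b < 1 \<and> (\<forall>x. x \<notin> {a<..<b} \<longrightarrow> \<eta> x = 0)"
  unfolding test_function_iff by (rule conjunct2)

lemma test_function_continuous: "test_function \<eta> \<Longrightarrow> continuous_on A \<eta>"
  unfolding test_function_iff using times_differentiable_continuous_on by blast

lemma test_function_has_derivative:
  "test_function \<eta> \<Longrightarrow> (\<eta> has_real_derivative deriv \<eta> x) (at x)"
  using times_differentiable_differentiable[of 0 \<eta>] differentiable_has_deriv unfolding test_function_iff by blast

text \<open>On one side of x, possibly an endpoint of the interval, the function vanishes
  identically, so a one-sided difference quotient is constantly 0.\<close>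

lemma deriv_eq_0_outside:
  assumes "(\<eta> has_real_derivative d) (at x)" "\<And>x. x \<notin> {a<..<b::real} \<Longrightarrow> \<eta> x = 0" "x \<notin> {a<..<b}"
  shows "d = 0"
proof -
  have "((\<lambda>y. (\<eta> y - \<eta> x) / (y - x)) \<longlongrightarrow> d) (at x)"
    using assms(1) by (simp add: has_field_derivative_iff)
  then have l: "((\<lambda>y. (\<eta> y - \<eta> x) / (y - x)) \<longlongrightarrow> d) (at_left x)" "((\<lambda>y. (\<eta> y - \<eta> x) / (y - x)) \<longlongrightarrow> d) (at_right x)"
    by (auto intro: filterlim_mono[OF _ order_refl] simp: at_le)
  show ?thesis
  proof (cases "x \<le> a")
    case True
    then have "\<forall>\<^sub>F y in at_left x. (\<eta> y - \<eta> x) / (y - x) = 0"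
      using assms(2) by (auto simp: eventually_at_left_field intro: exI[of _ "x - 1"])
    then have "((\<lambda>y. (\<eta> y - \<eta> x) / (y - x)) \<longlongrightarrow> 0) (at_left x)" by (rule tendsto_eventually)
    with l(1) show ?thesis by (rule tendsto_unique[OF trivial_limit_at_left_real])
  next
    case False
    then have "b \<le> x" using assms(3) by auto
    then have "\<forall>\<^sub>F y in at_right x. (\<eta> y - \<eta> x) / (y - x) = 0"
      using assms(2) by (auto simp: eventually_at_right_field intro: exI[of _ "x + 1"])
    then have "((\<lambda>y. (\<eta> y - \<eta> x) / (y - x)) \<longlongrightarrow> 0) (at_right x)" by (rule tendsto_eventually)
    with l(2) show ?thesis by (rule tendsto_unique[OF trivial_limit_at_right_real])
  qed
qed

lemma test_function_deriv: "test_function \<eta> \<Longrightarrow> test_function (deriv \<eta>)"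
proof -
  assume \<eta>: "test_function \<eta>"
  obtain a b where ab: "-1 < a" "a < b" "b < 1" "\<forall>x. x \<notin> {a<..<b} \<longrightarrow> \<eta> x = 0"
    using test_function_support[OF \<eta>] by blast
  have "times_differentiable n (deriv \<eta>)" for n
    using \<eta> unfolding test_function_iff by (metis times_differentiable.simps(2))
  moreover have "deriv \<eta> x = 0" if "x \<notin> {a<..<b}" for x
    using deriv_eq_0_outside[OF test_function_has_derivative[OF \<eta>] ab(4)[rule_format] that] .
  ultimately show ?thesis unfolding test_function_iff using ab by blast
qed

lemma test_function_cutoff: "-1 < a \<Longrightarrow> a < b \<Longrightarrow> b < 1 \<Longrightarrow> test_function (cutoff a b n)"
  unfolding test_function_iff using times_differentiable_cutoff cutoff_outside by blast

lemma test_function_lincomb: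
  assumes "test_function f" "test_function g"
  shows "test_function (\<lambda>x. c * f x + d * g x)"
proof -
  obtain a b a' b' where ab: "-1 < a" "a < b" "b < 1" "\<And>x. x \<notin> {a<..<b} \<Longrightarrow> f x = 0"
    "-1 < a'" "a' < b'" "b' < 1" "\<And>x. x \<notin> {a'<..<b'} \<Longrightarrow> g x = 0"
    using assms unfolding test_function_iff by metis
  have "times_differentiable n (\<lambda>x. c * f x + d * g x)" for n
    using assms unfolding test_function_iff
    by (auto intro!: times_differentiable_add times_differentiable_mult times_differentiable_const)
  moreover have "c * f x + d * g x = 0" if "x \<notin> {min a a'<..<max b b'}" for x
  proof -
    have "f x = 0" "g x = 0" using that by (auto intro!: ab(4,8))
    then show ?thesis by simp
  qed
  ultimately show ?thesis
    unfolding test_function_iff using ab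
    by (intro conjI allI exI[of _ "min a a'"] exI[of _ "max b b'"]) auto
qed

lemma test_function_integrable: "test_function \<eta> \<Longrightarrow> integrable lborel \<eta>"
proof -
  assume \<eta>: "test_function \<eta>"
  obtain a b where ab: "-1 < a" "a < b" "b < 1" "\<forall>x. x \<notin> {a<..<b} \<longrightarrow> \<eta> x = 0"
    using test_function_support[OF \<eta>] by blast
  have "integrable lborel (\<lambda>x. indicator {a..b} x *\<^sub>R \<eta> x)"
    using borel_integrable_compact[OF compact_Icc test_function_continuous[OF \<eta>]]
    by (simp add: set_integrable_def)
  moreover have "(\<lambda>x. indicator {a..b} x *\<^sub>R \<eta> x) = \<eta>"
  proof
    show "indicator {a..b} x *\<^sub>R \<eta> x = \<eta> x" for x
      using spec[OF ab(4), of x] by (cases "x \<in> {a<..<b}") (auto simp: indicator_def)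
  qed
  ultimately show ?thesis by simp
qed

lemma test_function_bounded:
  assumes "test_function \<eta>"
  obtains B where "\<And>x. \<bar>\<eta> x\<bar> \<le> B"
proof -
  obtain a b where ab: "-1 < a" "a < b" "b < 1" "\<forall>x. x \<notin> {a<..<b} \<longrightarrow> \<eta> x = 0"
    using test_function_support[OF assms] by blast
  have "compact (\<eta> ` {a..b})"
    using test_function_continuous[OF assms] by (intro compact_continuous_image) auto
  then have "bounded (\<eta> ` {a..b})" by (rule compact_imp_bounded)
  then obtain B where B: "\<forall>x\<in>{a..b}. \<bar>\<eta> x\<bar> \<le> B"
    by (auto simp: bounded_iff)
  have "\<bar>\<eta> x\<bar> \<le> B" for x
    using ab(2) spec[OF ab(4), of x] bspec[OF B, of x] bspec[OF B, of a] by (cases "x \<in> {a<..<b}") auto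
  then show ?thesis by (rule that)
qed

section \<open>Primitives of integrable functions and vanishing of their densities\<close>

lemma integrable_imp_set_integrable:
  fixes v :: "real \<Rightarrow> real"
  shows "integrable lborel v \<Longrightarrow> A \<in> sets borel \<Longrightarrow> set_integrable lborel A v"
  unfolding set_integrable_def by (rule integrable_mult_indicator) simp_all

definition prim :: "(real \<Rightarrow> real) \<Rightarrow> real \<Rightarrow> real" where
  "prim v x = (LBINT y:{..x}. v y)"

lemma prim_diff:
  assumes "integrable lborel v" "a \<le> b"
  shows "prim v b - prim v a = (LBINT y:{a<..b}. v y)"
proof -
  have "set_integrable lborel A v" if "A \<in> sets borel" for A
    using assms that by (intro integrable_imp_set_integrable)
  then have "(LBINT y:{..a} \<union> {a<..b}. v y) = (LBINT y:{..a}. v y) + (LBINT y:{a<..b}. v y)"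
    by (intro set_integral_Un) auto
  moreover have "{..a} \<union> {a<..b} = {..b}" using assms by auto
  ultimately show ?thesis by (simp add: prim_def)
qed

lemma emeasure_density_integrable:
  fixes f :: "real \<Rightarrow> real"
  assumes f: "integrable lborel f" "\<And>x. 0 \<le> f x" and A: "A \<in> sets borel"
  shows "emeasure (density lborel (\<lambda>x. ennreal (f x))) A = ennreal (LBINT x:A. f x)"
proof -
  have "emeasure (density lborel (\<lambda>x. ennreal (f x))) A = (\<integral>\<^sup>+x. ennreal (f x) * indicator A x \<partial>lborel)"
    using f A by (intro emeasure_density) auto
  also have "\<dots> = (\<integral>\<^sup>+x. ennreal (indicator A x *\<^sub>R f x) \<partial>lborel)"
    by (intro nn_integral_cong) (auto simp: indicator_def)
  also have "\<dots> = ennreal (LBINT x:A. f x)"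
    unfolding set_lebesgue_integral_def
    using f A by (intro nn_integral_eq_integral integrable_mult_indicator) auto
  finally show ?thesis .
qed

text \<open>The positive and the negative part of u are densities of two measures that are finite
  and equal on all rays, hence equal. The two densities then agree almost everywhere, and both parts
  can agree at a point only if u is 0 there.\<close>

lemma AE_zero_if_integrals_zero:
  fixes u :: "real \<Rightarrow> real"
  assumes u: "integrable lborel u" and z: "\<And>x. (LBINT y:{x<..}. u y) = (0::real)"
  shows "AE x in lborel. u x = 0"
proof -
  have [measurable]: "u \<in> borel_measurable borel" using u by auto
  define p where "p = (\<lambda>x. ennreal (max 0 (u x)))"
  define q where "q = (\<lambda>x. ennreal (max 0 (- u x)))"
  have [measurable]: "p \<in> borel_measurable borel" "q \<in> borel_measurable borel"
    by (simp_all add: p_def q_def)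
  have ip: "integrable lborel (\<lambda>x. max 0 (u x))" "integrable lborel (\<lambda>x. max 0 (- u x))"
    using u by auto
  have eP: "emeasure (density lborel p) {x<..} = ennreal (LBINT y:{x<..}. max 0 (u y))"
   and eQ: "emeasure (density lborel q) {x<..} = ennreal (LBINT y:{x<..}. max 0 (- u y))" for x
    unfolding p_def q_def
    using emeasure_density_integrable[OF ip(1), of "{x<..}"] emeasure_density_integrable[OF ip(2), of "{x<..}"]
    by auto
  have "density lborel p = density lborel q"
  proof (rule measure_eqI_lessThan)
    fix x
    have si: "set_integrable lborel {x<..} (\<lambda>x. max 0 (u x))" "set_integrable lborel {x<..} (\<lambda>x. max 0 (- u x))"
      by (intro integrable_imp_set_integrable ip; simp)+
    have "(LBINT y:{x<..}. max 0 (u y)) - (LBINT y:{x<..}. max 0 (- u y)) = (LBINT y:{x<..}. max 0 (u y) - max 0 (- u y))"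
      using si by simp
    also have "(\<lambda>y. max 0 (u y) - max 0 (- u y)) = u" by (auto simp: fun_eq_iff)
    finally have "(LBINT y:{x<..}. max 0 (u y)) = (LBINT y:{x<..}. max 0 (- u y))" using z[of x] by simp
    then show "emeasure (density lborel p) {x<..} = emeasure (density lborel q) {x<..}"
      unfolding eP eQ by simp
    show "emeasure (density lborel p) {x<..} < \<infinity>" unfolding eP by simp
  qed auto
  then have "AE x in lborel. p x = q x"
    using sigma_finite_measure.density_unique_iff[OF sigma_finite_lborel, of p q] by simp
  then show ?thesis
    by eventually_elim (auto simp: p_def q_def max_def split: if_splits)
qed

section \<open>Weak derivatives and absolutely continuous representatives\<close>

lemma AE_lborel_ex:
  assumes "AE x in lborel. P x" "a < (b::real)"
  obtains x where "a < x" "x < b" "P x"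
proof -
  have "\<exists>x\<in>{a<..<b}. P x"
  proof (rule ccontr)
    assume "\<not> (\<exists>x\<in>{a<..<b}. P x)"
    with assms(1) have "AE x in lborel. x \<notin> {a<..<b}" by (auto elim!: eventually_mono)
    then have "emeasure lborel {a<..<b} = 0"
      by (subst (asm) AE_iff_measurable[of "{a<..<b}"]) auto
    then show False using assms(2) by simp
  qed
  then show ?thesis using that by auto
qed

text \<open>Every interval to the right of a has positive measure and so contains a zero of d,
  whereas a non-zero limit excludes zeros near a. It is applied to the difference of two
  representatives.\<close>

lemma tendsto_right_AE_zero:
  fixes d :: "real \<Rightarrow> real"
  assumes lim: "(d \<longlongrightarrow> L) (at_right a)" and ae: "AE x in lborel. x \<in> {a<..<b} \<longrightarrow> d x = 0" and "a < b"
  shows "L = 0"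
proof (rule ccontr)
  assume "L \<noteq> 0"
  then have "\<forall>\<^sub>F x in at_right a. d x \<noteq> 0"
    using lim by (intro tendsto_imp_eventually_ne) auto
  then obtain c where c: "c > a" "\<And>x. a < x \<Longrightarrow> x < c \<Longrightarrow> d x \<noteq> 0"
    by (auto simp: eventually_at_right_field)
  obtain x where "a < x" "x < min b c" "x \<in> {a<..<b} \<longrightarrow> d x = 0"
    using AE_lborel_ex[OF ae, of a "min b c"] \<open>a < b\<close> c(1) by auto
  then show False using c(2)[of x] by auto
qed

lemma tendsto_left_AE_zero:
  fixes d :: "real \<Rightarrow> real"
  assumes lim: "(d \<longlongrightarrow> L) (at_left b)" and ae: "AE x in lborel. x \<in> {a<..<b} \<longrightarrow> d x = 0" and "a < b"
  shows "L = 0"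
proof (rule ccontr)
  assume "L \<noteq> 0"
  then have "\<forall>\<^sub>F x in at_left b. d x \<noteq> 0"
    using lim by (intro tendsto_imp_eventually_ne) auto
  then obtain c where c: "c < b" "\<And>x. c < x \<Longrightarrow> x < b \<Longrightarrow> d x \<noteq> 0"
    by (auto simp: eventually_at_left_field)
  obtain x where "max a c < x" "x < b" "x \<in> {a<..<b} \<longrightarrow> d x = 0"
    using AE_lborel_ex[OF ae, of "max a c" b] \<open>a < b\<close> c(1) by auto
  then show False using c(2)[of x] by auto
qed

abbreviation ae_eq :: "(real \<Rightarrow> real) \<Rightarrow> (real \<Rightarrow> real) \<Rightarrow> bool" (infix "\<doteq>" 50) where
  "f \<doteq> g \<equiv> AE x in lborel. x \<in> {-1<..<1} \<longrightarrow> f x = g x"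

text \<open>Turns a boundary condition, stated for some representative, into an endpoint value of
  the continuous one.\<close>

lemma vanishes_at_right_eq_0:
  assumes "vanishes_at f (at_right (-1))" "f \<doteq> k"
    and "isCont k (-1)"
  shows "k (-1) = 0"
proof -
  obtain g where g: "g \<doteq> f" "(g \<longlongrightarrow> 0) (at_right (-1))"
    using assms(1) by (auto simp: vanishes_at_def)
  have "AE x in lborel. x \<in> {-1<..<1} \<longrightarrow> g x - k x = 0"
    using g(1) assms(2) by eventually_elim auto
  moreover have "(k \<longlongrightarrow> k (-1)) (at_right (-1))"
    using assms(3) unfolding isCont_def by (rule filterlim_mono) (auto intro: at_le)
  then have "((\<lambda>x. g x - k x) \<longlongrightarrow> 0 - k (-1)) (at_right (-1))"
    using g(2) by (intro tendsto_intros)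
  ultimately show ?thesis using tendsto_right_AE_zero[of "\<lambda>x. g x - k x" "0 - k (-1)" "-1" 1] by simp
qed

lemma vanishes_at_left_eq_0:
  assumes "vanishes_at f (at_left 1)" "f \<doteq> k"
    and "isCont k 1"
  shows "k 1 = 0"
proof -
  obtain g where g: "g \<doteq> f" "(g \<longlongrightarrow> 0) (at_left 1)"
    using assms(1) by (auto simp: vanishes_at_def)
  have "AE x in lborel. x \<in> {-1<..<1} \<longrightarrow> g x - k x = 0"
    using g(1) assms(2) by eventually_elim auto
  moreover have "(k \<longlongrightarrow> k 1) (at_left 1)"
    using assms(3) unfolding isCont_def by (rule filterlim_mono) (auto intro: at_le)
  then have "((\<lambda>x. g x - k x) \<longlongrightarrow> 0 - k 1) (at_left 1)"
    using g(2) by (intro tendsto_intros)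
  ultimately show ?thesis using tendsto_left_AE_zero[of "\<lambda>x. g x - k x" "0 - k 1" 1 "-1"] by simp
qed

lemma set_lebesgue_integral_mult:
  fixes f :: "real \<Rightarrow> real"
  shows "set_lebesgue_integral M A f = (\<integral>x. indicator A x * f x \<partial>M)"
  by (simp add: set_lebesgue_integral_def)

lemma set_integrable_mult:
  fixes f :: "real \<Rightarrow> real"
  shows "set_integrable M A f \<longleftrightarrow> integrable M (\<lambda>x. indicator A x * f x)"
  by (simp add: set_integrable_def)

lemma continuous_prim:
  assumes v: "integrable lborel v"
  shows "isCont (prim v) x"
  unfolding continuous_at_sequentially
proof (intro allI impI)
  fix s assume s: "s \<longlonglongrightarrow> x"
  have [measurable]: "v \<in> borel_measurable borel" using v by auto
  have "(\<lambda>n. LBINT y. indicator {..s n} y * v y) \<longlonglongrightarrow> (LBINT y. indicator {..x} y * v y)"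
  proof (rule integral_dominated_convergence[where w = "\<lambda>y. \<bar>v y\<bar>"])
    show "integrable lborel (\<lambda>y. \<bar>v y\<bar>)" using v by simp
    have "AE y in lborel. y \<noteq> x" by (rule AE_lborel_singleton)
    then show "AE y in lborel. (\<lambda>n. indicator {..s n} y * v y) \<longlonglongrightarrow> indicator {..x} y * v y"
    proof eventually_elim
      case (elim y)
      have "\<forall>\<^sub>F n in sequentially. (indicator {..s n} y :: real) = indicator {..x} y"
      proof (cases "y < x")
        case True
        with s have "\<forall>\<^sub>F n in sequentially. y < s n" by (rule order_tendstoD)
        then show ?thesis by eventually_elim (use True in auto)
      next
        case False
        with elim have "x < y" by simp
        with s have "\<forall>\<^sub>F n in sequentially. s n < y" by (rule order_tendstoD)
        then show ?thesis by eventually_elim (use \<open>x < y\<close> in auto)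
      qed
      then have "(\<lambda>n. indicator {..s n} y :: real) \<longlonglongrightarrow> indicator {..x} y" by (rule tendsto_eventually)
      then show ?case by (intro tendsto_intros)
    qed
  qed (auto simp: indicator_def)
  then show "(prim v \<circ> s) \<longlonglongrightarrow> prim v x" by (simp add: prim_def set_lebesgue_integral_mult comp_def)
qed

lemma borel_measurable_prim [measurable]: "integrable lborel v \<Longrightarrow> prim v \<in> borel_measurable borel"
  by (intro borel_measurable_continuous_onI continuous_at_imp_continuous_on ballI continuous_prim)

lemma prim_bound:
  assumes v: "integrable lborel v"
  shows "\<bar>prim v x\<bar> \<le> (LBINT y. \<bar>v y\<bar>)"
proof -
  have "\<bar>prim v x\<bar> \<le> (LBINT y. \<bar>indicator {..x} y * v y\<bar>)"
    unfolding prim_def set_lebesgue_integral_mult by (rule integral_abs_bound)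
  also have "\<dots> \<le> (LBINT y. \<bar>v y\<bar>)"
    using v integrable_imp_set_integrable[OF v, of "{..x}"]
    by (intro integral_mono integrable_abs) (auto simp: set_integrable_mult indicator_def)
  finally show ?thesis .
qed

lemma integrable_mult_bounded:
  fixes u k :: "real \<Rightarrow> real"
  assumes "integrable lborel u" "k \<in> borel_measurable borel" "\<And>x. \<bar>k x\<bar> \<le> B"
  shows "integrable lborel (\<lambda>x. u x * k x)" "integrable lborel (\<lambda>x. k x * u x)"
proof -
  have [measurable]: "u \<in> borel_measurable borel" using assms(1) by auto
  show "integrable lborel (\<lambda>x. u x * k x)"
  proof (rule Bochner_Integration.integrable_bound)
    show "integrable lborel (\<lambda>x. u x * B)" using assms(1) by simp
    have "B \<ge> 0" using assms(3)[of 0] by simp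
    then show "AE x in lborel. norm (u x * k x) \<le> norm (u x * B)"
      using assms(3) by (auto simp: abs_mult intro!: mult_left_mono)
  qed (use assms(2) in auto)
  then show "integrable lborel (\<lambda>x. k x * u x)" by (simp add: mult.commute)
qed

lemma integrable_pair_mult:
  fixes u v :: "real \<Rightarrow> real" and k :: "real \<times> real \<Rightarrow> real"
  assumes u: "integrable lborel u" and v: "integrable lborel v"
    and k: "k \<in> borel_measurable (lborel \<Otimes>\<^sub>M lborel)" "\<And>p. \<bar>k p\<bar> \<le> B"
  shows "integrable (lborel \<Otimes>\<^sub>M lborel) (\<lambda>(x, y). k (x, y) * (u x * v y))"
proof -
  have [measurable]: "u \<in> borel_measurable borel" "v \<in> borel_measurable borel" using u v by auto
  note k(1)[measurable]
  have "integrable (lborel \<Otimes>\<^sub>M lborel) (\<lambda>(x, y). u x * v y)"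
    using u v by (intro lborel_pair.Fubini_integrable) (auto simp: abs_mult)
  then have "integrable (lborel \<Otimes>\<^sub>M lborel) (\<lambda>p. B * (u (fst p) * v (snd p)))"
    by (simp add: case_prod_beta')
  then show ?thesis
  proof (rule Bochner_Integration.integrable_bound)
    have "B \<ge> 0" using k(2)[of undefined] by linarith
    then have "norm (case p of (x, y) \<Rightarrow> k (x, y) * (u x * v y)) \<le> norm (B * (u (fst p) * v (snd p)))" for p
      using k(2)[of p] by (cases p) (auto simp: abs_mult intro!: mult_right_mono)
    then show "AE p in lborel \<Otimes>\<^sub>M lborel. norm (case p of (x, y) \<Rightarrow> k (x, y) * (u x * v y)) \<le> norm (B * (u (fst p) * v (snd p)))"
      by simp
  qed simp
qed

text \<open>Fubini for u(x) v(y) on the half plane x <= y: one order of integration gives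
  \<open>prim u\<close>, the other the total integral of v minus \<open>prim v\<close>, the line x =
  y being null.\<close>

lemma prim_by_parts:
  assumes u: "integrable lborel u" and v: "integrable lborel v"
  shows "(LBINT x. u x * prim v x) + (LBINT x. prim u x * v x) = (LBINT x. u x) * (LBINT x. v x)"
proof -
  have [measurable]: "u \<in> borel_measurable borel" "v \<in> borel_measurable borel" using u v by auto
  define k :: "real \<times> real \<Rightarrow> real" where "k = (\<lambda>p. if fst p \<le> snd p then 1 else 0)"
  have k [simp]: "k (x, y) = (if x \<le> y then 1 else 0)" for x y by (simp add: k_def)
  have "k \<in> borel_measurable (lborel \<Otimes>\<^sub>M lborel)" unfolding k_def by measurable
  moreover have "\<bar>k p\<bar> \<le> 1" for p by (simp add: k_def)
  ultimately have int: "integrable (lborel \<Otimes>\<^sub>M lborel) (\<lambda>(x, y). k (x, y) * (u x * v y))"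
    by (rule integrable_pair_mult[OF u v])
  have "(LBINT y. prim u y * v y) = (LBINT y. (LBINT x. k (x, y) * (u x * v y)))"
  proof (intro Bochner_Integration.integral_cong refl)
    fix y
    have "(LBINT x. k (x, y) * (u x * v y)) = (LBINT x. (indicator {..y} x * u x) * v y)"
      by (intro Bochner_Integration.integral_cong) (auto simp: indicator_def)
    then show "prim u y * v y = (LBINT x. k (x, y) * (u x * v y))"
      by (simp add: prim_def set_lebesgue_integral_mult)
  qed
  also have "\<dots> = (LBINT x. (LBINT y. k (x, y) * (u x * v y)))"
    using lborel_pair.Fubini_integral[OF int] by simp
  also have "\<dots> = (LBINT x. u x * ((LBINT y. v y) - prim v x))"
  proof (intro Bochner_Integration.integral_cong refl)
    fix x
    have sv: "integrable lborel (\<lambda>y. indicator {..x} y * v y)"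
      using integrable_imp_set_integrable[OF v, of "{..x}"] by (simp add: set_integrable_mult)
    have "(LBINT y. k (x, y) * (u x * v y)) = (LBINT y. u x * (v y - indicator {..x} y * v y))"
    proof (rule integral_cong_AE)
      have "AE y in lborel. y \<noteq> x" by (rule AE_lborel_singleton)
      then show "AE y in lborel. k (x, y) * (u x * v y) = u x * (v y - indicator {..x} y * v y)"
        by eventually_elim (auto simp: indicator_def)
    qed (use u v in auto)
    also have "\<dots> = u x * ((LBINT y. v y) - prim v x)"
      using v sv by (simp add: prim_def set_lebesgue_integral_mult)
    finally show "(LBINT y. k (x, y) * (u x * v y)) = u x * ((LBINT y. v y) - prim v x)" .
  qed
  also have "\<dots> = (LBINT x. u x * (LBINT y. v y) - u x * prim v x)"
    by (simp add: right_diff_distrib)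
  also have "\<dots> = (LBINT x. u x) * (LBINT y. v y) - (LBINT x. u x * prim v x)"
    using integrable_mult_bounded(1)[OF u borel_measurable_prim[OF v] prim_bound[OF v]] u
    by (subst Bochner_Integration.integral_diff) auto
  finally show ?thesis by simp
qed

lemma prim_has_derivative:
  assumes v: "integrable lborel v" and c: "continuous_on {a..b} v" and ab: "a < x" "x < b"
  shows "(prim v has_real_derivative v x) (at x)"
proof -
  \<comment> \<open>Passing to the gauge integral over [a, y] makes the fundamental theorem of
    calculus applicable; the point a is null.\<close>
  have eq: "prim v (a) + integral {a..y} v = prim v y" if "y \<in> {a..b}" for y
  proof -
    have "(LBINT t:{a..y}. v t) = integral {a..y} v"
      by (intro set_borel_integral_eq_integral integrable_imp_set_integrable v) simp
    moreover have "(LBINT t:{a..y}. v t) = (LBINT t:{a<..y}. v t)"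
      unfolding set_lebesgue_integral_mult
    proof (rule integral_cong_AE)
      have "AE t in lborel. t \<noteq> a" by (rule AE_lborel_singleton)
      then show "AE t in lborel. indicator {a..y} t * v t = indicator {a<..y} t * v t"
        by eventually_elim (auto simp: indicator_def)
    qed (use v in auto)
    ultimately show ?thesis using prim_diff[OF v, of "a" y] that by simp
  qed
  have "((\<lambda>y. prim v (a) + integral {a..y} v) has_real_derivative 0 + v x) (at x within {a..b})"
    using c ab by (intro DERIV_add DERIV_const integral_has_real_derivative) auto
  then have "((\<lambda>y. prim v (a) + integral {a..y} v) has_real_derivative v x) (at x within {a..b})"
    by (simp only: add_0)
  then have "(prim v has_real_derivative v x) (at x within {a..b})"
    by (rule has_field_derivative_transform_within[where d = 1]) (simp_all only: eq, use ab in simp_all)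
  then show ?thesis using ab by (simp add: at_within_Icc_at)
qed

text \<open>To the left of the support of \<psi> the primitive is 0, and to the right it equals the
  total integral, which vanishes by hypothesis. So mean zero test functions are exactly what
  derivatives of test functions can reach.\<close>

lemma test_function_prim:
  assumes \<psi>: "test_function \<psi>" and z: "(LBINT x. \<psi> x) = 0"
  shows "test_function (prim \<psi>)" "deriv (prim \<psi>) = \<psi>"
proof -
  have i: "integrable lborel \<psi>" by (rule test_function_integrable[OF \<psi>])
  have d: "(prim \<psi> has_real_derivative \<psi> x) (at x)" for x
    by (rule prim_has_derivative[OF i test_function_continuous[OF \<psi>], of "x - 1" _ "x + 1"]) auto
  show "deriv (prim \<psi>) = \<psi>" by (rule deriv_eqI[OF d])
  obtain a b where ab: "-1 < a" "a < b" "b < 1" "\<forall>x. x \<notin> {a<..<b} \<longrightarrow> \<psi> x = 0"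
    using test_function_support[OF \<psi>] by blast
  have "prim \<psi> x = 0" if "x \<notin> {a<..<b}" for x
  proof (cases "x \<le> a")
    case True
    then have "(\<lambda>y. indicator {..x} y * \<psi> y) = (\<lambda>y. 0)"
      using ab(4) by (auto simp: fun_eq_iff indicator_def)
    then show ?thesis by (simp add: prim_def set_lebesgue_integral_mult)
  next
    case False
    then have "b \<le> x" using that by auto
    then have "(\<lambda>y. indicator {..x} y * \<psi> y) = \<psi>"
      using ab(4) by (auto simp: fun_eq_iff indicator_def)
    then show ?thesis using z by (simp add: prim_def set_lebesgue_integral_mult)
  qed
  moreover have "times_differentiable n (prim \<psi>)" for n
  proof (cases n)
    case 0
    then show ?thesis using d by (auto simp: real_differentiable_def)
  next
    case (Suc m)
    then show ?thesis using \<psi> times_differentiable_SucI[OF d] by (simp add: test_function_iff)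
  qed
  ultimately show "test_function (prim \<psi>)" unfolding test_function_iff using ab(1-3) by blast
qed

section \<open>The du Bois-Reymond lemma and its consequences for weak derivatives\<close>

lemma loc_integrable_Icc:
  "loc_integrable w \<Longrightarrow> -1 < a \<Longrightarrow> b < 1 \<Longrightarrow> integrable lborel (\<lambda>x. indicator {a..b} x * w x)"
  unfolding loc_integrable_def set_integrable_mult by (drule spec[of _ "{a..b}"]) auto

lemma test_integral_eq:
  fixes w \<eta> :: "real \<Rightarrow> real"
  assumes "\<And>x. x \<notin> {a<..<b} \<Longrightarrow> \<eta> x = 0" "-1 < a" "b < 1"
  shows "(LBINT x:{-1<..<1}. w x * \<eta> x) = (LBINT x. (indicator {a..b} x * w x) * \<eta> x)"
  unfolding set_lebesgue_integral_mult
proof (intro Bochner_Integration.integral_cong refl)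
  show "indicator {-1<..<1} x * (w x * \<eta> x) = (indicator {a..b} x * w x) * \<eta> x" for x
    using assms(1)[of x] assms(2,3) by (cases "x \<in> {a<..<b}") (auto simp: indicator_def)
qed

lemma test_integrable:
  assumes "loc_integrable w" "test_function \<eta>"
  shows "set_integrable lborel {-1<..<1} (\<lambda>x. w x * \<eta> x)"
proof -
  obtain a b where ab: "-1 < a" "a < b" "b < 1" "\<forall>x. x \<notin> {a<..<b} \<longrightarrow> \<eta> x = 0"
    using test_function_support[OF assms(2)] by blast
  obtain B where B: "\<And>x. \<bar>\<eta> x\<bar> \<le> B" using test_function_bounded[OF assms(2)] by blast
  have "\<eta> \<in> borel_measurable borel" using test_function_integrable[OF assms(2)] by auto
  with B have "integrable lborel (\<lambda>x. (indicator {a..b} x * w x) * \<eta> x)"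
    using loc_integrable_Icc[OF assms(1) ab(1,3)] by (intro integrable_mult_bounded(1)[where k = \<eta>])
  moreover have "(\<lambda>x. (indicator {a..b} x * w x) * \<eta> x) = (\<lambda>x. indicator {-1<..<1} x * (w x * \<eta> x))"
  proof
    show "(indicator {a..b} x * w x) * \<eta> x = indicator {-1<..<1} x * (w x * \<eta> x)" for x
      using spec[OF ab(4), of x] ab(1-3) by (cases "x \<in> {a<..<b}") (auto simp: indicator_def)
  qed
  ultimately show ?thesis by (simp add: set_integrable_mult)
qed

lemma integral_cutoff_tendsto:
  assumes "integrable lborel W"
  shows "(\<lambda>n. LBINT x. W x * cutoff a b n x) \<longlonglongrightarrow> (LBINT x. W x * indicator {a<..<b} x)"
proof (rule integral_dominated_convergence[where w = "\<lambda>x. \<bar>W x\<bar>"])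
  show "AE x in lborel. (\<lambda>n. W x * cutoff a b n x) \<longlonglongrightarrow> W x * indicator {a<..<b} x"
    by (intro AE_I2 tendsto_intros cutoff_tendsto)
  show "AE x in lborel. norm (W x * cutoff a b n x) \<le> \<bar>W x\<bar>" for n
    using cutoff_bounds[of a b n] by (auto simp: abs_mult intro!: mult_left_le)
qed (use assms in auto)

lemma interval_integral_eq_const:
  assumes w: "loc_integrable w"
    and c: "\<And>\<psi>. test_function \<psi> \<Longrightarrow> (LBINT x:{-1<..<1}. w x * \<psi> x) = c * (LBINT x. \<psi> x)"
    and ab: "-1 < a" "a < b" "b < 1"
  shows "(LBINT x:{a<..<b}. w x) = c * (b - a)"
proof -
  let ?W = "\<lambda>x. indicator {a..b} x * w x"
  have "(\<lambda>n. LBINT x. ?W x * cutoff a b n x) \<longlonglongrightarrow> (LBINT x. ?W x * indicator {a<..<b} x)"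
    by (intro integral_cutoff_tendsto loc_integrable_Icc w ab)
  moreover have "(LBINT x. ?W x * cutoff a b n x) = c * (LBINT x. indicator {a..b} x * cutoff a b n x)" for n
  proof -
    have "(LBINT x. ?W x * cutoff a b n x) = (LBINT x:{-1<..<1}. w x * cutoff a b n x)"
      using ab by (intro test_integral_eq[symmetric] cutoff_outside) auto
    also have "\<dots> = c * (LBINT x. cutoff a b n x)" by (intro c test_function_cutoff ab)
    also have "(LBINT x. cutoff a b n x) = (LBINT x. indicator {a..b} x * cutoff a b n x)"
    proof (intro Bochner_Integration.integral_cong refl)
      show "cutoff a b n x = indicator {a..b} x * cutoff a b n x" for x
        using cutoff_outside[of x a b n] by (cases "x \<in> {a<..<b}") auto
    qed
    finally show ?thesis .
  qed
  moreover have "(\<lambda>n. c * (LBINT x. indicator {a..b} x * cutoff a b n x)) \<longlonglongrightarrow> c * (LBINT x. indicator {a..b} x * indicator {a<..<b} x)"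
    using ab by (intro tendsto_mult_left integral_cutoff_tendsto integrable_real_indicator) auto
  ultimately have "(LBINT x. ?W x * indicator {a<..<b} x) = c * (LBINT x. indicator {a..b} x * indicator {a<..<b} x)"
    using LIMSEQ_unique by simp
  moreover have "(\<lambda>x. ?W x * indicator {a<..<b} x) = (\<lambda>x. indicator {a<..<b} x * w x)"
    "(\<lambda>x. indicator {a..b} x * indicator {a<..<b} x :: real) = indicator {a<..<b}"
    by (auto simp: fun_eq_iff indicator_def)
  ultimately show ?thesis using ab by (simp add: set_lebesgue_integral_mult)
qed

text \<open>Testing with cutoffs shows that w - c integrates to 0 over every compactly contained
  interval, so it vanishes almost everywhere there. Since w is only locally integrable, this is done
  on intervals exhausting (-1,1).\<close>

lemma du_Bois_Reymond:
  assumes w: "loc_integrable w"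
    and c: "\<And>\<psi>. test_function \<psi> \<Longrightarrow> (LBINT x:{-1<..<1}. w x * \<psi> x) = c * (LBINT x. \<psi> x)"
  shows "AE x in lborel. x \<in> {-1<..<1} \<longrightarrow> w x = c"
proof -
  \<comment> \<open>The shift by 2 makes 1 / (n + 2) at most 1/2, so that already the first interval
    is non-empty.\<close>
  define a where "a = (\<lambda>n. -1 + 1 / real (n + 2))"
  define b where "b = (\<lambda>n. 1 - 1 / real (n + 2))"
  have "AE x in lborel. x \<in> {a n<..<b n} \<longrightarrow> w x = c" for n
  proof -
    have ab: "-1 < a n" "a n < b n" "b n < 1"
    proof -
      have "1 / real (n + 2) \<le> 1 / 2" "0 < 1 / real (n + 2)" by (simp_all add: field_simps)
      then show "-1 < a n" "a n < b n" "b n < 1" unfolding a_def b_def by linarith+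
    qed
    let ?u = "\<lambda>x. indicator {a n<..<b n} x * (w x - c)"
    have W: "integrable lborel (\<lambda>x. indicator {a n..b n} x * w x)"
      by (intro loc_integrable_Icc w ab)
    have Wc: "integrable lborel (\<lambda>x. indicator {s<..<b n} x * w x)" if "s \<ge> a n" for s
    proof -
      have "integrable lborel (\<lambda>x. indicator {s<..<b n} x * (indicator {a n..b n} x * w x))"
        using integrable_imp_set_integrable[OF W, of "{s<..<b n}"] by (simp add: set_integrable_mult)
      also have "(\<lambda>x. indicator {s<..<b n} x * (indicator {a n..b n} x * w x)) = (\<lambda>x. indicator {s<..<b n} x * w x)"
        using that by (auto simp: fun_eq_iff indicator_def)
      finally show ?thesis .
    qed
    have "emeasure lborel {s<..<b n} < \<infinity>" for s
      by (cases "s \<le> b n") auto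
    then have ci: "integrable lborel (\<lambda>x. indicator {s<..<b n} x * c)" for s
      by (intro integrable_mult_left integrable_real_indicator) auto
    have "AE x in lborel. ?u x = 0"
    proof (rule AE_zero_if_integrals_zero)
      show "integrable lborel ?u" using Wc[of "a n"] ci[of "a n"] by (simp add: right_diff_distrib)
      fix x
      define s where "s = max x (a n)"
      have "(LBINT y:{x<..}. ?u y) = (LBINT y. indicator {s<..<b n} y * w y - indicator {s<..<b n} y * c)"
        unfolding set_lebesgue_integral_mult
        by (intro Bochner_Integration.integral_cong refl) (auto simp: indicator_def s_def)
      also have "\<dots> = (LBINT y:{s<..<b n}. w y) - (LBINT y. indicator {s<..<b n} y * c)"
        using Wc[of s] ci[of s] by (subst Bochner_Integration.integral_diff) (auto simp: s_def set_lebesgue_integral_mult)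
      also have "\<dots> = 0"
      proof (cases "s < b n")
        case True
        then show ?thesis using interval_integral_eq_const[OF w c, of s "b n"] ab by (simp add: s_def)
      next
        case False
        then show ?thesis by (simp add: set_lebesgue_integral_mult)
      qed
      finally show "(LBINT y:{x<..}. ?u y) = 0" .
    qed
    then show ?thesis by eventually_elim (auto simp: indicator_def)
  qed
  then have "AE x in lborel. \<forall>n. x \<in> {a n<..<b n} \<longrightarrow> w x = c" by (intro iffD2[OF AE_all_countable] allI)
  then show ?thesis
  proof eventually_elim
    case (elim x)
    show ?case
    proof
      assume x: "x \<in> {-1<..<1}"
      then have "min (x + 1) (1 - x) > 0" by simp
      then obtain n where n: "inverse (real (Suc n)) < min (x + 1) (1 - x)" using reals_Archimedean[of "min (x + 1) (1 - x)"] by metis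
      have "1 / real (n + 2) \<le> inverse (real (Suc n))" by (simp add: field_simps)
      with n have "x \<in> {a n<..<b n}" by (auto simp: a_def b_def)
      then show "w x = c" using elim by blast
    qed
  qed
qed

lemma weak_deriv_unique:
  assumes "weak_deriv f g" "weak_deriv f h"
  shows "g \<doteq> h"
proof -
  have l: "loc_integrable g" "loc_integrable h" using assms by (auto simp: weak_deriv_def)
  have "AE x in lborel. x \<in> {-1<..<1} \<longrightarrow> g x - h x = 0"
  proof (rule du_Bois_Reymond)
    show "loc_integrable (\<lambda>x. g x - h x)" using l by (auto simp: loc_integrable_def)
    fix \<psi> assume \<psi>: "test_function \<psi>"
    have "(LBINT x:{-1<..<1}. (g x - h x) * \<psi> x) = (LBINT x:{-1<..<1}. g x * \<psi> x) - (LBINT x:{-1<..<1}. h x * \<psi> x)"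
      using test_integrable[OF l(1) \<psi>] test_integrable[OF l(2) \<psi>] by (simp add: left_diff_distrib)
    also have "\<dots> = 0" using assms \<psi> by (auto simp: weak_deriv_def)
    finally show "(LBINT x:{-1<..<1}. (g x - h x) * \<psi> x) = 0 * (LBINT x. \<psi> x)" by simp
  qed
  then show ?thesis by eventually_elim auto
qed

text \<open>Representatives in \<open>L1\<close> are arbitrary outside [-1,1]; cutting gives
  functions integrable on the whole line, for which shifts, primitives and Fubini need no
  bookkeeping of domains.\<close>

definition cut :: "(real \<Rightarrow> real) \<Rightarrow> real \<Rightarrow> real" where
  "cut h x = indicator {-1..1} x * h x"

lemma cut_integrable: "h \<in> L1 \<Longrightarrow> integrable lborel (cut h)"
  by (simp add: L1_def set_integrable_mult cut_def[abs_def])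

text \<open>The difference of F and the primitive of h annihilates every mean zero test function,
  because such a function is the derivative of a test function. A functional with that property is
  integration against a constant.\<close>

lemma weak_deriv_imp_prim:
  assumes wd: "weak_deriv F h" and h: "h \<in> L1"
  obtains c where "AE x in lborel. x \<in> {-1<..<1} \<longrightarrow> F x = c + prim (cut h) x"
proof -
  let ?P = "prim (cut h)"
  define w where "w = (\<lambda>x. F x - ?P x)"
  note ih = cut_integrable[OF h]
  have F: "loc_integrable F" using wd by (simp add: weak_deriv_def)
  have P: "loc_integrable ?P"
    unfolding loc_integrable_def
    using borel_integrable_compact[of _ ?P] continuous_prim[OF ih]
    by (auto simp: set_integrable_def intro!: continuous_at_imp_continuous_on)
  have w: "loc_integrable w" using F P by (auto simp: loc_integrable_def w_def)
  have zero: "(LBINT x:{-1<..<1}. w x * \<psi> x) = 0" if \<psi>: "test_function \<psi>" "(LBINT x. \<psi> x) = 0" for \<psi>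
  proof -
    define \<eta> where "\<eta> = prim \<psi>"
    have \<eta>: "test_function \<eta>" "deriv \<eta> = \<psi>" unfolding \<eta>_def using test_function_prim[OF \<psi>] by auto
    have i\<psi>: "integrable lborel \<psi>" by (rule test_function_integrable[OF \<psi>(1)])
    have "(LBINT x:{-1<..<1}. F x * \<psi> x) = - (LBINT x:{-1<..<1}. h x * \<eta> x)"
      using wd \<eta> by (auto simp: weak_deriv_def)
    moreover obtain a b where ab: "-1 < a" "a < b" "b < 1" "\<forall>x. x \<notin> {a<..<b} \<longrightarrow> \<eta> x = 0"
      using test_function_support[OF \<eta>(1)] by blast
    have "(LBINT x:{-1<..<1}. h x * \<eta> x) = (LBINT x. cut h x * \<eta> x)"
      unfolding set_lebesgue_integral_mult
    proof (intro Bochner_Integration.integral_cong refl)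
      show "indicator {-1<..<1} x * (h x * \<eta> x) = cut h x * \<eta> x" for x
        using spec[OF ab(4), of x] ab(1-3) by (cases "x \<in> {a<..<b}") (auto simp: indicator_def cut_def)
    qed
    moreover obtain a' b' where ab': "-1 < a'" "a' < b'" "b' < 1" "\<forall>x. x \<notin> {a'<..<b'} \<longrightarrow> \<psi> x = 0"
      using test_function_support[OF \<psi>(1)] by blast
    have "(LBINT x:{-1<..<1}. ?P x * \<psi> x) = (LBINT x. ?P x * \<psi> x)"
      unfolding set_lebesgue_integral_mult
    proof (intro Bochner_Integration.integral_cong refl)
      show "indicator {-1<..<1} x * (?P x * \<psi> x) = ?P x * \<psi> x" for x
        using spec[OF ab'(4), of x] ab'(1-3) by (cases "x \<in> {a'<..<b'}") (auto simp: indicator_def)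
    qed
    moreover have "(LBINT x. cut h x * \<eta> x) + (LBINT x. ?P x * \<psi> x) = 0"
      using prim_by_parts[OF ih i\<psi>] \<psi>(2) by (simp add: \<eta>_def)
    moreover have "(LBINT x:{-1<..<1}. w x * \<psi> x) = (LBINT x:{-1<..<1}. F x * \<psi> x) - (LBINT x:{-1<..<1}. ?P x * \<psi> x)"
      using test_integrable[OF F \<psi>(1)] test_integrable[OF P \<psi>(1)] by (simp add: w_def left_diff_distrib)
    ultimately show ?thesis by simp
  qed
  \<comment> \<open>One fixed bump of non-zero integral r: subtracting the multiple s / r of it from
    a test function of integral s leaves a mean zero one, and the value on \<rho> determines the
    constant c.\<close>
  define \<rho> where "\<rho> = cutoff (-1/2) (1/2) 0"
  have \<rho>: "test_function \<rho>" unfolding \<rho>_def by (intro test_function_cutoff) auto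
  define r where "r = (LBINT x. \<rho> x)"
  have "r \<noteq> 0"
  proof
    assume "r = 0"
    then have "AE x in lborel. \<rho> x = 0"
      using integral_nonneg_eq_0_iff_AE[OF test_function_integrable[OF \<rho>]] cutoff_bounds
      by (simp add: r_def \<rho>_def)
    then obtain x where "-1/2 < x" "x < 1/2" "\<rho> x = 0" using AE_lborel_ex[of "\<lambda>x. \<rho> x = 0" "-1/2" "1/2"] by auto
    then show False using cutoff_pos[of x "-1/2" "1/2" 0] by (simp add: \<rho>_def)
  qed
  define c where "c = (LBINT x:{-1<..<1}. w x * \<rho> x) / r"
  have "AE x in lborel. x \<in> {-1<..<1} \<longrightarrow> w x = c"
  proof (rule du_Bois_Reymond[OF w])
    fix \<psi> assume \<psi>: "test_function \<psi>"
    define s where "s = (LBINT x. \<psi> x)"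
    have t: "test_function (\<lambda>x. 1 * \<psi> x + (- s / r) * \<rho> x)" by (intro test_function_lincomb \<psi> \<rho>)
    have "(LBINT x. 1 * \<psi> x + (- s / r) * \<rho> x) = 0"
      using test_function_integrable[OF \<psi>] test_function_integrable[OF \<rho>] \<open>r \<noteq> 0\<close>
      by (simp add: r_def s_def)
    then have "(LBINT x:{-1<..<1}. w x * (1 * \<psi> x + (- s / r) * \<rho> x)) = 0"
      by (rule zero[OF t])
    moreover have "(\<lambda>x. w x * (1 * \<psi> x + (- s / r) * \<rho> x)) = (\<lambda>x. w x * \<psi> x - (s / r) * (w x * \<rho> x))"
      by (simp add: fun_eq_iff algebra_simps)
    ultimately have "(LBINT x:{-1<..<1}. w x * \<psi> x - (s / r) * (w x * \<rho> x)) = 0" by (simp only:)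
    then have "(LBINT x:{-1<..<1}. w x * \<psi> x) - (s / r) * (LBINT x:{-1<..<1}. w x * \<rho> x) = 0"
      using test_integrable[OF w \<psi>] test_integrable[OF w \<rho>] by simp
    then show "(LBINT x:{-1<..<1}. w x * \<psi> x) = c * (LBINT x. \<psi> x)"
      by (simp add: c_def s_def mult.commute)
  qed
  then have "AE x in lborel. x \<in> {-1<..<1} \<longrightarrow> F x = c + ?P x"
    by eventually_elim (auto simp: w_def)
  then show ?thesis by (rule that)
qed

section \<open>Shifted convolutions and difference quotients\<close>

lemma prim_lipschitz:
  assumes v: "integrable lborel v" "\<And>x. x \<in> {-1<..<1} \<Longrightarrow> \<bar>v x\<bar> \<le> M" and xy: "-1 \<le> x" "x \<le> y" "y \<le> 1"
  shows "\<bar>prim v y - prim v x\<bar> \<le> M * (y - x)"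
proof -
  have [measurable]: "v \<in> borel_measurable borel" using v by auto
  have "prim v y - prim v x = (LBINT t. indicator {x<..y} t * v t)"
    using prim_diff[OF v(1) xy(2)] by (simp add: set_lebesgue_integral_mult)
  also have "\<bar>\<dots>\<bar> \<le> (LBINT t. \<bar>indicator {x<..y} t * v t\<bar>)" by (rule integral_abs_bound)
  also have "\<dots> \<le> (LBINT t. M * indicator {x<..y} t)"
  proof (rule integral_mono_AE)
    show "integrable lborel (\<lambda>t. \<bar>indicator {x<..y} t * v t\<bar>)"
      using integrable_imp_set_integrable[OF v(1), of "{x<..y}"] by (simp add: set_integrable_mult)
    show "integrable lborel (\<lambda>t. M * indicator {x<..y} t)"
      using xy by (intro integrable_mult_right integrable_real_indicator) auto
    have "AE t in lborel. t \<noteq> 1" by (rule AE_lborel_singleton)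
    then show "AE t in lborel. \<bar>indicator {x<..y} t * v t\<bar> \<le> M * indicator {x<..y} t"
      by eventually_elim (use v(2) xy in \<open>auto simp: indicator_def\<close>)
  qed
  also have "\<dots> = M * (y - x)" using xy by simp
  finally show ?thesis .
qed

text \<open>Truncation past 1 may create a jump, but each fixed y < 1 is eventually to the left of
  it, and the integrands are dominated by B |V|.\<close>

lemma integral_shift_tendsto:
  fixes V F :: "real \<Rightarrow> real"
  assumes V: "integrable lborel V" "\<And>y. y \<notin> {-1..1} \<Longrightarrow> V y = 0"
    and F: "\<And>y. isCont F y" "\<And>y. \<bar>F y\<bar> \<le> B"
    and s: "\<And>n. s n > 0" "s \<longlonglongrightarrow> 0"
  shows "(\<lambda>n. LBINT y. (if y + s n < 1 then F (y + s n) else 0) * V y) \<longlonglongrightarrow> (LBINT y. F y * V y)"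
proof (rule integral_dominated_convergence[where w = "\<lambda>y. B * \<bar>V y\<bar>"])
  have [measurable]: "V \<in> borel_measurable borel" using V by auto
  have [measurable]: "F \<in> borel_measurable borel"
    by (intro borel_measurable_continuous_onI continuous_at_imp_continuous_on ballI F)
  show "(\<lambda>y. F y * V y) \<in> borel_measurable lborel" by simp
  show "(\<lambda>y. (if y + s n < 1 then F (y + s n) else 0) * V y) \<in> borel_measurable lborel" for n by simp
  show "integrable lborel (\<lambda>y. B * \<bar>V y\<bar>)" using V by simp
  have "B \<ge> 0" using F(2)[of 0] by simp
  then show "AE y in lborel. norm ((if y + s n < 1 then F (y + s n) else 0) * V y) \<le> B * \<bar>V y\<bar>" for n
    using F(2) by (auto simp: abs_mult intro!: mult_right_mono)
  have "AE y in lborel. y \<noteq> 1" by (rule AE_lborel_singleton)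
  then show "AE y in lborel. (\<lambda>n. (if y + s n < 1 then F (y + s n) else 0) * V y) \<longlonglongrightarrow> F y * V y"
  proof eventually_elim
    case (elim y)
    show ?case
    proof (cases "y < 1")
      case True
      have ys: "(\<lambda>n. y + s n) \<longlonglongrightarrow> y + 0" using s(2) by (intro tendsto_intros)
      then have "(\<lambda>n. F (y + s n)) \<longlonglongrightarrow> F y" using isCont_tendsto_compose[OF F(1)] by simp
      moreover have "\<forall>\<^sub>F n in sequentially. y + s n < 1" using ys True by (intro order_tendstoD) auto
      then have "\<forall>\<^sub>F n in sequentially. F (y + s n) = (if y + s n < 1 then F (y + s n) else 0)"
        by eventually_elim simp
      ultimately have "(\<lambda>n. if y + s n < 1 then F (y + s n) else 0) \<longlonglongrightarrow> F y"
        by (rule Lim_transform_eventually)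
      then show ?thesis by (intro tendsto_intros)
    next
      case False
      then have "V y = 0" using V(2)[of y] elim by simp
      then show ?thesis by simp
    qed
  qed
qed

text \<open>F is differentiated under the integral after extension by 0 past 1. For y < 1 - s the
  quotient is genuine and dominated by M |V| through the Lipschitz bound. On the slab [1 - s, 1) it
  equals -F V / s, which is unbounded in general and is controlled by the hypothesis
  \<open>slab\<close>; the next two lemmas give the two ways to verify it.\<close>

lemma difference_quotient_tendsto:
  fixes V F F' :: "real \<Rightarrow> real"
  assumes V: "integrable lborel V" "\<And>y. y \<notin> {-1..1} \<Longrightarrow> V y = 0"
    and F: "\<And>y. isCont F y" "\<And>y. \<bar>F y\<bar> \<le> B"
    and F': "\<And>y. y \<in> {-1<..<1} \<Longrightarrow> (F has_real_derivative F' y) (at y)" "F' \<in> borel_measurable borel"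
    and lip: "\<And>x y. -1 \<le> x \<Longrightarrow> x \<le> y \<Longrightarrow> y \<le> 1 \<Longrightarrow> \<bar>F y - F x\<bar> \<le> M * (y - x)"
    and s: "\<And>n. s n > 0" "s \<longlonglongrightarrow> 0"
    and slab: "(\<lambda>n. (LBINT y. indicator {1 - s n..<1} y * \<bar>F y * V y\<bar>) / s n) \<longlonglongrightarrow> 0"
  shows "(\<lambda>n. (LBINT y. ((if y + s n < 1 then F (y + s n) else 0) - F y) * V y) / s n)
    \<longlonglongrightarrow> (LBINT y. F' y * V y)"
proof -
  have [measurable]: "V \<in> borel_measurable borel" using V by auto
  have [measurable]: "F \<in> borel_measurable borel"
    by (intro borel_measurable_continuous_onI continuous_at_imp_continuous_on ballI F)
  note F'(2)[measurable]
  have M: "M \<ge> 0" using lip[of 0 1] by simp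
  have FV: "integrable lborel (\<lambda>y. F y * V y)"
    by (rule integrable_mult_bounded(2)[OF V(1) _ F(2)]) simp
  define d where "d = (\<lambda>n y. (if y + s n < 1 then (F (y + s n) - F y) / s n * V y else 0))"
  have [measurable]: "d n \<in> borel_measurable borel" for n unfolding d_def by measurable
  have dM: "\<bar>d n y\<bar> \<le> M * \<bar>V y\<bar>" for n y
  proof (cases "y \<in> {-1..1} \<and> y + s n < 1")
    case True
    then have "\<bar>F (y + s n) - F y\<bar> \<le> M * s n" using lip[of y "y + s n"] s(1)[of n] by auto
    then have "\<bar>(F (y + s n) - F y) / s n\<bar> \<le> M" using s(1)[of n] by (simp add: field_simps)
    then have "\<bar>(F (y + s n) - F y) / s n\<bar> * \<bar>V y\<bar> \<le> M * \<bar>V y\<bar>" by (rule mult_right_mono) simp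
    then show ?thesis using True unfolding d_def abs_mult[symmetric] by simp
  next
    case False
    then show ?thesis using V(2)[of y] M by (auto simp: d_def)
  qed
  have di: "integrable lborel (d n)" for n
    by (rule Bochner_Integration.integrable_bound[of _ "\<lambda>y. M * \<bar>V y\<bar>"]) (use V dM M in \<open>auto simp: abs_mult\<close>)
  have "(\<lambda>n. LBINT y. d n y) \<longlonglongrightarrow> (LBINT y. F' y * V y)"
  proof (rule integral_dominated_convergence[where w = "\<lambda>y. M * \<bar>V y\<bar>"])
    have "AE y in lborel. y \<noteq> 1" "AE y in lborel. y \<noteq> -1" by (rule AE_lborel_singleton)+
    then show "AE y in lborel. (\<lambda>n. d n y) \<longlonglongrightarrow> F' y * V y"
    proof eventually_elim
      case (elim y)
      show ?case
      proof (cases "y \<in> {-1<..<1}")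
        case True
        have "((\<lambda>h. (F (y + h) - F y) / h) \<longlongrightarrow> F' y) (at 0)" using F'(1)[OF True] by (simp add: DERIV_def)
        moreover have "filterlim s (at 0) sequentially"
          unfolding filterlim_at using s by (auto simp: eventually_sequentially less_imp_neq[symmetric] intro: less_imp_neq[OF s(1), symmetric])
        ultimately have "(\<lambda>n. (F (y + s n) - F y) / s n) \<longlonglongrightarrow> F' y" by (rule filterlim_compose)
        then have "(\<lambda>n. (F (y + s n) - F y) / s n * V y) \<longlonglongrightarrow> F' y * V y" by (intro tendsto_intros)
        moreover have "(\<lambda>n. y + s n) \<longlonglongrightarrow> y + 0" using s(2) by (intro tendsto_intros)
        then have "\<forall>\<^sub>F n in sequentially. y + s n < 1" using True by (intro order_tendstoD) auto
        then have "\<forall>\<^sub>F n in sequentially. (F (y + s n) - F y) / s n * V y = d n y"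
          by eventually_elim (simp add: d_def)
        ultimately show ?thesis by (rule Lim_transform_eventually)
      next
        case False
        then have "V y = 0" using V(2)[of y] elim by auto
        then have "d n y = 0" for n by (simp add: d_def)
        then show ?thesis using \<open>V y = 0\<close> by simp
      qed
    qed
  qed (use V dM in auto)
  moreover have "(\<lambda>n. (LBINT y. indicator {1 - s n..<1} y * (F y * V y)) / s n) \<longlonglongrightarrow> 0"
  proof (rule Lim_null_comparison[OF _ slab], rule always_eventually, rule allI)
    fix n
    have "\<bar>LBINT y. indicator {1 - s n..<1} y * (F y * V y)\<bar> \<le>
        (LBINT y. \<bar>indicator {1 - s n..<1} y * (F y * V y)\<bar>)" by (rule integral_abs_bound)
    also have "\<dots> = (LBINT y. indicator {1 - s n..<1} y * \<bar>F y * V y\<bar>)"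
      by (intro Bochner_Integration.integral_cong) (auto simp: indicator_def)
    finally show "norm ((LBINT y. indicator {1 - s n..<1} y * (F y * V y)) / s n) \<le>
        (LBINT y. indicator {1 - s n..<1} y * \<bar>F y * V y\<bar>) / s n"
      using s(1)[of n] by (simp add: divide_right_mono)
  qed
  ultimately have "(\<lambda>n. (LBINT y. d n y) - (LBINT y. indicator {1 - s n..<1} y * (F y * V y)) / s n)
      \<longlonglongrightarrow> (LBINT y. F' y * V y) - 0"
    by (intro tendsto_diff)
  moreover have "(LBINT y. d n y) - (LBINT y. indicator {1 - s n..<1} y * (F y * V y)) / s n =
      (LBINT y. ((if y + s n < 1 then F (y + s n) else 0) - F y) * V y) / s n" for n
  proof -
    have ii: "integrable lborel (\<lambda>y. indicator {1 - s n..<1} y * (F y * V y))"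
      using integrable_imp_set_integrable[OF FV, of "{1 - s n..<1}"] by (simp add: set_integrable_mult)
    have "(LBINT y. d n y) - (LBINT y. indicator {1 - s n..<1} y * (F y * V y)) / s n =
      (LBINT y. d n y - indicator {1 - s n..<1} y * (F y * V y) / s n)"
      using ii di[of n] by simp
    also have "\<dots> = (LBINT y. ((if y + s n < 1 then F (y + s n) else 0) - F y) * V y / s n)"
    proof (rule integral_cong_AE)
      have "AE y in lborel. y \<noteq> 1" by (rule AE_lborel_singleton)
      then show "AE y in lborel. d n y - indicator {1 - s n..<1} y * (F y * V y) / s n =
          ((if y + s n < 1 then F (y + s n) else 0) - F y) * V y / s n"
      proof eventually_elim
        case (elim y)
        then show ?case using V(2)[of y] s(1)[of n]
          by (cases "y < 1") (auto simp: d_def indicator_def field_simps)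
      qed
    qed simp_all
    finally show ?thesis by simp
  qed
  ultimately show ?thesis by simp
qed

text \<open>The slab has length s n, so a bound of F V by e on it already gives the averaged bound.
  This is the case where V is small at 1 and F may jump there.\<close>

lemma slab_tendsto_vanishing:
  fixes V F :: "real \<Rightarrow> real"
  assumes V: "integrable lborel V" and F: "F \<in> borel_measurable borel" "\<And>y. \<bar>F y\<bar> \<le> B"
    and s: "\<And>n. s n > 0" "s \<longlonglongrightarrow> 0"
    and small: "\<And>e. e > 0 \<Longrightarrow> \<exists>d>0. AE y in lborel. y \<in> {1 - d<..<1} \<longrightarrow> \<bar>V y\<bar> \<le> e"
  shows "(\<lambda>n. (LBINT y. indicator {1 - s n..<1} y * \<bar>F y * V y\<bar>) / s n) \<longlonglongrightarrow> 0"
proof (rule tendstoI)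
  fix e :: real assume "e > 0"
  have [measurable]: "V \<in> borel_measurable borel" using V by auto
  note F(1)[measurable]
  have B: "B \<ge> 0" using F(2)[of 0] by simp
  \<comment> \<open>Dividing by B + 1 rather than B allows B = 0 and makes B e' strictly smaller
    than e.\<close>
  define e' where "e' = e / (B + 1)"
  have e': "e' > 0" "B * e' < e"
    using \<open>e > 0\<close> B by (auto simp: e'_def field_simps)
  obtain d where d: "d > 0" and ae: "AE y in lborel. y \<in> {1 - d<..<1} \<longrightarrow> \<bar>V y\<bar> \<le> e'"
    using small[OF e'(1)] by blast
  have "\<forall>\<^sub>F n in sequentially. s n < d" using s(2) d by (intro order_tendstoD) auto
  then show "\<forall>\<^sub>F n in sequentially. dist ((LBINT y. indicator {1 - s n..<1} y * \<bar>F y * V y\<bar>) / s n) 0 < e"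
  proof eventually_elim
    case (elim n)
    have nn: "0 \<le> (LBINT y. indicator {1 - s n..<1} y * \<bar>F y * V y\<bar>)"
      by (intro integral_nonneg_AE) auto
    have "(LBINT y. indicator {1 - s n..<1} y * \<bar>F y * V y\<bar>) \<le> (LBINT y. (B * e') * indicator {1 - s n..<1} y)"
    proof (rule integral_mono_AE)
      have "integrable lborel (\<lambda>y. F y * V y)" by (rule integrable_mult_bounded(2)[OF V F])
      then show "integrable lborel (\<lambda>y. indicator {1 - s n..<1} y * \<bar>F y * V y\<bar>)"
        using integrable_imp_set_integrable[of "\<lambda>y. \<bar>F y * V y\<bar>" "{1 - s n..<1}"] by (simp add: set_integrable_mult)
      show "integrable lborel (\<lambda>y. (B * e') * indicator {1 - s n..<1} y)"
        using s(1)[of n] by (intro integrable_mult_right integrable_real_indicator) auto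
      show "AE y in lborel. indicator {1 - s n..<1} y * \<bar>F y * V y\<bar> \<le> (B * e') * indicator {1 - s n..<1} y"
        using ae
      proof eventually_elim
        case (elim y)
        then show ?case using \<open>s n < d\<close> F(2)[of y] B e'
          by (auto simp: indicator_def abs_mult intro!: mult_mono)
      qed
    qed
    also have "\<dots> = (B * e') * s n" using s(1)[of n] by simp
    finally have "(LBINT y. indicator {1 - s n..<1} y * \<bar>F y * V y\<bar>) / s n \<le> B * e'"
      using s(1)[of n] by (simp add: field_simps)
    moreover have "0 \<le> (LBINT y. indicator {1 - s n..<1} y * \<bar>F y * V y\<bar>) / s n"
      using nn s(1)[of n] by simp
    ultimately show ?case using e' by (simp only: dist_real_def diff_0_right abs_of_nonneg)
  qed
qed

text \<open>On the slab |F| <= M s n, which cancels the division; what remains is M times the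
  integral of |V| over shrinking sets. Here V is merely integrable and F vanishes linearly at
  1.\<close>

lemma slab_tendsto_linear:
  fixes V F :: "real \<Rightarrow> real"
  assumes V: "integrable lborel V" and F: "F \<in> borel_measurable borel" "\<And>y. \<bar>F y\<bar> \<le> B"
    and lin: "\<And>y. y \<in> {0<..<1} \<Longrightarrow> \<bar>F y\<bar> \<le> M * (1 - y)" "M \<ge> 0"
    and s: "\<And>n. s n > 0" "s \<longlonglongrightarrow> 0"
  shows "(\<lambda>n. (LBINT y. indicator {1 - s n..<1} y * \<bar>F y * V y\<bar>) / s n) \<longlonglongrightarrow> 0"
proof -
  have [measurable]: "V \<in> borel_measurable borel" using V by auto
  note F(1)[measurable]
  have "(\<lambda>n. LBINT y. indicator {1 - s n..<1} y * (M * \<bar>V y\<bar>)) \<longlonglongrightarrow> (LBINT (y::real). 0)"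
  proof (rule integral_dominated_convergence[where w = "\<lambda>y. M * \<bar>V y\<bar>"])
    show "AE y in lborel. (\<lambda>n. indicator {1 - s n..<1} y * (M * \<bar>V y\<bar>)) \<longlonglongrightarrow> 0"
    proof (rule AE_I2)
      fix y
      show "(\<lambda>n. indicator {1 - s n..<1} y * (M * \<bar>V y\<bar>)) \<longlonglongrightarrow> 0"
      proof (cases "y < 1")
        case True
        then have "\<forall>\<^sub>F n in sequentially. s n < 1 - y" using s(2) by (intro order_tendstoD) auto
        then have "\<forall>\<^sub>F n in sequentially. indicator {1 - s n..<1} y * (M * \<bar>V y\<bar>) = 0"
          by eventually_elim auto
        then show ?thesis by (rule tendsto_eventually)
      qed simp
    qed
    show "AE y in lborel. norm (indicator {1 - s n..<1} y * (M * \<bar>V y\<bar>)) \<le> M * \<bar>V y\<bar>" for n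
      using lin(2) by (auto simp: indicator_def)
  qed (use V in auto)
  then have "(\<lambda>n. LBINT y. indicator {1 - s n..<1} y * (M * \<bar>V y\<bar>)) \<longlonglongrightarrow> 0" by simp
  then show ?thesis
  proof (rule Lim_null_comparison[rotated])
    have "\<forall>\<^sub>F n in sequentially. s n < 1" using s(2) by (intro order_tendstoD) auto
    then show "\<forall>\<^sub>F n in sequentially. norm ((LBINT y. indicator {1 - s n..<1} y * \<bar>F y * V y\<bar>) / s n)
      \<le> (LBINT y. indicator {1 - s n..<1} y * (M * \<bar>V y\<bar>))"
    proof eventually_elim
      case (elim n)
      have nn: "0 \<le> (LBINT y. indicator {1 - s n..<1} y * \<bar>F y * V y\<bar>)"
        by (intro integral_nonneg_AE) auto
      have i1: "integrable lborel (\<lambda>y. indicator {1 - s n..<1} y * \<bar>F y * V y\<bar>)"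
      proof -
        have "integrable lborel (\<lambda>y. F y * V y)" by (rule integrable_mult_bounded(2)[OF V F])
        then show ?thesis
          using integrable_imp_set_integrable[of "\<lambda>y. \<bar>F y * V y\<bar>" "{1 - s n..<1}"] by (simp add: set_integrable_mult)
      qed
      have i2: "integrable lborel (\<lambda>y. indicator {1 - s n..<1} y * (M * \<bar>V y\<bar>))"
        using integrable_imp_set_integrable[of "\<lambda>y. M * \<bar>V y\<bar>" "{1 - s n..<1}"] V by (simp add: set_integrable_mult)
      have "(LBINT y. indicator {1 - s n..<1} y * \<bar>F y * V y\<bar>) \<le>
          (LBINT y. s n * (indicator {1 - s n..<1} y * (M * \<bar>V y\<bar>)))"
      proof (rule integral_mono_AE[OF i1 integrable_mult_right[OF i2]], rule AE_I2)
        fix y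
        show "indicator {1 - s n..<1} y * \<bar>F y * V y\<bar> \<le> s n * (indicator {1 - s n..<1} y * (M * \<bar>V y\<bar>))"
        proof (cases "y \<in> {1 - s n..<1}")
          case True
          then have "\<bar>F y\<bar> \<le> M * (1 - y)" using elim by (intro lin) auto
          also have "\<dots> \<le> M * s n" using True lin(2) by (intro mult_left_mono) auto
          finally have "\<bar>F y\<bar> * \<bar>V y\<bar> \<le> (M * s n) * \<bar>V y\<bar>" by (intro mult_right_mono) auto
          then show ?thesis using True by (simp add: abs_mult mult_ac)
        qed simp
      qed
      also have "\<dots> = s n * (LBINT y. indicator {1 - s n..<1} y * (M * \<bar>V y\<bar>))" by simp
      finally show ?case using nn s(1)[of n] by (simp add: field_simps)
    qed
  qed
qed

section \<open>Convolutions with a shifted kernel\<close>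

lemma AE_lborel_affine:
  assumes "AE x in lborel. P x" "c \<noteq> (0::real)"
  shows "AE x in lborel. P (t + c * x)"
proof -
  \<comment> \<open>P may fail to be measurable, so the change of variables is performed on a null
    set containing the exceptions.\<close>
  obtain N where N: "\<And>x. x \<in> space lborel - N \<Longrightarrow> P x" "N \<in> null_sets lborel"
    by (rule AE_E3[OF assms(1)]) blast
  have "AE x in lborel. t + c * x \<notin> N"
  proof (rule AE_borel_affine[OF assms(2)])
    show "Measurable.pred borel (\<lambda>x. x \<notin> N)"
    proof -
      have "N \<in> sets borel" using N(2) by (simp add: null_sets_def)
      then show ?thesis by measurable
    qed
    show "AE x in lborel. x \<notin> N" by (rule AE_not_in[OF N(2)])
  qed
  then show ?thesis
  proof eventually_elim
    case (elim x)
    then show ?case using N(1)[of "t + c * x"] by simp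
  qed
qed

text \<open>Integrate the absolute value over s as well: by Tonelli the inner integral over s is the
  L^1 norm of K whatever x and y are, so the triple integral is the product of three norms. It is
  finite, hence so is the integral over (x, y) for almost every s.\<close>

lemma AE_integrable_convolution:
  fixes U K V :: "real \<Rightarrow> real"
  assumes U: "integrable lborel U" and V: "integrable lborel V" and K: "integrable lborel K"
  shows "AE s in lborel. integrable (lborel \<Otimes>\<^sub>M lborel) (\<lambda>(x, y). U x * K (x - y - s) * V y)"
proof -
  have [measurable]: "U \<in> borel_measurable borel" "V \<in> borel_measurable borel" "K \<in> borel_measurable borel"
    using U V K by auto
  define f where "f = (\<lambda>s x y. ennreal \<bar>U x * K (x - y - s) * V y\<bar>)"
  have m1: "(\<lambda>(s, x). \<integral>\<^sup>+y. f s x y \<partial>lborel) \<in> borel_measurable (lborel \<Otimes>\<^sub>M lborel)"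
    unfolding f_def by measurable
  have m2: "(\<lambda>(s, y). f s x y) \<in> borel_measurable (lborel \<Otimes>\<^sub>M lborel)" for x
    unfolding f_def by measurable
  have "(\<integral>\<^sup>+s. \<integral>\<^sup>+x. \<integral>\<^sup>+y. f s x y \<partial>lborel \<partial>lborel \<partial>lborel) = (\<integral>\<^sup>+x. \<integral>\<^sup>+s. \<integral>\<^sup>+y. f s x y \<partial>lborel \<partial>lborel \<partial>lborel)"
    using lborel_pair.Fubini'[OF m1] by simp
  also have "\<dots> = (\<integral>\<^sup>+x. \<integral>\<^sup>+y. \<integral>\<^sup>+s. f s x y \<partial>lborel \<partial>lborel \<partial>lborel)"
    using lborel_pair.Fubini'[OF m2] by simp
  also have "\<dots> = (\<integral>\<^sup>+x. \<integral>\<^sup>+y. ennreal \<bar>U x\<bar> * (ennreal \<bar>V y\<bar> * (\<integral>\<^sup>+z. ennreal \<bar>K z\<bar> \<partial>lborel)) \<partial>lborel \<partial>lborel)"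
  proof (intro nn_integral_cong)
    fix x y
    have "(\<integral>\<^sup>+z. ennreal \<bar>K z\<bar> \<partial>lborel) = (\<integral>\<^sup>+s. ennreal \<bar>K ((x - y) + (-1) * s)\<bar> \<partial>lborel)"
      using nn_integral_real_affine[of "\<lambda>z. ennreal \<bar>K z\<bar>" "-1" "x - y"] by simp
    then show "(\<integral>\<^sup>+s. f s x y \<partial>lborel) = ennreal \<bar>U x\<bar> * (ennreal \<bar>V y\<bar> * (\<integral>\<^sup>+z. ennreal \<bar>K z\<bar> \<partial>lborel))"
      by (simp add: f_def abs_mult ennreal_mult' nn_integral_cmult[symmetric] mult_ac)
  qed
  also have "\<dots> = (\<integral>\<^sup>+x. ennreal \<bar>U x\<bar> \<partial>lborel) * ((\<integral>\<^sup>+y. ennreal \<bar>V y\<bar> \<partial>lborel) * (\<integral>\<^sup>+z. ennreal \<bar>K z\<bar> \<partial>lborel))"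
    by (simp add: nn_integral_cmult nn_integral_multc)
  also have "\<dots> < \<infinity>"
    using U V K by (simp add: integrable_iff_bounded ennreal_mult_less_top)
  finally have "AE s in lborel. (\<integral>\<^sup>+x. \<integral>\<^sup>+y. f s x y \<partial>lborel \<partial>lborel) \<noteq> \<infinity>"
    by (intro nn_integral_PInf_AE) (auto simp: f_def)
  then show ?thesis
  proof eventually_elim
    case (elim s)
    have "(\<integral>\<^sup>+p. ennreal (norm (case p of (x, y) \<Rightarrow> U x * K (x - y - s) * V y)) \<partial>(lborel \<Otimes>\<^sub>M lborel)) =
        (\<integral>\<^sup>+x. \<integral>\<^sup>+y. f s x y \<partial>lborel \<partial>lborel)"
      by (subst lborel.nn_integral_fst[symmetric]) (auto simp: f_def)
    then show ?case using elim by (simp add: integrable_iff_bounded less_top)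
  qed
qed

text \<open>At \<open>s = 0\<close> the double integral need not converge absolutely.\<close>

lemma conv_shift:
  fixes k u v :: "real \<Rightarrow> real"
  assumes k0: "\<forall>x\<le>0. k x = 0" and k: "integrable lborel (\<lambda>x. indicator {..2} x * k x)"
    and u: "u \<in> L1" and v: "v \<in> L1"
  shows "AE s in lborel. s \<ge> 0 \<longrightarrow>
    (LBINT x. cut u x * conv k v (x - s)) = (LBINT y. conv (\<lambda>x. k (- x)) u (y + s) * cut v y)"
proof -
  \<comment> \<open>For x and y in [-1,1] and s >= 0 the argument x - y - s never exceeds 2, so
    truncation at 2 loses nothing and yields a kernel integrable on the whole line.\<close>
  define K where "K = (\<lambda>x. indicator {..2} x * k x)"
  have K: "integrable lborel K" using k by (simp add: K_def)
  have "AE s in lborel. integrable (lborel \<Otimes>\<^sub>M lborel) (\<lambda>(x, y). cut u x * K (x - y - s) * cut v y)"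
    by (intro AE_integrable_convolution cut_integrable u v K)
  then show ?thesis
  proof (eventually_elim, intro impI)
    fix s :: real
    assume int: "integrable (lborel \<Otimes>\<^sub>M lborel) (\<lambda>(x, y). cut u x * K (x - y - s) * cut v y)" and s: "s \<ge> 0"
    have kK: "cut u x * K (x - y - s) * cut v y = cut u x * k (x - y - s) * cut v y" for x y
      using s by (auto simp: cut_def K_def indicator_def)
    have "(LBINT x. cut u x * conv k v (x - s)) = (LBINT x. (LBINT y. cut u x * K (x - y - s) * cut v y))"
    proof (intro Bochner_Integration.integral_cong refl)
      fix x
      have "(LBINT y. cut u x * K (x - y - s) * cut v y) = (LBINT y. cut u x * (indicator {-1..1} y * (k (x - s - y) * v y)))"
        unfolding kK by (intro Bochner_Integration.integral_cong) (auto simp: cut_def algebra_simps)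
      then show "cut u x * conv k v (x - s) = (LBINT y. cut u x * K (x - y - s) * cut v y)"
        by (simp add: conv_def set_lebesgue_integral_mult)
    qed
    also have "\<dots> = (LBINT y. (LBINT x. cut u x * K (x - y - s) * cut v y))"
      using lborel_pair.Fubini_integral[OF int] by simp
    also have "\<dots> = (LBINT y. conv (\<lambda>x. k (- x)) u (y + s) * cut v y)"
    proof (intro Bochner_Integration.integral_cong refl)
      fix y
      have "(LBINT x. cut u x * K (x - y - s) * cut v y) = (LBINT x. (indicator {-1..1} x * (k (- (y + s - x)) * u x)) * cut v y)"
        unfolding kK by (intro Bochner_Integration.integral_cong) (auto simp: cut_def algebra_simps)
      then show "(LBINT x. cut u x * K (x - y - s) * cut v y) = conv (\<lambda>x. k (- x)) u (y + s) * cut v y"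
        by (simp add: conv_def set_lebesgue_integral_mult)
    qed
    finally show "(LBINT x. cut u x * conv k v (x - s)) = (LBINT y. conv (\<lambda>x. k (- x)) u (y + s) * cut v y)" .
  qed
qed

lemma conv_left_eq_0:
  assumes "\<forall>x\<le>0. k x = 0" "x \<le> -1"
  shows "conv k v x = 0"
proof -
  have "(\<lambda>y. indicator {-1..1} y * (k (x - y) * v y)) = (\<lambda>y. 0)"
    using assms by (auto simp: fun_eq_iff indicator_def)
  then show ?thesis by (simp add: conv_def set_lebesgue_integral_mult)
qed

lemma conv_right_eq_0:
  assumes "\<forall>x\<le>0. k x = 0" "x \<ge> 1"
  shows "conv (\<lambda>x. k (- x)) v x = 0"
proof -
  have "(\<lambda>y. indicator {-1..1} y * (k (- (x - y)) * v y)) = (\<lambda>y. 0)"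
    using assms by (auto simp: fun_eq_iff indicator_def)
  then show ?thesis by (simp add: conv_def set_lebesgue_integral_mult)
qed

lemma borel_measurable_conv [measurable]:
  fixes k v :: "real \<Rightarrow> real"
  assumes [measurable]: "k \<in> borel_measurable borel" and v: "v \<in> L1"
  shows "conv k v \<in> borel_measurable borel"
proof -
  have [measurable]: "cut v \<in> borel_measurable borel" using cut_integrable[OF v] by auto
  have "conv k v = (\<lambda>x. LBINT y. k (x - y) * cut v y)"
    by (simp add: conv_def set_lebesgue_integral_mult cut_def fun_eq_iff mult.left_commute)
  then show ?thesis by simp
qed

text \<open>F and H represent the convolutions only inside (-1,1). The conditions in the integrands
  record that \<open>conv k v\<close> is exactly 0 to the left of -1 and the reflected convolution
  exactly 0 to the right of 1.\<close>

lemma conv_shift_representatives: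
  fixes k u v F H :: "real \<Rightarrow> real"
  assumes k0: "\<forall>x\<le>0. k x = 0" and k: "integrable lborel (\<lambda>x. indicator {..2} x * k x)"
    and km: "k \<in> borel_measurable borel"
    and u: "u \<in> L1" and v: "v \<in> L1"
    and F: "conv (\<lambda>x. k (- x)) u \<doteq> F" "F \<in> borel_measurable borel"
    and H: "conv k v \<doteq> H" "H \<in> borel_measurable borel"
  shows "AE s in lborel. s > 0 \<longrightarrow>
    (LBINT x. (if - 1 < x - s then H (x - s) else 0) * cut u x) = (LBINT y. (if y + s < 1 then F (y + s) else 0) * cut v y)"
  using conv_shift[OF k0 k u v]
proof eventually_elim
  note F(2)[measurable] H(2)[measurable] km[measurable]
  have [measurable]: "cut u \<in> borel_measurable borel" "cut v \<in> borel_measurable borel"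
    using cut_integrable[OF u] cut_integrable[OF v] by auto
  case (elim s)
  show ?case
  proof
    assume s: "s > 0"
    let ?h = "\<lambda>x. (if - 1 < x - s then H (x - s) else 0) * cut u x"
    let ?f = "\<lambda>y. (if y + s < 1 then F (y + s) else 0) * cut v y"
    have "AE x in lborel. (- s + 1 * x) \<in> {-1<..<1} \<longrightarrow> conv k v (- s + 1 * x) = H (- s + 1 * x)"
      by (rule AE_lborel_affine[OF H(1)]) simp
    then have h: "AE x in lborel. cut u x * conv k v (x - s) = ?h x"
    proof eventually_elim
      case (elim x)
      then show ?case using s conv_left_eq_0[OF k0, of "x - s" v] by (auto simp: cut_def indicator_def)
    qed
    have "AE y in lborel. (s + 1 * y) \<in> {-1<..<1} \<longrightarrow> conv (\<lambda>x. k (- x)) u (s + 1 * y) = F (s + 1 * y)"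
      by (rule AE_lborel_affine[OF F(1)]) simp
    then have f: "AE y in lborel. conv (\<lambda>x. k (- x)) u (y + s) * cut v y = ?f y"
    proof eventually_elim
      case (elim y)
      then show ?case using s conv_right_eq_0[OF k0, of "y + s" u] by (auto simp: cut_def indicator_def add.commute)
    qed
    have [measurable]: "conv k v \<in> borel_measurable borel" "conv (\<lambda>x. k (- x)) u \<in> borel_measurable borel"
      by (intro borel_measurable_conv u v; measurable)+
    have "(LBINT x. ?h x) = (LBINT x. cut u x * conv k v (x - s))"
      using h by (intro integral_cong_AE) (auto elim!: eventually_mono)
    also have "\<dots> = (LBINT y. conv (\<lambda>x. k (- x)) u (y + s) * cut v y)"
      using elim s by simp
    also have "\<dots> = (LBINT y. ?f y)"
      using f by (intro integral_cong_AE) auto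
    finally show "(LBINT x. ?h x) = (LBINT y. ?f y)" .
  qed
qed

section \<open>Integration by parts for the fractional operators\<close>

text \<open>Limits in s are taken along a sequence of admissible shifts, since identities are
  available for almost every s only.\<close>

lemma AE_lborel_null_sequence:
  assumes "AE s in lborel. s > 0 \<longrightarrow> Q s"
  obtains s :: "nat \<Rightarrow> real" where "\<And>n. s n > 0" "s \<longlonglongrightarrow> 0" "\<And>n. Q (s n)"
proof -
  have "\<exists>s. 0 < s \<and> s < inverse (real (Suc n)) \<and> Q s" for n
  proof -
    obtain s where "0 < s" "s < inverse (real (Suc n))" "s > 0 \<longrightarrow> Q s"
      by (rule AE_lborel_ex[OF assms, of 0 "inverse (real (Suc n))"]) auto
    then show ?thesis by blast
  qed
  then obtain s where s: "\<forall>n. 0 < s n \<and> s n < inverse (real (Suc n)) \<and> Q (s n)" by metis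
  have "s \<longlonglongrightarrow> 0"
  proof (rule tendsto_sandwich[OF _ _ tendsto_const LIMSEQ_inverse_real_of_nat])
    show "\<forall>\<^sub>F n in sequentially. 0 \<le> s n" using s by (auto intro!: always_eventually less_imp_le)
    show "\<forall>\<^sub>F n in sequentially. s n \<le> inverse (real (Suc n))" using s by (auto intro!: always_eventually less_imp_le)
  qed
  then show ?thesis using s that by blast
qed

lemma lborel_integral_reflect:
  fixes f :: "real \<Rightarrow> real"
  shows "(LBINT x. f (- x)) = (LBINT x. f x)"
  using lborel_integral_real_affine[of "-1" f 0] by simp

lemma lborel_integrable_reflect:
  fixes f :: "real \<Rightarrow> real"
  shows "integrable lborel f \<Longrightarrow> integrable lborel (\<lambda>x. f (- x))"
  using lborel_integrable_real_affine[of f "-1" 0] by simp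

lemma AE_lborel_reflect: "AE x in lborel. P x \<Longrightarrow> AE x in lborel. P (- x :: real)"
  using AE_lborel_affine[of P "-1" 0] by simp

text \<open>The substitution x = -y in one integral moves its truncation from -1 to 1. Both sides
  then have the same shape, and the limit lemmas for the right endpoint serve both.\<close>

lemma conv_reflected_sequence:
  fixes k u v F H :: "real \<Rightarrow> real"
  assumes k0: "\<forall>x\<le>0. k x = 0" and k: "integrable lborel (\<lambda>x. indicator {..2} x * k x)"
    and km: "k \<in> borel_measurable borel"
    and u: "u \<in> L1" and v: "v \<in> L1"
    and F: "conv (\<lambda>x. k (- x)) u \<doteq> F" "F \<in> borel_measurable borel"
    and H: "conv k v \<doteq> H" "H \<in> borel_measurable borel"
  obtains s :: "nat \<Rightarrow> real" where "\<And>n. s n > 0" "s \<longlonglongrightarrow> 0"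
    "\<And>n. (LBINT y. (if y + s n < 1 then H (- (y + s n)) else 0) * cut u (- y)) =
      (LBINT y. (if y + s n < 1 then F (y + s n) else 0) * cut v y)"
proof -
  obtain s :: "nat \<Rightarrow> real" where s: "\<And>n. s n > 0" "s \<longlonglongrightarrow> 0"
    and eq: "\<And>n. (LBINT x. (if - 1 < x - s n then H (x - s n) else 0) * cut u x) =
      (LBINT y. (if y + s n < 1 then F (y + s n) else 0) * cut v y)"
    by (rule AE_lborel_null_sequence[OF conv_shift_representatives[OF assms]]) blast
  have "(LBINT y. (if y + s n < 1 then H (- (y + s n)) else 0) * cut u (- y)) =
      (LBINT x. (if - 1 < x - s n then H (x - s n) else 0) * cut u x)" for n
  proof -
    have "(\<lambda>y. (if y + s n < 1 then H (- (y + s n)) else 0) * cut u (- y)) =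
        (\<lambda>y. (\<lambda>x. (if - 1 < x - s n then H (x - s n) else 0) * cut u x) (- y))"
      by (auto simp: fun_eq_iff)
    then show ?thesis
      by (simp only: lborel_integral_reflect[of "\<lambda>x. (if - 1 < x - s n then H (x - s n) else 0) * cut u x"])
  qed
  then show ?thesis using eq by (intro that[OF s]) (simp only:)
qed

lemma cut_outside: "y \<notin> {-1..1} \<Longrightarrow> cut v y = 0"
  by (simp add: cut_def)

lemma conv_pairing_limit:
  fixes U V F H :: "real \<Rightarrow> real"
  assumes U: "integrable lborel U" "\<And>y. y \<notin> {-1..1} \<Longrightarrow> U y = 0"
    and V: "integrable lborel V" "\<And>y. y \<notin> {-1..1} \<Longrightarrow> V y = 0"
    and F: "\<And>y. isCont F y" "\<And>y. \<bar>F y\<bar> \<le> B"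
    and H: "\<And>y. isCont H y" "\<And>y. \<bar>H y\<bar> \<le> C"
    and s: "\<And>n. s n > 0" "s \<longlonglongrightarrow> 0"
    and eq: "\<And>n. (LBINT y. (if y + s n < 1 then H (y + s n) else 0) * U y) =
      (LBINT y. (if y + s n < 1 then F (y + s n) else 0) * V y)"
  shows "(LBINT y. H y * U y) = (LBINT y. F y * V y)"
proof -
  have "(\<lambda>n. LBINT y. (if y + s n < 1 then H (y + s n) else 0) * U y) \<longlonglongrightarrow> (LBINT y. H y * U y)"
    by (rule integral_shift_tendsto[OF U H s])
  moreover have "(\<lambda>n. LBINT y. (if y + s n < 1 then F (y + s n) else 0) * V y) \<longlonglongrightarrow> (LBINT y. F y * V y)"
    by (rule integral_shift_tendsto[OF V F s])
  ultimately show ?thesis unfolding eq by (rule LIMSEQ_unique)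
qed

text \<open>On \<open>[-1,1]\<close>, the absolutely continuous function with value \<open>c\<close> at \<open>-1\<close> and derivative \<open>h\<close>.\<close>

definition acf :: "real \<Rightarrow> (real \<Rightarrow> real) \<Rightarrow> real \<Rightarrow> real" where
  "acf c h x = c + prim (cut h) x"

lemma isCont_acf: "h \<in> L1 \<Longrightarrow> isCont (acf c h) x"
  unfolding acf_def by (intro continuous_intros continuous_prim cut_integrable)

lemma borel_measurable_acf: "h \<in> L1 \<Longrightarrow> acf c h \<in> borel_measurable borel"
  by (intro borel_measurable_continuous_onI continuous_at_imp_continuous_on ballI isCont_acf)

lemma acf_bound: "h \<in> L1 \<Longrightarrow> \<bar>acf c h x\<bar> \<le> \<bar>c\<bar> + (LBINT y. \<bar>cut h y\<bar>)"
  unfolding acf_def using prim_bound[OF cut_integrable, of h x] by linarith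

lemma prim_cut_left: "prim (cut h) (-1) = 0"
proof -
  have "prim (cut h) (-1) = (LBINT y. indicator {-1} y * cut h y)"
    unfolding prim_def set_lebesgue_integral_mult
    by (intro Bochner_Integration.integral_cong) (auto simp: cut_def indicator_def)
  also have "\<dots> = (LBINT (y::real). indicator {-1} y * cut h (-1))"
    by (intro Bochner_Integration.integral_cong) (auto simp: indicator_def)
  finally show ?thesis by simp
qed

lemma prim_cut_right: "prim (cut h) 1 = (LBINT y. cut h y)"
  unfolding prim_def set_lebesgue_integral_mult
  by (intro Bochner_Integration.integral_cong) (auto simp: cut_def indicator_def)

lemma acf_by_parts:
  assumes a: "a \<in> L1" and b: "b \<in> L1"
  shows "(LBINT x. acf d b x * cut a x) + (LBINT x. acf c a x * cut b x) =
    acf c a 1 * acf d b 1 - acf c a (-1) * acf d b (-1)"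
proof -
  note ia = cut_integrable[OF a] and ib = cut_integrable[OF b]
  have "integrable lborel (\<lambda>x. cut a x * prim (cut b) x)" "integrable lborel (\<lambda>x. prim (cut a) x * cut b x)"
    by (rule integrable_mult_bounded(1)[OF ia borel_measurable_prim[OF ib] prim_bound[OF ib]],
        rule integrable_mult_bounded(2)[OF ib borel_measurable_prim[OF ia] prim_bound[OF ia]])
  then have "(LBINT x. acf d b x * cut a x) = d * (LBINT x. cut a x) + (LBINT x. cut a x * prim (cut b) x)"
    "(LBINT x. acf c a x * cut b x) = c * (LBINT x. cut b x) + (LBINT x. prim (cut a) x * cut b x)"
  proof -
    assume i: "integrable lborel (\<lambda>x. cut a x * prim (cut b) x)" "integrable lborel (\<lambda>x. prim (cut a) x * cut b x)"
    have "(\<lambda>x. acf d b x * cut a x) = (\<lambda>x. d * cut a x + cut a x * prim (cut b) x)"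
      "(\<lambda>x. acf c a x * cut b x) = (\<lambda>x. c * cut b x + prim (cut a) x * cut b x)"
      by (simp_all add: acf_def fun_eq_iff algebra_simps)
    with i ia ib show "(LBINT x. acf d b x * cut a x) = d * (LBINT x. cut a x) + (LBINT x. cut a x * prim (cut b) x)"
      "(LBINT x. acf c a x * cut b x) = c * (LBINT x. cut b x) + (LBINT x. prim (cut a) x * cut b x)"
      by simp_all
  qed
  then show ?thesis
    using prim_by_parts[OF ia ib] by (simp add: acf_def prim_cut_left prim_cut_right algebra_simps)
qed

lemma acf_has_derivative:
  assumes h: "h \<in> L1" and c: "continuous_on {-1<..<1} h" and y: "y \<in> {-1<..<1}"
  shows "(acf c0 h has_real_derivative h y) (at y)"
proof -
  let ?a = "(y - 1) / 2" and ?b = "(y + 1) / 2"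
  have ab: "?a < y" "y < ?b" "-1 < ?a" "?b < 1" using y by auto
  have "continuous_on {?a..?b} h" using ab by (intro continuous_on_subset[OF c]) auto
  moreover have "cut h x = h x" if "x \<in> {?a..?b}" for x using that ab by (auto simp: cut_def)
  ultimately have "continuous_on {?a..?b} (cut h)"
    using continuous_on_cong[OF refl, of "{?a..?b}" "cut h" h] by blast
  then have "(prim (cut h) has_real_derivative cut h y) (at y)"
    by (rule prim_has_derivative[OF cut_integrable[OF h] _ ab(1,2)])
  then have "((\<lambda>x. c0 + prim (cut h) x) has_real_derivative 0 + cut h y) (at y)"
    by (intro DERIV_add DERIV_const)
  then show ?thesis using y by (simp add: acf_def[abs_def] cut_def)
qed

lemma acf_lipschitz:
  assumes h: "h \<in> L1" "\<And>x. x \<in> {-1<..<1} \<Longrightarrow> \<bar>h x\<bar> \<le> M" and xy: "-1 \<le> x" "x \<le> y" "y \<le> 1"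
  shows "\<bar>acf c h y - acf c h x\<bar> \<le> M * (y - x)"
  using prim_lipschitz[OF cut_integrable[OF h(1)] _ xy, of M] h(2) by (simp add: acf_def cut_def)

lemma continuous_imp_L1:
  assumes "\<And>x. isCont f x"
  shows "f \<in> L1"
  using borel_integrable_compact[of "{-1..1::real}" f] assms
  by (simp add: L1_def set_integrable_def continuous_at_imp_continuous_on)

lemma acf_L1: "h \<in> L1 \<Longrightarrow> acf c h \<in> L1"
  using isCont_acf by (rule continuous_imp_L1)

lemma integral_eq_acf:
  assumes "f \<in> L1" "k \<in> L1" "h \<in> L1" "f \<doteq> acf c h"
  shows "(LBINT x:{-1..1}. f x * k x) = (LBINT x. acf c h x * cut k x)"
proof -
  have [measurable]: "cut f \<in> borel_measurable borel" "cut k \<in> borel_measurable borel" "acf c h \<in> borel_measurable borel"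
    using cut_integrable assms borel_measurable_acf by auto
  have "(LBINT x:{-1..1}. f x * k x) = (LBINT x. cut f x * cut k x)"
    unfolding set_lebesgue_integral_mult
    by (intro Bochner_Integration.integral_cong) (auto simp: cut_def indicator_def)
  also have "\<dots> = (LBINT x. acf c h x * cut k x)"
  proof (rule integral_cong_AE)
    have "AE x in lborel. x \<noteq> 1" "AE x in lborel. x \<noteq> -1" by (rule AE_lborel_singleton)+
    then show "AE x in lborel. cut f x * cut k x = acf c h x * cut k x"
      using assms(4) by eventually_elim (auto simp: cut_def indicator_def)
  qed simp_all
  finally show ?thesis .
qed

lemma weak_deriv_acf:
  assumes "weak_deriv F h" "h \<in> L1"
  obtains c where "F \<doteq> acf c h"
  by (rule weak_deriv_imp_prim[OF assms]) (auto simp: acf_def)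

lemma weak_deriv_cong_AE:
  assumes wd: "weak_deriv F g" and ae: "g \<doteq> g'" and g': "loc_integrable g'"
  shows "weak_deriv F g'"
  unfolding weak_deriv_def
proof (intro conjI allI impI)
  show "loc_integrable F" "loc_integrable g'" using wd g' by (auto simp: weak_deriv_def)
  fix \<eta> assume \<eta>: "test_function \<eta>"
  have g: "loc_integrable g" using wd by (simp add: weak_deriv_def)
  have "(LBINT x:{-1<..<1}. g x * \<eta> x) = (LBINT x:{-1<..<1}. g' x * \<eta> x)"
    unfolding set_lebesgue_integral_mult
  proof (rule integral_cong_AE)
    show "AE x in lborel. indicator {-1<..<1} x * (g x * \<eta> x) = indicator {-1<..<1} x * (g' x * \<eta> x)"
      using ae by eventually_elim (auto simp: indicator_def)
  qed (use test_integrable[OF g \<eta>] test_integrable[OF g' \<eta>] in \<open>auto simp: set_integrable_mult\<close>)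
  then show "(LBINT x:{-1<..<1}. F x * deriv \<eta> x) = - (LBINT x:{-1<..<1}. g' x * \<eta> x)"
    using wd \<eta> by (simp add: weak_deriv_def)
qed

lemma conv_cong_AE:
  assumes [measurable]: "k \<in> borel_measurable borel" and uv: "u \<in> L1" "v \<in> L1"
    and ae: "u \<doteq> v"
  shows "conv k u = conv k v"
proof
  fix x
  have [measurable]: "cut u \<in> borel_measurable borel" "cut v \<in> borel_measurable borel"
    using cut_integrable uv by auto
  have "conv k w x = (LBINT y. k (x - y) * cut w y)" for w
    by (simp add: conv_def set_lebesgue_integral_mult cut_def mult.left_commute)
  moreover have "(LBINT y. k (x - y) * cut u y) = (LBINT y. k (x - y) * cut v y)"
  proof (rule integral_cong_AE)
    have "AE y in lborel. y \<noteq> 1" "AE y in lborel. y \<noteq> -1" by (rule AE_lborel_singleton)+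
    then show "AE y in lborel. k (x - y) * cut u y = k (x - y) * cut v y"
      using ae by eventually_elim (auto simp: cut_def indicator_def)
  qed simp_all
  ultimately show "conv k u x = conv k v x" by simp
qed

lemma vanishes_at_cong_AE:
  assumes "vanishes_at f F" "f \<doteq> g"
  shows "vanishes_at g F"
proof -
  obtain h where h: "h \<doteq> f" "(h \<longlongrightarrow> 0) F"
    using assms(1) by (auto simp: vanishes_at_def)
  have "h \<doteq> g"
    using h(1) assms(2) by eventually_elim auto
  then show ?thesis using h(2) by (auto simp: vanishes_at_def)
qed

lemma vanishes_at_left_small:
  assumes "vanishes_at f (at_left 1)" "e > 0"
  shows "\<exists>d>0. AE y in lborel. y \<in> {1 - d<..<1} \<longrightarrow> \<bar>cut f y\<bar> \<le> e"
proof -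
  obtain g where g: "g \<doteq> f" "(g \<longlongrightarrow> 0) (at_left 1)"
    using assms(1) by (auto simp: vanishes_at_def)
  have "\<forall>\<^sub>F x in at_left 1. dist (g x) 0 < e" using g(2) assms(2) by (rule tendstoD)
  then obtain c where c: "c < 1" "\<And>x. c < x \<Longrightarrow> x < 1 \<Longrightarrow> \<bar>g x\<bar> < e"
    by (auto simp: eventually_at_left_field)
  show ?thesis
  proof (intro exI conjI)
    \<comment> \<open>The minimum with 1 keeps the interval inside (0,1), where the almost
      everywhere equality is available.\<close>
    show "min 1 (1 - c) > 0" using c by simp
    show "AE y in lborel. y \<in> {1 - min 1 (1 - c)<..<1} \<longrightarrow> \<bar>cut f y\<bar> \<le> e"
      using g(1)
    proof eventually_elim
      case (elim y)
      then show ?case using c(2)[of y] by (auto simp: cut_def min_def split: if_splits)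
    qed
  qed
qed

lemma vanishes_at_right_small:
  assumes "vanishes_at f (at_right (-1))" "e > 0"
  shows "\<exists>d>0. AE y in lborel. y \<in> {1 - d<..<1} \<longrightarrow> \<bar>cut f (- y)\<bar> \<le> e"
proof -
  obtain g where g: "g \<doteq> f" "(g \<longlongrightarrow> 0) (at_right (-1))"
    using assms(1) by (auto simp: vanishes_at_def)
  have "\<forall>\<^sub>F x in at_right (-1). dist (g x) 0 < e" using g(2) assms(2) by (rule tendstoD)
  then obtain c where c: "-1 < c" "\<And>x. -1 < x \<Longrightarrow> x < c \<Longrightarrow> \<bar>g x\<bar> < e"
    by (auto simp: eventually_at_right_field)
  show ?thesis
  proof (intro exI conjI)
    show "min 1 (c + 1) > 0" using c by simp
    show "AE y in lborel. y \<in> {1 - min 1 (c + 1)<..<1} \<longrightarrow> \<bar>cut f (- y)\<bar> \<le> e"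
      using AE_lborel_reflect[OF g(1)]
    proof eventually_elim
      case (elim y)
      then show ?case using c(2)[of "- y"] by (auto simp: cut_def min_def split: if_splits)
    qed
  qed
qed

text \<open>Integrating by parts on each side leaves the pairing of F with v and that of u with H,
  which agree by letting the shift tend to 0. The boundary products are compared rather than set to
  0 separately: a Dirichlet condition kills f and g at the endpoint, a Neumann condition kills F and
  H, and either way both products vanish.\<close>

lemma caputo_duality:
  fixes k :: "real \<Rightarrow> real"
  assumes k0: "\<forall>x\<le>0. k x = 0" and k: "integrable lborel (\<lambda>x. indicator {..2} x * k x)"
    and km: "k \<in> borel_measurable borel"
    and L1: "f \<in> L1" "u \<in> L1" "h \<in> L1" "g \<in> L1" "v \<in> L1" "p \<in> L1"
    and f: "f \<doteq> acf cf u"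
    and F: "conv (\<lambda>x. k (- x)) u \<doteq> acf cF h"
    and g: "g \<doteq> acf cg v"
    and H: "conv k v \<doteq> acf cH p"
    and bdry: "acf cF h 1 * acf cg v 1 = acf cf u 1 * acf cH p 1"
      "acf cF h (-1) * acf cg v (-1) = acf cf u (-1) * acf cH p (-1)"
  shows "(LBINT x:{-1..1}. h x * g x) = (LBINT x:{-1..1}. f x * p x)"
proof -
  obtain s :: "nat \<Rightarrow> real" where s: "\<And>n. s n > 0" "s \<longlonglongrightarrow> 0"
    and eq: "\<And>n. (LBINT y. (if y + s n < 1 then acf cH p (- (y + s n)) else 0) * cut u (- y)) =
      (LBINT y. (if y + s n < 1 then acf cF h (y + s n) else 0) * cut v y)"
    by (rule conv_reflected_sequence[OF k0 k km L1(2) L1(5) F borel_measurable_acf[OF L1(3)] H borel_measurable_acf[OF L1(6)]]) blast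
  have "(LBINT y. acf cH p (- y) * cut u (- y)) = (LBINT y. acf cF h y * cut v y)"
  proof (rule conv_pairing_limit[OF _ _ _ _ _ _ _ _ s])
    show "integrable lborel (\<lambda>y. cut u (- y))" "integrable lborel (cut v)"
      by (intro lborel_integrable_reflect cut_integrable L1)+
    show "isCont (acf cF h) y" for y by (intro isCont_acf L1)
    show "isCont (\<lambda>y. acf cH p (- y)) y" for y
      by (rule isCont_o2[OF _ isCont_acf]) (auto intro: L1)
    show "\<bar>acf cF h y\<bar> \<le> \<bar>cF\<bar> + (LBINT y. \<bar>cut h y\<bar>)" for y by (rule acf_bound[OF L1(3)])
    show "\<bar>acf cH p (- y)\<bar> \<le> \<bar>cH\<bar> + (LBINT y. \<bar>cut p y\<bar>)" for y by (rule acf_bound[OF L1(6)])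
    show "cut v y = 0" if "y \<notin> {-1..1}" for y using that by (rule cut_outside)
    show "cut u (- y) = 0" if "y \<notin> {-1..1}" for y using that by (intro cut_outside) auto
  qed (rule eq)
  then have "(LBINT y. acf cH p y * cut u y) = (LBINT y. acf cF h y * cut v y)"
    using lborel_integral_reflect[of "\<lambda>y. acf cH p y * cut u y"] by simp
  moreover have "(LBINT x:{-1..1}. h x * g x) = (LBINT x. acf cg v x * cut h x)"
    using integral_eq_acf[OF L1(4,3,5) g] by (simp add: mult.commute)
  moreover have "(LBINT x:{-1..1}. f x * p x) = (LBINT x. acf cf u x * cut p x)"
    by (rule integral_eq_acf[OF L1(1,6,2) f])
  ultimately show ?thesis
    using acf_by_parts[OF L1(3,5), of cg cF] acf_by_parts[OF L1(2,6), of cH cf] bdry by simp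
qed

text \<open>The function \<open>conv k g\<close> may jump at \<open>-1\<close> from \<open>0\<close> to \<open>cH\<close>. In the difference quotient of its extension
  by zero this contributes \<open>\<integral>u\<close> over \<open>[-1, -1 + s]\<close> times \<open>cH / s\<close>, which tends to \<open>0\<close> because \<open>u\<close> vanishes at \<open>-1\<close>.\<close>

lemma riemann_liouville_duality:
  fixes k :: "real \<Rightarrow> real"
  assumes k0: "\<forall>x\<le>0. k x = 0" and k: "integrable lborel (\<lambda>x. indicator {..2} x * k x)"
    and km: "k \<in> borel_measurable borel"
    and L1: "f \<in> L1" "u \<in> L1" "h \<in> L1" "g \<in> L1" "p \<in> L1"
    and h: "continuous_on {-1<..<1} h" "\<And>x. x \<in> {-1<..<1} \<Longrightarrow> \<bar>h x\<bar> \<le> M"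
    and f: "f \<doteq> acf cf u"
    and F: "conv (\<lambda>x. k (- x)) u \<doteq> acf cF h"
    and H: "conv k g \<doteq> acf cH (acf c0 p)"
    and u: "vanishes_at u (at_right (-1))"
    and left: "acf c0 p (-1) = 0"
    and right: "acf cf u 1 * acf c0 p 1 = 0" "vanishes_at g (at_left 1) \<or> acf cF h 1 = 0"
  shows "(LBINT x:{-1..1}. h x * g x) = (LBINT x:{-1..1}. f x * p x)"
proof -
  let ?q = "acf c0 p"
  let ?F = "acf cF h" and ?H = "\<lambda>y. acf cH ?q (- y)" and ?U = "\<lambda>y. cut u (- y)" and ?V = "cut g"
  have q: "?q \<in> L1" by (rule acf_L1[OF L1(5)])
  have M: "M \<ge> 0" using h(2)[of 0] by simp
  obtain s :: "nat \<Rightarrow> real" where s: "\<And>n. s n > 0" "s \<longlonglongrightarrow> 0"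
    and eq: "\<And>n. (LBINT y. (if y + s n < 1 then acf cH ?q (- (y + s n)) else 0) * ?U y) =
      (LBINT y. (if y + s n < 1 then ?F (y + s n) else 0) * ?V y)"
    by (rule conv_reflected_sequence[OF k0 k km L1(2,4) F borel_measurable_acf[OF L1(3)] H borel_measurable_acf[OF q]]) blast
  have U: "integrable lborel ?U" "\<And>y. y \<notin> {-1..1} \<Longrightarrow> ?U y = 0"
    by (intro lborel_integrable_reflect cut_integrable L1, intro cut_outside, auto)
  have V: "integrable lborel ?V" "\<And>y. y \<notin> {-1..1} \<Longrightarrow> ?V y = 0"
    by (intro cut_integrable L1, rule cut_outside)
  have Fc: "isCont ?F y" "\<bar>?F y\<bar> \<le> \<bar>cF\<bar> + (LBINT y. \<bar>cut h y\<bar>)" for y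
    by (rule isCont_acf[OF L1(3)], rule acf_bound[OF L1(3)])
  have Hc: "isCont ?H y" "\<bar>?H y\<bar> \<le> \<bar>cH\<bar> + (LBINT y. \<bar>cut ?q y\<bar>)" for y
    by (rule isCont_o2[OF _ isCont_acf[OF q]]) (auto intro: acf_bound[OF q])
  have Fm: "?F \<in> borel_measurable borel" and Hm: "?H \<in> borel_measurable borel"
    by (intro borel_measurable_continuous_onI continuous_at_imp_continuous_on ballI Fc Hc)+
  have pair: "(LBINT y. ?H y * ?U y) = (LBINT y. ?F y * ?V y)"
    by (rule conv_pairing_limit[OF U V Fc Hc s eq])
  \<comment> \<open>Subtracting \<open>pair\<close> from \<open>eq\<close> and dividing by s n turns
    the identity into one between difference quotients in the shift. On this side the slab at 1 is
    harmless either because g is small there (condition D) or because F vanishes at 1 with Lipschitz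
    bound M (condition N).\<close>
  have "(\<lambda>n. (LBINT y. ((if y + s n < 1 then ?F (y + s n) else 0) - ?F y) * ?V y) / s n)
    \<longlonglongrightarrow> (LBINT y. cut h y * ?V y)"
  proof (rule difference_quotient_tendsto[OF V Fc _ _ _ s])
    show "(?F has_real_derivative cut h y) (at y)" if "y \<in> {-1<..<1}" for y
      using acf_has_derivative[OF L1(3) h(1) that] that by (simp add: cut_def)
    show "cut h \<in> borel_measurable borel" using cut_integrable[OF L1(3)] by auto
    show "\<bar>?F y - ?F x\<bar> \<le> M * (y - x)" if "-1 \<le> x" "x \<le> y" "y \<le> 1" for x y
      by (rule acf_lipschitz[OF L1(3) h(2) that])
    show "(\<lambda>n. (LBINT y. indicator {1 - s n..<1} y * \<bar>?F y * ?V y\<bar>) / s n) \<longlonglongrightarrow> 0"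
      using right(2)
    proof
      assume "vanishes_at g (at_left 1)"
      then show ?thesis by (intro slab_tendsto_vanishing[OF V(1) Fm Fc(2) s] vanishes_at_left_small)
    next
      assume F1: "?F 1 = 0"
      have "\<bar>?F y\<bar> \<le> M * (1 - y)" if "y \<in> {0<..<1}" for y
        using acf_lipschitz[OF L1(3) h(2), of y 1 cF] that F1 by simp
      then show ?thesis by (rule slab_tendsto_linear[OF V(1) Fm Fc(2) _ M s])
    qed
  qed
  \<comment> \<open>Under the reflection the endpoint -1 has become 1, the slab sees u near -1, and
    the chain rule turns the derivative q into \<open>- ?q (- y)\<close>.\<close>
  moreover have "(\<lambda>n. (LBINT y. ((if y + s n < 1 then ?H (y + s n) else 0) - ?H y) * ?U y) / s n)
    \<longlonglongrightarrow> (LBINT y. - ?q (- y) * ?U y)"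
  proof (rule difference_quotient_tendsto[OF U Hc _ _ _ s])
    show "(?H has_real_derivative - ?q (- y)) (at y)" if "y \<in> {-1<..<1}" for y
    proof -
      have "(acf cH ?q has_real_derivative ?q (- y)) (at (- y))"
        using that by (intro acf_has_derivative[OF q] continuous_at_imp_continuous_on ballI isCont_acf L1) auto
      then have "((\<lambda>y. acf cH ?q (- y)) has_real_derivative ?q (- y) * (-1)) (at y)"
        by (rule DERIV_chain2) (auto intro!: derivative_eq_intros)
      then show ?thesis by simp
    qed
    show "(\<lambda>y. - ?q (- y)) \<in> borel_measurable borel"
      using borel_measurable_acf[OF L1(5), of c0] by measurable
    let ?C = "\<bar>c0\<bar> + (LBINT y. \<bar>cut p y\<bar>)"
    show "\<bar>?H y - ?H x\<bar> \<le> ?C * (y - x)" if "-1 \<le> x" "x \<le> y" "y \<le> 1" for x y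
      using acf_lipschitz[OF q acf_bound[OF L1(5)], of "- y" "- x" cH] that by (simp add: abs_minus_commute)
    show "(\<lambda>n. (LBINT y. indicator {1 - s n..<1} y * \<bar>?H y * ?U y\<bar>) / s n) \<longlonglongrightarrow> 0"
      by (intro slab_tendsto_vanishing[OF U(1) Hm Hc(2) s] vanishes_at_right_small u)
  qed
  moreover have "(LBINT y. ((if y + s n < 1 then ?H (y + s n) else 0) - ?H y) * ?U y) =
      (LBINT y. ((if y + s n < 1 then ?F (y + s n) else 0) - ?F y) * ?V y)" for n
  proof -
    have split: "(LBINT y. ((if y + s n < 1 then G (y + s n) else 0) - G y) * W y) =
        (LBINT y. (if y + s n < 1 then G (y + s n) else 0) * W y) - (LBINT y. G y * W y)"
      if W: "integrable lborel W" and G: "G \<in> borel_measurable borel" "\<And>y. \<bar>G y\<bar> \<le> C" for G W :: "real \<Rightarrow> real" and C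
    proof -
      note G(1)[measurable]
      have "C \<ge> 0" using G(2)[of 0] by simp
      then have "integrable lborel (\<lambda>y. (if y + s n < 1 then G (y + s n) else 0) * W y)"
        using G(2) by (intro integrable_mult_bounded(2)[OF W, of _ C]) auto
      moreover have "integrable lborel (\<lambda>y. G y * W y)" by (rule integrable_mult_bounded(2)[OF W G])
      ultimately show ?thesis by (simp add: left_diff_distrib)
    qed
    show ?thesis
      unfolding split[OF U(1) Hm Hc(2)] split[OF V(1) Fm Fc(2)] using eq[of n] pair by simp
  qed
  ultimately have "(LBINT y. cut h y * ?V y) = (LBINT y. - ?q (- y) * ?U y)"
    using LIMSEQ_unique by auto
  also have "\<dots> = - (LBINT y. ?q y * cut u y)"
    using lborel_integral_reflect[of "\<lambda>y. ?q y * cut u y"] by simp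
  also have "\<dots> = (LBINT x. acf cf u x * cut p x)"
    using acf_by_parts[OF L1(2,5), of c0 cf] left right(1) by simp
  also have "\<dots> = (LBINT x:{-1..1}. f x * p x)"
    by (rule integral_eq_acf[OF L1(1,5,2) f, symmetric])
  also have "(LBINT y. cut h y * ?V y) = (LBINT x:{-1..1}. h x * g x)"
    unfolding set_lebesgue_integral_mult
    by (intro Bochner_Integration.integral_cong) (auto simp: cut_def indicator_def)
  finally show ?thesis .
qed

section \<open>Integrability of the kernel\<close>

locale levy =
  fixes \<phi> :: "real measure"
  assumes sets_phi: "sets \<phi> = sets (restrict_space borel {0<..})"
    and int_phi: "(\<integral>\<^sup>+ z. ennreal (min (z\<^sup>2) z) \<partial>\<phi>) < \<infinity>"
begin

lemma space_phi: "space \<phi> = {0<..}"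
  using sets_eq_imp_space_eq[OF sets_phi] by (simp add: space_restrict_space)

lemma tail_in_sets: "y \<ge> 0 \<Longrightarrow> {y<..} \<in> sets \<phi>"
proof -
  assume "y \<ge> 0"
  then have "{y<..} = {0<..} \<inter> {y<..}" by auto
  moreover have "{0<..} \<inter> {y<..} \<in> sets (restrict_space borel {0<..})"
    unfolding sets_restrict_space by (rule imageI) simp
  ultimately show ?thesis unfolding sets_phi by (simp only:)
qed

lemma borel_imp_measurable_phi: "f \<in> borel_measurable borel \<Longrightarrow> f \<in> borel_measurable \<phi>"
  unfolding measurable_cong_sets[OF sets_phi refl] by (rule measurable_restrict_space1)

text \<open>Markov's inequality: for z > y the integrand min (z^2) z is at least min (y^2) y, which
  is positive.\<close>

lemma tail_finite:
  assumes "y > 0"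
  shows "emeasure \<phi> {y<..} < \<infinity>"
proof -
  define c where "c = min (y\<^sup>2) y"
  have c: "c > 0" using assms by (simp add: c_def)
  have "c \<le> min (z\<^sup>2) z" if "z > y" for z
  proof -
    have "y\<^sup>2 \<le> z\<^sup>2" using that assms by (intro power_mono) auto
    then show ?thesis using that unfolding c_def by linarith
  qed
  then have "(\<integral>\<^sup>+ z. ennreal c * indicator {y<..} z \<partial>\<phi>) \<le> (\<integral>\<^sup>+ z. ennreal (min (z\<^sup>2) z) \<partial>\<phi>)"
    by (intro nn_integral_mono) (auto simp: indicator_def intro!: ennreal_leI)
  then have "ennreal c * emeasure \<phi> {y<..} < \<infinity>"
    using int_phi tail_in_sets[of y] assms by (simp add: nn_integral_cmult_indicator)
  then show ?thesis using c by (auto simp: ennreal_mult_less_top ennreal_mult_eq_top_iff less_top)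
qed

text \<open>The mass of \<phi> may be infinite near 0, but the rays starting at 1 / (n + 1) have
  finite mass and exhaust the space. Tonelli with respect to \<phi> relies on this.\<close>

lemma sigma_finite_phi: "sigma_finite_measure \<phi>"
proof
  let ?A = "range (\<lambda>n. {inverse (real (Suc n))<..})"
  have "\<Union> ?A = {0<..}"
  proof safe
    fix x n assume "inverse (real (Suc n)) < (x :: real)"
    then show "0 < x" by (meson inverse_positive_iff_positive less_trans of_nat_0_less_iff zero_less_Suc)
  next
    fix x :: real assume "0 < x"
    then show "x \<in> \<Union> ?A" using reals_Archimedean[of x] by auto
  qed
  then show "\<exists>A. countable A \<and> A \<subseteq> sets \<phi> \<and> \<Union> A = space \<phi> \<and> (\<forall>a\<in>A. emeasure \<phi> a \<noteq> \<infinity>)"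
  proof (intro exI[of _ ?A] conjI ballI)
    show "?A \<subseteq> sets \<phi>" by (auto intro!: tail_in_sets)
    fix a assume "a \<in> ?A"
    then obtain n where "a = {inverse (real (Suc n))<..}" by blast
    then show "emeasure \<phi> a \<noteq> \<infinity>" using tail_finite[of "inverse (real (Suc n))"] by (simp add: less_top)
  qed (simp_all add: space_phi)
qed

text \<open>Written as an integral with parameter y so that measurability in y is immediate on all
  of the line. For negative y the ray is not a set of the sigma-algebra of \<phi>, so
  \<open>emeasure\<close> would give its default value there.\<close>

definition tail :: "real \<Rightarrow> ennreal" where
  "tail y = (\<integral>\<^sup>+ z. (if y < z then 1 else 0) \<partial>\<phi>)"

lemma borel_measurable_tail [measurable]: "tail \<in> borel_measurable borel"
proof -
  interpret phi: sigma_finite_measure \<phi> by (rule sigma_finite_phi)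
  have [measurable]: "(\<lambda>z. z) \<in> borel_measurable \<phi>" by (rule borel_imp_measurable_phi) simp
  have "(\<lambda>y. \<integral>\<^sup>+ z. (if y < z then 1 else 0) \<partial>\<phi>) \<in> borel_measurable borel" by measurable
  then show ?thesis by (simp only: tail_def[abs_def])
qed

lemma tail_eq: "y > 0 \<Longrightarrow> emeasure \<phi> {y<..} = tail y"
proof -
  assume "y > 0"
  then have "{y<..} \<in> sets \<phi>" by (intro tail_in_sets) simp
  then have "emeasure \<phi> {y<..} = (\<integral>\<^sup>+ z. indicator {y<..} z \<partial>\<phi>)"
    by (rule nn_integral_indicator[symmetric])
  also have "\<dots> = tail y" unfolding tail_def by (intro nn_integral_cong) (auto simp: indicator_def)
  finally show ?thesis .
qed

lemma Phi_eq: "Phi \<phi> x = (if x > 0 then (LBINT y. (if x < y then enn2real (tail y) else 0)) else 0)"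
proof (cases "x > 0")
  case True
  have "(LBINT y:{x<..}. measure \<phi> {y<..}) = (LBINT y. (if x < y then enn2real (tail y) else 0))"
    unfolding set_lebesgue_integral_mult
  proof (intro Bochner_Integration.integral_cong refl)
    fix y
    show "indicator {x<..} y * measure \<phi> {y<..} = (if x < y then enn2real (tail y) else 0)"
      using True tail_eq[of y] by (simp add: indicator_def measure_def)
  qed
  then show ?thesis using True by (simp add: Phi_def)
qed (simp add: Phi_def)

lemma borel_measurable_Phi: "Phi \<phi> \<in> borel_measurable borel"
proof -
  have "(\<lambda>x. LBINT y. (if x < y then enn2real (tail y) else 0)) \<in> borel_measurable borel"
    by (rule lborel.borel_measurable_lebesgue_integral) measurable
  then show ?thesis unfolding Phi_eq[abs_def] by measurable
qed

text \<open>An upper bound in \<open>ennreal\<close> also covers the default value 0 of a divergent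
  integral, so the estimate is made without deciding convergence.\<close>

lemma Phi_le:
  assumes "x > 0"
  shows "ennreal \<bar>Phi \<phi> x\<bar> \<le> (\<integral>\<^sup>+y. \<integral>\<^sup>+z. (if x < y \<and> y < z then 1 else 0) \<partial>\<phi> \<partial>lborel)"
proof -
  have eq: "Phi \<phi> x = (LBINT y. (if x < y then enn2real (tail y) else 0))"
    using assms by (simp only: Phi_eq if_True)
  have "ennreal (norm (Phi \<phi> x)) \<le> (\<integral>\<^sup>+y. ennreal (norm (if x < y then enn2real (tail y) else 0)) \<partial>lborel)"
  proof (cases "integrable lborel (\<lambda>y. if x < y then enn2real (tail y) else 0)")
    case True
    then show ?thesis unfolding eq by (rule integral_norm_bound_ennreal)
  next
    case False
    show ?thesis unfolding eq not_integrable_integral_eq[OF False] by simp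
  qed
  also have "\<dots> \<le> (\<integral>\<^sup>+y. \<integral>\<^sup>+z. (if x < y \<and> y < z then 1 else 0) \<partial>\<phi> \<partial>lborel)"
  proof (rule nn_integral_mono)
    fix y
    show "ennreal (norm (if x < y then enn2real (tail y) else 0)) \<le> (\<integral>\<^sup>+z. (if x < y \<and> y < z then 1 else 0) \<partial>\<phi>)"
    proof (cases "x < y")
      case True
      have "ennreal (enn2real (tail y)) \<le> tail y" by (cases "tail y" rule: ennreal_cases) auto
      then show ?thesis using True by (simp add: tail_def)
    qed simp
  qed
  finally show ?thesis by simp
qed

text \<open>By Tonelli the integral is at most the \<phi>-integral of the area of all (x, y) with 0
  < x <= 2 and x < y < z. That area is at most min 2 z * z, which is comparable to min (z^2) z. The
  bound 2 is the largest difference of two points of [-1,1].\<close>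

lemma integrable_Phi: "integrable lborel (\<lambda>x. indicator {..2} x * Phi \<phi> x)"
proof (rule integrableI_bounded)
  interpret phi: sigma_finite_measure \<phi> by (rule sigma_finite_phi)
  interpret pair: pair_sigma_finite lborel \<phi> ..
  have [measurable]: "(\<lambda>z. z) \<in> borel_measurable \<phi>" by (rule borel_imp_measurable_phi) simp
  show "(\<lambda>x. indicator {..2} x * Phi \<phi> x) \<in> borel_measurable lborel"
    by (intro borel_measurable_times borel_measurable_indicator) (use borel_measurable_Phi in auto)
  define q :: "real \<Rightarrow> real \<Rightarrow> real \<Rightarrow> ennreal"
    where "q = (\<lambda>x y z. if 0 < x \<and> x \<le> 2 \<and> x < y \<and> y < z then 1 else 0)"
  have "(\<integral>\<^sup>+x. ennreal (norm (indicator {..2} x * Phi \<phi> x)) \<partial>lborel) \<le> (\<integral>\<^sup>+x. \<integral>\<^sup>+y. \<integral>\<^sup>+z. q x y z \<partial>\<phi> \<partial>lborel \<partial>lborel)"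
  proof (rule nn_integral_mono)
    fix x
    show "ennreal (norm (indicator {..2} x * Phi \<phi> x)) \<le> (\<integral>\<^sup>+y. \<integral>\<^sup>+z. q x y z \<partial>\<phi> \<partial>lborel)"
    proof (cases "0 < x \<and> x \<le> 2")
      case True
      then show ?thesis using Phi_le[of x] by (simp add: q_def)
    next
      case False
      then show ?thesis by (auto simp: Phi_def indicator_def)
    qed
  qed
  also have "\<dots> = (\<integral>\<^sup>+x. \<integral>\<^sup>+z. \<integral>\<^sup>+y. q x y z \<partial>lborel \<partial>\<phi> \<partial>lborel)"
  proof (intro nn_integral_cong)
    fix x
    have "(\<lambda>(y, z). q x y z) \<in> borel_measurable (lborel \<Otimes>\<^sub>M \<phi>)" unfolding q_def by measurable
    then show "(\<integral>\<^sup>+y. \<integral>\<^sup>+z. q x y z \<partial>\<phi> \<partial>lborel) = (\<integral>\<^sup>+z. \<integral>\<^sup>+y. q x y z \<partial>lborel \<partial>\<phi>)"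
      using pair.Fubini'[of "\<lambda>y z. q x y z"] by simp
  qed
  also have "\<dots> = (\<integral>\<^sup>+z. \<integral>\<^sup>+x. \<integral>\<^sup>+y. q x y z \<partial>lborel \<partial>lborel \<partial>\<phi>)"
  proof -
    have "(\<lambda>(x, z). \<integral>\<^sup>+y. q x y z \<partial>lborel) \<in> borel_measurable (lborel \<Otimes>\<^sub>M \<phi>)" unfolding q_def by measurable
    then show ?thesis using pair.Fubini'[of "\<lambda>x z. \<integral>\<^sup>+y. q x y z \<partial>lborel"] by simp
  qed
  also have "\<dots> \<le> (\<integral>\<^sup>+z. ennreal 2 * ennreal (min (z\<^sup>2) z) \<partial>\<phi>)"
  proof (rule nn_integral_mono)
    fix z assume "z \<in> space \<phi>"
    then have z: "z > 0" by (simp add: space_phi)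
    \<comment> \<open>The region is enlarged to a rectangle with sides min 2 z and z, so that the
      double integral factors.\<close>
    have "(\<integral>\<^sup>+x. \<integral>\<^sup>+y. q x y z \<partial>lborel \<partial>lborel) \<le> (\<integral>\<^sup>+x. \<integral>\<^sup>+y. indicator {0<..min 2 z} x * indicator {0<..<z} y \<partial>lborel \<partial>lborel)"
      by (intro nn_integral_mono) (auto simp: q_def indicator_def)
    also have "\<dots> = ennreal (min 2 z) * ennreal z"
      using z by (simp add: nn_integral_cmult nn_integral_multc)
    also have "\<dots> \<le> ennreal 2 * ennreal (min (z\<^sup>2) z)"
    proof -
      have "min 2 z * z \<le> 2 * min (z\<^sup>2) z"
        using z by (auto simp: min_def power2_eq_square)
      then show ?thesis using z by (simp add: ennreal_mult[symmetric] ennreal_leI del: ennreal_numeral)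
    qed
    finally show "(\<integral>\<^sup>+x. \<integral>\<^sup>+y. q x y z \<partial>lborel \<partial>lborel) \<le> ennreal 2 * ennreal (min (z\<^sup>2) z)" .
  qed
  also have "\<dots> = ennreal 2 * (\<integral>\<^sup>+z. ennreal (min (z\<^sup>2) z) \<partial>\<phi>)"
    by (rule nn_integral_cmult) measurable
  also have "\<dots> < \<infinity>" using int_phi by (simp add: ennreal_mult_less_top del: ennreal_numeral)
  finally show "(\<integral>\<^sup>+x. ennreal (norm (indicator {..2} x * Phi \<phi> x)) \<partial>lborel) < \<infinity>" .
qed

lemma Phi_nonpos: "\<forall>x\<le>0. Phi \<phi> x = 0"
  by (simp add: Phi_def)

end

section \<open>Completeness of the two function spaces\<close>

lemma L1_norm_eq: "L1_norm f = (LBINT x. \<bar>cut f x\<bar>)"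
  unfolding L1_norm_def set_lebesgue_integral_mult
  by (intro Bochner_Integration.integral_cong) (auto simp: cut_def indicator_def)

lemma L1_iff: "f \<in> L1 \<longleftrightarrow> integrable lborel (cut f)"
  by (simp add: L1_def set_integrable_mult cut_def[abs_def])

lemma cut_lincomb: "cut (\<lambda>x. a * f x + b * g x) = (\<lambda>x. a * cut f x + b * cut g x)"
  by (simp add: cut_def fun_eq_iff algebra_simps)

lemma L1_lincomb: "f \<in> L1 \<Longrightarrow> g \<in> L1 \<Longrightarrow> (\<lambda>x. a * f x + b * g x) \<in> L1"
  by (simp add: L1_iff cut_lincomb)

lemma L1_norm_lincomb:
  assumes "f \<in> L1" "g \<in> L1"
  shows "L1_norm (\<lambda>x. a * f x + b * g x) \<le> \<bar>a\<bar> * L1_norm f + \<bar>b\<bar> * L1_norm g"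
proof -
  have "(LBINT x. \<bar>a * cut f x + b * cut g x\<bar>) \<le> (LBINT x. \<bar>a\<bar> * \<bar>cut f x\<bar> + \<bar>b\<bar> * \<bar>cut g x\<bar>)"
    using assms by (intro integral_mono) (auto simp: L1_iff abs_mult[symmetric])
  also have "\<dots> = \<bar>a\<bar> * (LBINT x. \<bar>cut f x\<bar>) + \<bar>b\<bar> * (LBINT x. \<bar>cut g x\<bar>)"
    using assms by (simp add: L1_iff)
  finally show ?thesis by (simp add: L1_norm_eq cut_lincomb)
qed

lemma L1_norm_diff_triangle:
  assumes "f \<in> L1" "g \<in> L1" "h \<in> L1"
  shows "L1_norm (\<lambda>x. f x - h x) \<le> L1_norm (\<lambda>x. f x - g x) + L1_norm (\<lambda>x. g x - h x)"
  using L1_norm_lincomb[of "\<lambda>x. f x - g x" "\<lambda>x. g x - h x" 1 1] L1_lincomb[OF assms(1,2), of 1 "-1"] L1_lincomb[OF assms(2,3), of 1 "-1"]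
  by simp

text \<open>The Riesz-Fischer argument: along a subsequence the increments are summable in norm, so
  their series converges absolutely almost everywhere, and in norm by dominated convergence.\<close>

lemma L1_complete:
  assumes s: "\<And>n. s n \<in> L1" and cauchy: "\<And>e. e > 0 \<Longrightarrow> \<exists>M. \<forall>m\<ge>M. \<forall>n\<ge>M. L1_norm (\<lambda>x. s m x - s n x) < e"
  shows "\<exists>g\<in>L1. (\<lambda>n. L1_norm (\<lambda>x. s n x - g x)) \<longlonglongrightarrow> 0"
proof -
  have "\<exists>R. \<forall>k. \<forall>m\<ge>R k. \<forall>n\<ge>R k. L1_norm (\<lambda>x. s m x - s n x) < (1 / 2) ^ k"
    using cauchy by (intro choice allI) auto
  then obtain R where R: "\<And>k m n. m \<ge> R k \<Longrightarrow> n \<ge> R k \<Longrightarrow> L1_norm (\<lambda>x. s m x - s n x) < (1 / 2) ^ k"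
    by blast
  \<comment> \<open>Summing all earlier thresholds makes both r k and r (k + 1) at least R k; the
    added k forces r k to infinity.\<close>
  define r where "r = (\<lambda>k. (\<Sum>i\<le>k. R i) + k)"
  have r: "r k \<ge> R k" "r (Suc k) \<ge> R k" "r k \<ge> k" for k
  proof -
    show "r k \<ge> R k" unfolding r_def by (intro trans_le_add1 member_le_sum) auto
    then show "r (Suc k) \<ge> R k" by (simp add: r_def)
  qed (simp add: r_def)
  define a where "a = (\<lambda>k. cut (\<lambda>x. s (r (Suc k)) x - s (r k) x))"
  have a: "integrable lborel (a k)" for k
    using L1_lincomb[OF s s, of 1 "r (Suc k)" "-1" "r k"] by (simp add: a_def L1_iff)
  have [measurable]: "a k \<in> borel_measurable borel" for k using a[of k] by auto
  have a_le: "(LBINT x. \<bar>a k x\<bar>) \<le> (1 / 2) ^ k" for k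
    using R[OF r(2) r(1), of k] by (simp add: a_def L1_norm_eq)
  have sum_a: "summable (\<lambda>k. LBINT x. \<bar>a k x\<bar>)"
    by (rule summable_comparison_test[OF _ summable_geometric[of "1 / 2 :: real"]]) (use a_le in auto)
  have "(\<integral>\<^sup>+x. (\<Sum>k. ennreal \<bar>a k x\<bar>) \<partial>lborel) = (\<Sum>k. \<integral>\<^sup>+x. ennreal \<bar>a k x\<bar> \<partial>lborel)"
    by (rule nn_integral_suminf) simp
  also have "\<dots> = (\<Sum>k. ennreal (LBINT x. \<bar>a k x\<bar>))"
    using a by (simp add: nn_integral_eq_integral)
  also have "\<dots> = ennreal (\<Sum>k. LBINT x. \<bar>a k x\<bar>)"
    by (rule suminf_ennreal2[OF _ sum_a]) simp
  finally have "(\<integral>\<^sup>+x. (\<Sum>k. ennreal \<bar>a k x\<bar>) \<partial>lborel) \<noteq> \<infinity>" by simp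
  then have "AE x in lborel. (\<Sum>k. ennreal \<bar>a k x\<bar>) \<noteq> \<infinity>"
    by (intro nn_integral_PInf_AE) simp_all
  then have ae: "AE x in lborel. summable (\<lambda>k. \<bar>a k x\<bar>)"
    by eventually_elim (rule summable_suminf_not_top; simp)
  \<comment> \<open>The sum of the absolute increments bounds all partial sums and the limit, so 2 w
    dominates their differences.\<close>
  define w where "w = (\<lambda>x. \<Sum>k. \<bar>a k x\<bar>)"
  define G where "G = (\<lambda>x. \<Sum>k. a k x)"
  have w: "integrable lborel w"
    unfolding w_def using integrable_suminf[of lborel "\<lambda>k x. \<bar>a k x\<bar>"] a ae sum_a by simp
  have G: "integrable lborel G"
    unfolding G_def using integrable_suminf[of lborel a] a ae sum_a by simp
  define S where "S = (\<lambda>n x. \<Sum>k<n. a k x)"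
  have "(\<lambda>n. LBINT x. \<bar>S n x - G x\<bar>) \<longlonglongrightarrow> (LBINT (x::real). 0)"
  proof (rule integral_dominated_convergence[where w = "\<lambda>x. 2 * w x"])
    have [measurable]: "G \<in> borel_measurable borel" using G by auto
    show "(\<lambda>x. \<bar>S n x - G x\<bar>) \<in> borel_measurable lborel" for n by (simp add: S_def)
    show "AE x in lborel. (\<lambda>n. \<bar>S n x - G x\<bar>) \<longlonglongrightarrow> 0"
      using ae
    proof eventually_elim
      case (elim x)
      have "(\<lambda>n. S n x) \<longlonglongrightarrow> G x"
        unfolding S_def G_def by (rule summable_LIMSEQ[OF summable_rabs_cancel[OF elim]])
      then have "(\<lambda>n. \<bar>S n x - G x\<bar>) \<longlonglongrightarrow> \<bar>G x - G x\<bar>" by (intro tendsto_intros)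
      then show ?case by simp
    qed
    show "AE x in lborel. norm \<bar>S n x - G x\<bar> \<le> 2 * w x" for n
      using ae
    proof eventually_elim
      case (elim x)
      have "\<bar>S n x\<bar> \<le> (\<Sum>k<n. \<bar>a k x\<bar>)" unfolding S_def by (rule sum_abs)
      also have "\<dots> \<le> w x" unfolding w_def by (rule sum_le_suminf[OF elim]) auto
      finally have "\<bar>S n x\<bar> \<le> w x" .
      moreover have "\<bar>G x\<bar> \<le> w x" unfolding G_def w_def by (rule summable_rabs[OF elim])
      ultimately show ?case by simp
    qed
  qed (use w in auto)
  then have lim: "(\<lambda>n. LBINT x. \<bar>S n x - G x\<bar>) \<longlonglongrightarrow> 0" by simp
  define g where "g = (\<lambda>x. s (r 0) x + G x)"
  have "integrable lborel (\<lambda>x. indicator {-1..1} x * G x)"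
    using integrable_imp_set_integrable[OF G, of "{-1..1}"] by (simp add: set_integrable_mult)
  moreover have "cut g = (\<lambda>x. cut (s (r 0)) x + indicator {-1..1} x * G x)"
    by (simp add: g_def cut_def fun_eq_iff distrib_left)
  ultimately have g: "g \<in> L1" using s[of "r 0"] by (simp add: L1_iff)
  have S_eq: "S n x = cut (s (r n)) x - cut (s (r 0)) x" for n x
    unfolding S_def a_def
    by (induction n) (auto simp: cut_def algebra_simps)
  have close: "L1_norm (\<lambda>x. s (r n) x - g x) \<le> (LBINT x. \<bar>S n x - G x\<bar>)" for n
    unfolding L1_norm_eq
  proof (rule integral_mono)
    show "integrable lborel (\<lambda>x. \<bar>cut (\<lambda>x. s (r n) x - g x) x\<bar>)"
      using L1_lincomb[OF s g, of 1 "r n" "-1"] by (simp add: L1_iff)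
    show "integrable lborel (\<lambda>x. \<bar>S n x - G x\<bar>)" using G a by (simp add: S_def)
    show "\<bar>cut (\<lambda>x. s (r n) x - g x) x\<bar> \<le> \<bar>S n x - G x\<bar>" for x
      unfolding S_eq by (auto simp: cut_def g_def indicator_def)
  qed
  have "(\<lambda>n. L1_norm (\<lambda>x. s n x - g x)) \<longlonglongrightarrow> 0"
  proof (rule tendsto_sandwich[OF _ _ tendsto_const])
    \<comment> \<open>The bound \<open>?l\<close> passes from the whole sequence to the subsequence
      by the Cauchy property and from there to the limit by \<open>lim\<close>.\<close>
    have "(\<lambda>n. (1 / 2) ^ n) \<longlonglongrightarrow> (0::real)" by (rule LIMSEQ_realpow_zero) auto
    then show "(\<lambda>n. L1_norm (\<lambda>x. s n x - s (r n) x) + (LBINT x. \<bar>S n x - G x\<bar>)) \<longlonglongrightarrow> 0" (is "?l \<longlonglongrightarrow> 0")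
    proof -
      have "(\<lambda>n. L1_norm (\<lambda>x. s n x - s (r n) x)) \<longlonglongrightarrow> 0"
      proof (rule tendstoI)
        fix e :: real assume "e > 0"
        then obtain M where M: "\<forall>m\<ge>M. \<forall>n\<ge>M. L1_norm (\<lambda>x. s m x - s n x) < e" using cauchy by blast
        have "dist (L1_norm (\<lambda>x. s n x - s (r n) x)) 0 < e" if "n \<ge> M" for n
        proof -
          have "r n \<ge> M" using r(3)[of n] that by linarith
          then have "L1_norm (\<lambda>x. s n x - s (r n) x) < e" using M that by blast
          moreover have "0 \<le> L1_norm (\<lambda>x. s n x - s (r n) x)" unfolding L1_norm_eq by simp
          ultimately show ?thesis by simp
        qed
        then show "\<forall>\<^sub>F n in sequentially. dist (L1_norm (\<lambda>x. s n x - s (r n) x)) 0 < e"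
          unfolding eventually_sequentially by blast
      qed
      from tendsto_add[OF this lim] show ?thesis by simp
    qed
    show "\<forall>\<^sub>F n in sequentially. L1_norm (\<lambda>x. s n x - g x) \<le> ?l n"
      using L1_norm_diff_triangle[OF s s g] close by (intro always_eventually allI) (meson add_left_mono order_trans)
    show "\<forall>\<^sub>F n in sequentially. 0 \<le> L1_norm (\<lambda>x. s n x - g x)" by (simp add: L1_norm_eq)
  qed
  then show ?thesis using g by blast
qed

lemma function_space_L1: "function_space L1 L1_norm"
proof
  show "(\<lambda>x. 0) \<in> L1" by (simp add: L1_def set_integrable_mult)
  show "0 \<le> L1_norm f" for f by (simp add: L1_norm_eq)
  show "(\<lambda>x. a * f x + b * g x) \<in> L1" if "f \<in> L1" "g \<in> L1" for f g a b
    using that by (rule L1_lincomb)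
  show "L1_norm (\<lambda>x. a * f x + b * g x) \<le> \<bar>a\<bar> * L1_norm f + \<bar>b\<bar> * L1_norm g"
    if "f \<in> L1" "g \<in> L1" for f g a b
    using that by (rule L1_norm_lincomb)
  show "\<exists>g\<in>L1. (\<lambda>n. L1_norm (\<lambda>x. s n x - g x)) \<longlonglongrightarrow> 0"
    if "\<And>n. s n \<in> L1" "\<And>e. e > 0 \<Longrightarrow> \<exists>M. \<forall>m\<ge>M. \<forall>n\<ge>M. L1_norm (\<lambda>x. s m x - s n x) < e" for s
    using that by (rule L1_complete)
qed

section \<open>The space of continuous functions vanishing at the excluded endpoints\<close>

lemma Omega_openin: "openin (top_of_set {-1..1}) (Omega l r)"
proof -
  have "Omega l r = {-1..1} \<inter> - ((if l = LD then {-1} else {}) \<union> (if r = RD then {1} else {}))"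
    by (auto simp: Omega_def)
  moreover have "open (- ((if l = LD then {-1} else {}) \<union> (if r = RD then {1::real} else {})))"
    by (intro open_Compl closed_Un) auto
  ultimately show ?thesis by (metis openin_open)
qed

lemma Omega_subset: "Omega l r \<subseteq> {-1..1}" "{-1<..<1} \<subseteq> Omega l r"
  by (auto simp: Omega_def)

text \<open>Continuity is assumed only on \<Omega>. Together with the complement of the support,
  where g is 0, \<Omega> forms a cover of [-1,1] by relatively open sets, so g is continuous up to
  the excluded endpoints as well.\<close>

lemma Cc_continuous_on:
  assumes "g \<in> Cc (Omega l r)"
  shows "continuous_on {-1..1} g"
proof -
  obtain K where K: "continuous_on (Omega l r) g" "compact K" "K \<subseteq> Omega l r" "\<forall>x. x \<notin> K \<longrightarrow> g x = 0"
    using assms by (auto simp: Cc_def)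
  have un: "Omega l r \<union> ({-1..1} - K) = {-1..1}" using K(3) Omega_subset(1)[of l r] by auto
  have "continuous_on ({-1..1} - K) g"
    using K(4) by (intro continuous_on_cong[THEN iffD2, OF refl _ continuous_on_const[of _ 0]]) auto
  moreover have "openin (top_of_set {-1..1}) ({-1..1} - K)"
    using compact_imp_closed[OF K(2)] by (metis Diff_eq open_Compl openin_open)
  ultimately have "continuous_on (Omega l r \<union> ({-1..1} - K)) g"
    using K(1) Omega_openin[of l r] by (intro continuous_on_Un_local_open) (simp_all only: un)
  then show ?thesis by (simp add: un)
qed

lemma C0_continuous_on:
  assumes f: "f \<in> C0 (Omega l r)"
  shows "continuous_on {-1..1} f"
proof -
  have "\<exists>g. g \<in> Cc (Omega l r) \<and> (\<forall>x. \<bar>f x - g x\<bar> < e)" if "e > 0" for e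
    using f that by (auto simp: C0_def)
  then have "\<exists>g. \<forall>n. g n \<in> Cc (Omega l r) \<and> (\<forall>x. \<bar>f x - g n x\<bar> < inverse (real (Suc n)))"
    by (intro choice allI) simp
  then obtain g where g: "\<And>n. g n \<in> Cc (Omega l r)" "\<And>n x. \<bar>f x - g n x\<bar> < inverse (real (Suc n))"
    by blast
  have "uniform_limit {-1..1} g f sequentially"
  proof (rule uniform_limitI)
    fix e :: real assume "e > 0"
    then obtain N where N: "inverse (real (Suc N)) < e" using reals_Archimedean by metis
    have "dist (g n x) (f x) < e" if "n \<ge> N" for n x
    proof -
      have "inverse (real (Suc n)) \<le> inverse (real (Suc N))" using that by (intro le_imp_inverse_le) auto
      then show ?thesis using N g(2)[of x n] unfolding dist_real_def abs_minus_commute[of "g n x"] by linarith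
    qed
    then show "\<forall>\<^sub>F n in sequentially. \<forall>x\<in>{-1..1}. dist (g n x) (f x) < e"
      unfolding eventually_sequentially by blast
  qed
  then show ?thesis
    by (rule uniform_limit_theorem[rotated]) (auto intro!: always_eventually Cc_continuous_on[OF g(1)])
qed

lemma C0_outside:
  assumes "f \<in> C0 (Omega l r)" "x \<notin> {-1..1}"
  shows "f x = 0"
proof -
  have "\<bar>f x\<bar> \<le> 0 + e" if "e > 0" for e
  proof -
    obtain g where g: "g \<in> Cc (Omega l r)" "\<bar>f x - g x\<bar> < e"
      using assms(1) \<open>e > 0\<close> by (auto simp: C0_def)
    have "g x = 0" using g(1) assms(2) Omega_subset(1)[of l r] unfolding Cc_def by blast
    then show ?thesis using g(2) by simp
  qed
  then have "\<bar>f x\<bar> \<le> 0" by (rule field_le_epsilon)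
  then show ?thesis by simp
qed

text \<open>The supremum is over [-1,1] only; it is finite because elements are continuous on that
  compact interval, and it bounds f everywhere because they vanish outside.\<close>

lemma C0_abs_le:
  assumes "f \<in> C0 (Omega l r)"
  shows "\<bar>f x\<bar> \<le> sup_norm f"
proof -
  have "compact ((\<lambda>x. \<bar>f x\<bar>) ` {-1..1})"
    by (intro compact_continuous_image continuous_on_rabs C0_continuous_on[OF assms]) auto
  then have bdd: "bdd_above ((\<lambda>x. \<bar>f x\<bar>) ` {-1..1})"
    by (intro bounded_imp_bdd_above compact_imp_bounded)
  have in_Icc: "\<bar>f x\<bar> \<le> sup_norm f" if "x \<in> {-1..1}" for x
    unfolding sup_norm_def using that by (intro cSUP_upper bdd)
  show ?thesis
    using in_Icc[of x] in_Icc[of 0] C0_outside[OF assms, of x] by (cases "x \<in> {-1..1}") auto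
qed

lemma sup_norm_le: "(\<And>x. \<bar>f x\<bar> \<le> c) \<Longrightarrow> sup_norm f \<le> c"
  unfolding sup_norm_def by (intro cSUP_least) auto

lemma Cc_lincomb:
  assumes "f \<in> Cc \<Omega>" "g \<in> Cc \<Omega>"
  shows "(\<lambda>x. a * f x + b * g x) \<in> Cc \<Omega>"
proof -
  obtain K K' where K: "compact K" "K \<subseteq> \<Omega>" "\<forall>x. x \<notin> K \<longrightarrow> f x = 0" "compact K'" "K' \<subseteq> \<Omega>" "\<forall>x. x \<notin> K' \<longrightarrow> g x = 0"
    and c: "continuous_on \<Omega> f" "continuous_on \<Omega> g"
    using assms unfolding Cc_def by blast
  have "compact (K \<union> K')" "K \<union> K' \<subseteq> \<Omega>" "\<forall>x. x \<notin> K \<union> K' \<longrightarrow> a * f x + b * g x = 0"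
    using K by auto
  moreover have "continuous_on \<Omega> (\<lambda>x. a * f x + b * g x)" by (intro continuous_intros c)
  ultimately show ?thesis unfolding Cc_def by blast
qed

lemma C0_lincomb:
  assumes "f \<in> C0 \<Omega>" "g \<in> C0 \<Omega>"
  shows "(\<lambda>x. a * f x + b * g x) \<in> C0 \<Omega>"
  unfolding C0_def
proof (intro CollectI allI impI)
  fix e :: real assume "e > 0"
  \<comment> \<open>The summand 1 covers a = b = 0 and makes the final estimate strict.\<close>
  define d where "d = e / (\<bar>a\<bar> + \<bar>b\<bar> + 1)"
  have d: "d > 0" using \<open>e > 0\<close> by (simp add: d_def add_nonneg_pos)
  obtain f' g' where fg: "f' \<in> Cc \<Omega>" "\<And>x. \<bar>f x - f' x\<bar> < d" "g' \<in> Cc \<Omega>" "\<And>x. \<bar>g x - g' x\<bar> < d"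
    using assms d unfolding C0_def by blast
  have "\<bar>(a * f x + b * g x) - (a * f' x + b * g' x)\<bar> < e" for x
  proof -
    have "(a * f x + b * g x) - (a * f' x + b * g' x) = a * (f x - f' x) + b * (g x - g' x)"
      by (simp add: algebra_simps)
    also have "\<bar>\<dots>\<bar> \<le> \<bar>a\<bar> * \<bar>f x - f' x\<bar> + \<bar>b\<bar> * \<bar>g x - g' x\<bar>"
      by (rule order_trans[OF abs_triangle_ineq]) (simp add: abs_mult)
    also have "\<dots> \<le> \<bar>a\<bar> * d + \<bar>b\<bar> * d"
      using fg(2)[of x] fg(4)[of x] by (intro add_mono mult_left_mono) auto
    also have "\<dots> < (\<bar>a\<bar> + \<bar>b\<bar> + 1) * d" using d by (simp add: algebra_simps)
    also have "\<dots> = e" by (simp add: d_def add_nonneg_pos less_imp_neq[symmetric])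
    finally show ?thesis .
  qed
  then show "\<exists>h\<in>Cc \<Omega>. \<forall>x. \<bar>(a * f x + b * g x) - h x\<bar> < e"
    by (intro bexI[OF _ Cc_lincomb[OF fg(1,3), of a b]] allI)
qed

lemma C0_zero: "(\<lambda>x. 0) \<in> C0 \<Omega>"
proof -
  have "(\<lambda>x. 0) \<in> Cc \<Omega>" unfolding Cc_def by (auto intro: exI[of _ "{}"])
  then show ?thesis unfolding C0_def by (intro CollectI allI impI bexI[of _ "\<lambda>x. 0"]) auto
qed

text \<open>\<open>C0_abs_le\<close> turns the Cauchy property in norm into a uniform one on the
  whole line, so the pointwise limit is uniform there, which is the sense of approximation in
  \<open>C0\<close>.\<close>

lemma C0_complete:
  assumes s: "\<And>n. s n \<in> C0 (Omega l r)"
    and cauchy: "\<And>e. e > 0 \<Longrightarrow> \<exists>M. \<forall>m\<ge>M. \<forall>n\<ge>M. sup_norm (\<lambda>x. s m x - s n x) < e"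
  shows "\<exists>g\<in>C0 (Omega l r). (\<lambda>n. sup_norm (\<lambda>x. s n x - g x)) \<longlonglongrightarrow> 0"
proof -
  have diff: "(\<lambda>x. f x - g x) \<in> C0 (Omega l r)" if "f \<in> C0 (Omega l r)" "g \<in> C0 (Omega l r)" for f g
    using C0_lincomb[OF that, of 1 "-1"] by simp
  have unif: "\<exists>M. \<forall>m\<ge>M. \<forall>n\<ge>M. \<forall>x. \<bar>s m x - s n x\<bar> < e" if e: "e > 0" for e
  proof -
    obtain M where M: "\<forall>m\<ge>M. \<forall>n\<ge>M. sup_norm (\<lambda>x. s m x - s n x) < e" using cauchy[OF e] by blast
    have "\<bar>s m x - s n x\<bar> < e" if "m \<ge> M" "n \<ge> M" for m n x
      using C0_abs_le[OF diff[OF s[of m] s[of n]], of x] M that by (meson le_less_trans)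
    then show ?thesis by blast
  qed
  have "Cauchy (\<lambda>n. s n x)" for x
  proof (rule metric_CauchyI)
    fix e :: real assume "e > 0"
    then show "\<exists>M. \<forall>m\<ge>M. \<forall>n\<ge>M. dist (s m x) (s n x) < e" using unif[of e] by (auto simp: dist_real_def)
  qed
  then have conv: "(\<lambda>n. s n x) \<longlonglongrightarrow> lim (\<lambda>n. s n x)" for x
    by (simp add: Cauchy_convergent convergent_LIMSEQ_iff[symmetric])
  define g where "g = (\<lambda>x. lim (\<lambda>n. s n x))"
  have close: "\<exists>M. \<forall>n\<ge>M. \<forall>x. \<bar>s n x - g x\<bar> \<le> e" if e: "e > 0" for e
  proof -
    obtain M where M: "\<forall>m\<ge>M. \<forall>n\<ge>M. \<forall>x. \<bar>s m x - s n x\<bar> < e" using unif[OF e] by blast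
    have "\<bar>s n x - g x\<bar> \<le> e" if n: "n \<ge> M" for n x
    proof (rule LIMSEQ_le_const2)
      show "(\<lambda>m. \<bar>s n x - s m x\<bar>) \<longlonglongrightarrow> \<bar>s n x - g x\<bar>" unfolding g_def by (intro tendsto_intros conv)
      have "\<bar>s n x - s m x\<bar> \<le> e" if "m \<ge> M" for m using M n that by (meson less_imp_le)
      then show "\<exists>N. \<forall>m\<ge>N. \<bar>s n x - s m x\<bar> \<le> e" by blast
    qed
    then show ?thesis by blast
  qed
  have g: "g \<in> C0 (Omega l r)"
    unfolding C0_def
  proof (intro CollectI allI impI)
    fix e :: real assume e: "e > 0"
    then obtain M where M: "\<forall>n\<ge>M. \<forall>x. \<bar>s n x - g x\<bar> \<le> e / 2" using close[of "e / 2"] by auto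
    obtain h where h: "h \<in> Cc (Omega l r)" "\<forall>x. \<bar>s M x - h x\<bar> < e / 2"
      using s[of M] e unfolding C0_def by (auto dest: spec[of _ "e / 2"])
    have "\<bar>g x - h x\<bar> < e" for x
      using spec[OF h(2), of x] M[rule_format, of M x] by linarith
    then show "\<exists>h\<in>Cc (Omega l r). \<forall>x. \<bar>g x - h x\<bar> < e" using h(1) by blast
  qed
  have "(\<lambda>n. sup_norm (\<lambda>x. s n x - g x)) \<longlonglongrightarrow> 0"
  proof (rule tendstoI)
    fix e :: real assume e: "e > 0"
    then obtain M where M: "\<forall>n\<ge>M. \<forall>x. \<bar>s n x - g x\<bar> \<le> e / 2" using close[of "e / 2"] by auto
    have "dist (sup_norm (\<lambda>x. s n x - g x)) 0 < e" if "n \<ge> M" for n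
    proof -
      have "sup_norm (\<lambda>x. s n x - g x) \<le> e / 2" using M that by (intro sup_norm_le) blast
      moreover have "0 \<le> sup_norm (\<lambda>x. s n x - g x)"
        using C0_abs_le[OF diff[OF s[of n] g], of 0] by (meson abs_ge_zero order_trans)
      ultimately show ?thesis using e by simp
    qed
    then show "\<forall>\<^sub>F n in sequentially. dist (sup_norm (\<lambda>x. s n x - g x)) 0 < e"
      unfolding eventually_sequentially by blast
  qed
  then show ?thesis using g by blast
qed

lemma function_space_C0: "function_space (C0 (Omega l r)) sup_norm"
proof
  show "(\<lambda>x. 0) \<in> C0 (Omega l r)" by (rule C0_zero)
  show "\<exists>g\<in>C0 (Omega l r). (\<lambda>n. sup_norm (\<lambda>x. s n x - g x)) \<longlonglongrightarrow> 0"
    if "\<And>n. s n \<in> C0 (Omega l r)" "\<And>e. e > 0 \<Longrightarrow> \<exists>M. \<forall>m\<ge>M. \<forall>n\<ge>M. sup_norm (\<lambda>x. s m x - s n x) < e" for s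
    using that by (rule C0_complete)
  fix f g a b assume fg: "f \<in> C0 (Omega l r)" "g \<in> C0 (Omega l r)"
  show "(\<lambda>x. a * f x + b * g x) \<in> C0 (Omega l r)" by (rule C0_lincomb[OF fg])
  show "sup_norm (\<lambda>x. a * f x + b * g x) \<le> \<bar>a\<bar> * sup_norm f + \<bar>b\<bar> * sup_norm g"
  proof (rule sup_norm_le)
    fix x
    have "\<bar>a * f x + b * g x\<bar> \<le> \<bar>a\<bar> * \<bar>f x\<bar> + \<bar>b\<bar> * \<bar>g x\<bar>"
      by (rule order_trans[OF abs_triangle_ineq]) (simp add: abs_mult)
    also have "\<dots> \<le> \<bar>a\<bar> * sup_norm f + \<bar>b\<bar> * sup_norm g"
      by (intro add_mono mult_left_mono C0_abs_le[OF fg(1)] C0_abs_le[OF fg(2)]) auto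
    finally show "\<bar>a * f x + b * g x\<bar> \<le> \<bar>a\<bar> * sup_norm f + \<bar>b\<bar> * sup_norm g" .
  qed
next
  fix f assume "f \<in> C0 (Omega l r)"
  then show "0 \<le> sup_norm f" using C0_abs_le[of f l r 0] by (meson abs_ge_zero order_trans)
qed

lemma C0_L1: "f \<in> C0 (Omega l r) \<Longrightarrow> f \<in> L1"
  using borel_integrable_compact[OF compact_Icc C0_continuous_on]
  by (simp add: L1_def set_integrable_def)

section \<open>Duality of the generators and of the semigroups\<close>

lemma W11_deriv_unique:
  assumes "W11_deriv f u" "W11_deriv f v"
  shows "u \<doteq> v"
  using assms weak_deriv_unique by (auto simp: W11_deriv_def)

text \<open>A boundary condition may pick another representative of f' than the operator does. The
  convolution does not see the difference, so the two images are equal as functions.\<close>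

lemma caputo'_unique:
  assumes "k \<in> borel_measurable borel" "W11_deriv f u" "caputo' k f F"
  shows "F = conv k u"
proof -
  obtain v where v: "W11_deriv f v" "F = conv k v" using assms(3) by (auto simp: caputo'_def)
  have "conv k v = conv k u"
    using v(1) assms(2) by (intro conv_cong_AE[OF assms(1)] W11_deriv_unique[OF v(1) assms(2)]) (auto simp: W11_deriv_def)
  then show ?thesis using v(2) by simp
qed

lemma loc_integrable_acf:
  assumes "h \<in> L1"
  shows "loc_integrable (acf c h)"
proof -
  have "continuous_on K (acf c h)" for K
    by (intro continuous_at_imp_continuous_on ballI isCont_acf[OF assms])
  then show ?thesis
    unfolding loc_integrable_def set_integrable_def using borel_integrable_compact[of _ "acf c h"] by blast
qed

section \<open>The pairing of continuous with integrable functions\<close>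

lemma C0_L1_integrable:
  assumes "f \<in> C0 (Omega l r)" "g \<in> L1"
  shows "integrable lborel (\<lambda>x. cut f x * cut g x)"
proof (rule integrable_mult_bounded(2)[OF cut_integrable[OF assms(2)]])
  show "cut f \<in> borel_measurable borel" using cut_integrable[OF C0_L1[OF assms(1)]] by auto
  show "\<bar>cut f x\<bar> \<le> sup_norm f" for x
    using C0_abs_le[OF assms(1), of x] C0_abs_le[OF assms(1), of 0] by (auto simp: cut_def indicator_def)
qed

lemma integral_cut: "(LBINT x:{-1..1}. f x * g x) = (LBINT x. cut f x * cut g x)"
  unfolding set_lebesgue_integral_mult
  by (intro Bochner_Integration.integral_cong) (auto simp: cut_def indicator_def)

lemma pairing_bound:
  assumes "f \<in> C0 (Omega l r)" "g \<in> L1"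
  shows "\<bar>LBINT x:{-1..1}. f x * g x\<bar> \<le> sup_norm f * L1_norm g"
proof -
  have "\<bar>LBINT x. cut f x * cut g x\<bar> \<le> (LBINT x. \<bar>cut f x * cut g x\<bar>)"
    by (rule integral_abs_bound)
  also have "\<dots> \<le> (LBINT x. sup_norm f * \<bar>cut g x\<bar>)"
  proof (rule integral_mono)
    show "integrable lborel (\<lambda>x. \<bar>cut f x * cut g x\<bar>)" using C0_L1_integrable[OF assms] by simp
    show "integrable lborel (\<lambda>x. sup_norm f * \<bar>cut g x\<bar>)" using cut_integrable[OF assms(2)] by simp
    show "\<bar>cut f x * cut g x\<bar> \<le> sup_norm f * \<bar>cut g x\<bar>" for x
      using C0_abs_le[OF assms(1), of x] by (auto simp: cut_def indicator_def abs_mult intro: mult_right_mono)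
  qed
  also have "\<dots> = sup_norm f * L1_norm g" by (simp add: L1_norm_eq)
  finally show ?thesis by (simp add: integral_cut)
qed

lemma pairing_left:
  assumes "f \<in> C0 (Omega l r)" "f' \<in> C0 (Omega l r)" "g \<in> L1"
  shows "(LBINT x:{-1..1}. (a * f x + b * f' x) * g x) = a * (LBINT x:{-1..1}. f x * g x) + b * (LBINT x:{-1..1}. f' x * g x)"
  using C0_L1_integrable[OF assms(1,3)] C0_L1_integrable[OF assms(2,3)]
  unfolding integral_cut integral_cut[of "\<lambda>x. a * f x + b * f' x"] cut_lincomb by (simp add: distrib_right mult.assoc)

lemma pairing_right:
  assumes "f \<in> C0 (Omega l r)" "g \<in> L1" "g' \<in> L1"
  shows "(LBINT x:{-1..1}. f x * (a * g x + b * g' x)) = a * (LBINT x:{-1..1}. f x * g x) + b * (LBINT x:{-1..1}. f x * g' x)"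
  using C0_L1_integrable[OF assms(1,2)] C0_L1_integrable[OF assms(1,3)]
  unfolding integral_cut integral_cut[of _ "\<lambda>x. a * g x + b * g' x"] cut_lincomb
  by (simp add: distrib_left mult.left_commute)

section \<open>Representatives for domain elements and duality of the generators\<close>

context levy
begin

text \<open>All conditions are transferred to one choice of representatives, where they become
  endpoint values. Only the N* condition remains a \<open>vanishes_at\<close> statement, because u =
  f' is merely in L^1.\<close>

lemma G_minus_representation:
  assumes "(f, h) \<in> G_minus \<phi> l r"
  obtains u cf cF where "u \<in> L1" "f \<doteq> acf cf u"
    "conv (Phi_minus \<phi>) u \<doteq> acf cF h"
    "l = LD \<longrightarrow> acf cf u (-1) = 0" "l = LN \<longrightarrow> acf cF h (-1) = 0"
    "l = LNstar \<longrightarrow> vanishes_at u (at_right (-1))"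
    "r = RD \<longrightarrow> acf cf u 1 = 0" "r = RN \<longrightarrow> acf cF h 1 = 0"
proof -
  have hC: "h \<in> C0 (Omega l r)" and cap: "caputo (Phi_minus \<phi>) f h"
    and lc: "left_cond_bwd \<phi> l f" and rc: "right_cond_bwd \<phi> r f"
    using assms by (auto simp: G_minus_def)
  have h: "h \<in> L1" by (rule C0_L1[OF hC])
  have km: "Phi_minus \<phi> \<in> borel_measurable borel" using borel_measurable_Phi by measurable
  obtain u where u: "W11_deriv f u" and wd: "weak_deriv (conv (Phi_minus \<phi>) u) h"
    using cap by (auto simp: caputo_def caputo'_def)
  have uL: "u \<in> L1" and fu: "weak_deriv f u" using u by (auto simp: W11_deriv_def)
  obtain cf where cf: "f \<doteq> acf cf u"
    by (rule weak_deriv_acf[OF fu uL])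
  obtain cF where cF: "conv (Phi_minus \<phi>) u \<doteq> acf cF h"
    by (rule weak_deriv_acf[OF wd h])
  show ?thesis
  proof (rule that[OF uL cf cF])
    show "l = LD \<longrightarrow> acf cf u (-1) = 0"
    proof
      assume that: "l = LD"
      show "acf cf u (-1) = 0"
        using lc that by (intro vanishes_at_right_eq_0[OF _ cf isCont_acf[OF uL]]) simp
    qed
    show "l = LN \<longrightarrow> acf cF h (-1) = 0"
    proof
      assume that: "l = LN"
      show "acf cF h (-1) = 0"
        using lc that caputo'_unique[OF km u] by (intro vanishes_at_right_eq_0[OF _ cF isCont_acf[OF h]]) auto
    qed
    show "r = RD \<longrightarrow> acf cf u 1 = 0"
    proof
      assume that: "r = RD"
      show "acf cf u 1 = 0"
        using rc that by (intro vanishes_at_left_eq_0[OF _ cf isCont_acf[OF uL]]) simp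
    qed
    show "r = RN \<longrightarrow> acf cF h 1 = 0"
    proof
      assume that: "r = RN"
      show "acf cF h 1 = 0"
        using rc that caputo'_unique[OF km u] by (intro vanishes_at_left_eq_0[OF _ cF isCont_acf[OF h]]) auto
    qed
    show "l = LNstar \<longrightarrow> vanishes_at u (at_right (-1))"
    proof
      assume that: "l = LNstar"
      show "vanishes_at u (at_right (-1))"
      proof -
        have "left_cond_bwd \<phi> LNstar f" using lc that by (simp only:)
        then obtain v where "W11_deriv f v" "vanishes_at v (at_right (-1))" by auto
        then show ?thesis using vanishes_at_cong_AE W11_deriv_unique[OF _ u] by blast
      qed
    qed
  qed
qed

lemma G_plus_caputo_representation:
  assumes "(g, p) \<in> G_plus \<phi> l r" "l \<noteq> LNstar"
  obtains v cg cG where "v \<in> L1" "g \<doteq> acf cg v"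
    "conv (Phi \<phi>) v \<doteq> acf cG p"
    "l = LD \<longrightarrow> acf cg v (-1) = 0" "l = LN \<longrightarrow> acf cG p (-1) = 0"
    "r = RD \<longrightarrow> acf cg v 1 = 0" "r = RN \<longrightarrow> acf cG p 1 = 0"
proof -
  have p: "p \<in> L1" and cap: "caputo (Phi \<phi>) g p"
    and lc: "left_cond_fwd \<phi> l g" and rc: "right_cond_fwd \<phi> l r g"
    using assms by (auto simp: G_plus_def)
  note km = borel_measurable_Phi
  obtain v where v: "W11_deriv g v" and wd: "weak_deriv (conv (Phi \<phi>) v) p"
    using cap by (auto simp: caputo_def caputo'_def)
  have vL: "v \<in> L1" and gv: "weak_deriv g v" using v by (auto simp: W11_deriv_def)
  obtain cg where cg: "g \<doteq> acf cg v"
    by (rule weak_deriv_acf[OF gv vL])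
  obtain cG where cG: "conv (Phi \<phi>) v \<doteq> acf cG p"
    by (rule weak_deriv_acf[OF wd p])
  show ?thesis
  proof (rule that[OF vL cg cG])
    show "l = LD \<longrightarrow> acf cg v (-1) = 0"
    proof
      assume that: "l = LD"
      show "acf cg v (-1) = 0"
        using lc that by (intro vanishes_at_right_eq_0[OF _ cg isCont_acf[OF vL]]) simp
    qed
    show "l = LN \<longrightarrow> acf cG p (-1) = 0"
    proof
      assume that: "l = LN"
      show "acf cG p (-1) = 0"
        using lc that caputo'_unique[OF km v] by (intro vanishes_at_right_eq_0[OF _ cG isCont_acf[OF p]]) auto
    qed
    show "r = RD \<longrightarrow> acf cg v 1 = 0"
    proof
      assume that: "r = RD"
      show "acf cg v 1 = 0"
        using rc that by (intro vanishes_at_left_eq_0[OF _ cg isCont_acf[OF vL]]) simp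
    qed
    show "r = RN \<longrightarrow> acf cG p 1 = 0"
    proof
      assume that: "r = RN"
      show "acf cG p 1 = 0"
        using rc that assms(2) caputo'_unique[OF km v] by (intro vanishes_at_left_eq_0[OF _ cG isCont_acf[OF p]]) auto
    qed
  qed
qed

text \<open>Two weak derivatives of the convolution give a representative that is a primitive of an
  absolutely continuous function; hence the nested \<open>acf\<close>. Since g itself is only in
  L^1, the Dirichlet condition at 1 is kept as \<open>vanishes_at\<close>.\<close>

lemma G_plus_riemann_liouville_representation:
  assumes "(g, p) \<in> G_plus \<phi> LNstar r"
  obtains c0 cH where "conv (Phi \<phi>) g \<doteq> acf cH (acf c0 p)"
    "acf c0 p (-1) = 0" "r = RD \<longrightarrow> vanishes_at g (at_left 1)" "r = RN \<longrightarrow> acf c0 p 1 = 0"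
proof -
  have p: "p \<in> L1" and rl: "riemann_liouville \<phi> g p"
    and lc: "left_cond_fwd \<phi> LNstar g" and rc: "right_cond_fwd \<phi> LNstar r g"
    using assms by (auto simp: G_plus_def)
  obtain q where q: "weak_deriv (conv (Phi \<phi>) g) q" "weak_deriv q p"
    using rl by (auto simp: riemann_liouville_def riemann_liouville'_def)
  obtain c0 where c0: "q \<doteq> acf c0 p"
    by (rule weak_deriv_acf[OF q(2) p])
  have wd: "weak_deriv (conv (Phi \<phi>) g) (acf c0 p)"
    by (rule weak_deriv_cong_AE[OF q(1) c0 loc_integrable_acf[OF p]])
  obtain cH where cH: "conv (Phi \<phi>) g \<doteq> acf cH (acf c0 p)"
    by (rule weak_deriv_acf[OF wd acf_L1[OF p]])
  have AE_eq: "q' \<doteq> acf c0 p" if "riemann_liouville' \<phi> g q'" for q'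
    using that wd by (intro weak_deriv_unique) (auto simp: riemann_liouville'_def)
  show ?thesis
  proof (rule that[OF cH])
    show "acf c0 p (-1) = 0"
    proof -
      obtain q' where "riemann_liouville' \<phi> g q'" "vanishes_at q' (at_right (-1))" using lc by auto
      then show ?thesis using vanishes_at_right_eq_0[OF _ AE_eq isCont_acf[OF p]] by blast
    qed
    show "r = RD \<longrightarrow> vanishes_at g (at_left 1)" using rc by (cases r) auto
    show "r = RN \<longrightarrow> acf c0 p 1 = 0"
    proof
      assume that: "r = RN"
      show "acf c0 p 1 = 0"
      proof -
        have "right_cond_fwd \<phi> LNstar RN g" using rc that by (simp only:)
        then obtain q' where "riemann_liouville' \<phi> g q'" "vanishes_at q' (at_left 1)" by auto
        then show ?thesis using vanishes_at_left_eq_0[OF _ AE_eq isCont_acf[OF p]] by blast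
      qed
    qed
  qed
qed

lemma generators_dual:
  assumes fh: "(f, h) \<in> G_minus \<phi> l r" and gp: "(g, p) \<in> G_plus \<phi> l r"
  shows "(LBINT x:{-1..1}. h x * g x) = (LBINT x:{-1..1}. f x * p x)"
proof -
  have C: "f \<in> C0 (Omega l r)" "h \<in> C0 (Omega l r)" using fh by (auto simp: G_minus_def)
  have L: "f \<in> L1" "h \<in> L1" "g \<in> L1" "p \<in> L1" using gp C0_L1[OF C(1)] C0_L1[OF C(2)] by (auto simp: G_plus_def)
  obtain u cf cF where u: "u \<in> L1" "f \<doteq> acf cf u"
    "conv (Phi_minus \<phi>) u \<doteq> acf cF h"
    and b: "l = LD \<longrightarrow> acf cf u (-1) = 0" "l = LN \<longrightarrow> acf cF h (-1) = 0"
    "l = LNstar \<longrightarrow> vanishes_at u (at_right (-1))"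
    "r = RD \<longrightarrow> acf cf u 1 = 0" "r = RN \<longrightarrow> acf cF h 1 = 0"
    by (rule G_minus_representation[OF fh])
  show ?thesis
  proof (cases "l = LNstar")
    case True
    obtain c0 cH where H: "conv (Phi \<phi>) g \<doteq> acf cH (acf c0 p)"
      and c: "acf c0 p (-1) = 0" "r = RD \<longrightarrow> vanishes_at g (at_left 1)" "r = RN \<longrightarrow> acf c0 p 1 = 0"
      by (rule G_plus_riemann_liouville_representation[OF gp[unfolded True]])
    show ?thesis
    proof (rule riemann_liouville_duality[OF Phi_nonpos integrable_Phi borel_measurable_Phi L(1) u(1) L(2,3,4) _ _ u(2,3) H])
      show "continuous_on {-1<..<1} h" by (rule continuous_on_subset[OF C0_continuous_on[OF C(2)]]) auto
      show "\<bar>h x\<bar> \<le> sup_norm h" for x by (rule C0_abs_le[OF C(2)])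
      show "vanishes_at u (at_right (-1))" using b(3) True by simp
      show "acf c0 p (-1) = 0" by (rule c)
      \<comment> \<open>At 1 the condition D kills the first factor, a value of f, and N the second,
        a value of the derivative of \<open>conv (Phi \<phi>) g\<close>. In the next line D makes g
        small and N kills F.\<close>
      show "acf cf u 1 * acf c0 p 1 = 0" using b(4) c(3) by (cases r) auto
      show "vanishes_at g (at_left 1) \<or> acf cF h 1 = 0" using b(5) c(2) by (cases r) auto
    qed
  next
    case False
    obtain v cg cG where v: "v \<in> L1" "g \<doteq> acf cg v"
      "conv (Phi \<phi>) v \<doteq> acf cG p"
      and c: "l = LD \<longrightarrow> acf cg v (-1) = 0" "l = LN \<longrightarrow> acf cG p (-1) = 0"
      "r = RD \<longrightarrow> acf cg v 1 = 0" "r = RN \<longrightarrow> acf cG p 1 = 0"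
      by (rule G_plus_caputo_representation[OF gp False])
    show ?thesis
    proof (rule caputo_duality[OF Phi_nonpos integrable_Phi borel_measurable_Phi L(1) u(1) L(2,3) v(1) L(4) u(2,3) v(2,3)])
      show "acf cF h 1 * acf cg v 1 = acf cf u 1 * acf cG p 1" using b(4,5) c(3,4) by (cases r) auto
      show "acf cF h (-1) * acf cg v (-1) = acf cf u (-1) * acf cG p (-1)"
        using b(1,2) c(1,2) False by (cases l) auto
    qed
  qed
qed

end

text \<open>\<open>dual_op\<close> is restricted to the dual space, so this membership is what
  allows it to be evaluated at an embedded function.\<close>

lemma dual_embed_C0_in_dual_space:
  assumes "g \<in> L1"
  shows "dual_embed (C0 (Omega l r)) g \<in> dual_space (C0 (Omega l r)) sup_norm"
proof -
  have "\<bar>dual_embed (C0 (Omega l r)) g f\<bar> \<le> L1_norm g * sup_norm f" if "f \<in> C0 (Omega l r)" for f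
    using pairing_bound[OF that assms] that by (simp add: dual_embed_def mult.commute)
  then show ?thesis
    unfolding dual_space_def
  proof (intro CollectI conjI ballI allI exI[of _ "L1_norm g"])
    show "dual_embed (C0 (Omega l r)) g (\<lambda>x. a * f x + b * f' x) =
        a * dual_embed (C0 (Omega l r)) g f + b * dual_embed (C0 (Omega l r)) g f'"
      if "f \<in> C0 (Omega l r)" "f' \<in> C0 (Omega l r)" for f f' a b
      using pairing_left[OF that assms, of a b] C0_lincomb[OF that, of a b] that by (simp add: dual_embed_def)
  qed (auto simp: dual_embed_def)
qed

lemma dual_embed_L1_in_dual_space:
  assumes "f \<in> C0 (Omega l r)"
  shows "dual_embed L1 f \<in> dual_space L1 L1_norm"
proof -
  have "\<bar>dual_embed L1 f g\<bar> \<le> sup_norm f * L1_norm g" if "g \<in> L1" for g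
    using pairing_bound[OF assms that] that by (simp add: dual_embed_def mult.commute)
  then show ?thesis
    unfolding dual_space_def
  proof (intro CollectI conjI ballI allI exI[of _ "sup_norm f"])
    show "dual_embed L1 f (\<lambda>x. a * g x + b * g' x) = a * dual_embed L1 f g + b * dual_embed L1 f g'"
      if "g \<in> L1" "g' \<in> L1" for g g' a b
      using pairing_right[OF assms that, of a b] L1_lincomb[OF that, of a b] that
      by (simp add: dual_embed_def mult.commute[of _ "f _"])
  qed (auto simp: dual_embed_def)
qed

theorem corollary5p4:
  fixes \<phi> :: "real measure"
    and l :: left_bc and r :: right_bc
    and P Q :: "real \<Rightarrow> (real \<Rightarrow> real) \<Rightarrow> (real \<Rightarrow> real)"
  assumes "sets \<phi> = sets (restrict_space borel {0<..})"
    and "(\<integral>\<^sup>+ z. ennreal (min (z\<^sup>2) z) \<partial>\<phi>) < \<infinity>"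
    and "(\<integral>\<^sup>+ z. ennreal z * indicator {0<..<1} z \<partial>\<phi>) = \<infinity>"
    and "pos_contraction_semigroup (C0 (Omega l r)) sup_norm P"
    and "generator (C0 (Omega l r)) sup_norm P = G_minus \<phi> l r"
    and "pos_contraction_semigroup L1 L1_norm Q"
    and "generator L1 L1_norm Q = G_plus \<phi> l r"
  shows "(\<forall>t\<ge>0. \<forall>g\<in>L1.
            dual_op (C0 (Omega l r)) sup_norm (P t) (dual_embed (C0 (Omega l r)) g)
              = dual_embed (C0 (Omega l r)) (Q t g)) \<and>
         (\<forall>t\<ge>0. \<forall>f\<in>C0 (Omega l r).
            dual_op L1 L1_norm (Q t) (dual_embed L1 f) = dual_embed L1 (P t f))"
proof -
  interpret levy \<phi> by unfold_locales (fact assms(1), fact assms(2))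
  interpret X: function_space "C0 (Omega l r)" sup_norm by (rule function_space_C0)
  interpret Y: function_space L1 L1_norm by (rule function_space_L1)
  interpret semigroup_pairing "C0 (Omega l r)" sup_norm P L1 L1_norm Q "\<lambda>f g. LBINT x:{-1..1}. f x * g x"
  proof unfold_locales
    show "pos_contraction_semigroup (C0 (Omega l r)) sup_norm P" "pos_contraction_semigroup L1 L1_norm Q"
      by (fact assms)+
    show "(LBINT x:{-1..1}. f' x * g x) = (LBINT x:{-1..1}. f x * g' x)"
      if "(f, f') \<in> generator (C0 (Omega l r)) sup_norm P" "(g, g') \<in> generator L1 L1_norm Q" for f f' g g'
      using that unfolding assms(5,7) by (rule generators_dual)
  qed (rule pairing_left pairing_right pairing_bound; assumption)+
  have dual: "(LBINT x:{-1..1}. P t f x * g x) = (LBINT x:{-1..1}. f x * Q t g x)"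
    if "t \<ge> 0" "f \<in> C0 (Omega l r)" "g \<in> L1" for t f g
    using pairing_duality[OF that(2,3,1)] .
  show ?thesis
  proof (intro conjI allI impI ballI)
    fix t :: real and g assume t: "0 \<le> t" and g: "g \<in> L1"
    show "dual_op (C0 (Omega l r)) sup_norm (P t) (dual_embed (C0 (Omega l r)) g) = dual_embed (C0 (Omega l r)) (Q t g)"
    proof
      fix f
      \<comment> \<open>For f outside \<open>C0 (Omega l r)\<close> both functionals take the value
        \<open>undefined\<close>, being restrictions, so they agree as total functions.\<close>
      show "dual_op (C0 (Omega l r)) sup_norm (P t) (dual_embed (C0 (Omega l r)) g) f = dual_embed (C0 (Omega l r)) (Q t g) f"
        using dual_embed_C0_in_dual_space[OF g, of l r] dual[OF t _ g, of f] P.T_closed[OF t, of f]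
        by (simp add: dual_op_def dual_embed_def restrict_def)
    qed
  next
    fix t :: real and f assume t: "0 \<le> t" and f: "f \<in> C0 (Omega l r)"
    show "dual_op L1 L1_norm (Q t) (dual_embed L1 f) = dual_embed L1 (P t f)"
    proof
      fix g
      show "dual_op L1 L1_norm (Q t) (dual_embed L1 f) g = dual_embed L1 (P t f) g"
        using dual_embed_L1_in_dual_space[OF f] dual[OF t f, of g] Q.T_closed[OF t, of g]
        by (simp add: dual_op_def dual_embed_def restrict_def mult.commute)
    qed
  qed
qed

end
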